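(* Let $n\ge 2$, let $\Omega\subset\mathbb{C}^n$ be a domain, let $\pi:E\to\Omega$ be a holomorphic vector bundle and $h$ a smooth Hermitian metric on $E$ with Chern curvature $\Theta_h$. For fixed $a\in\Omega$ and $\xi\in E_a\setminus\{0\}$, the $L^2$-extension index $L_h$ has the expansion $$ L_{h}(a,r,s,A,\xi)=1-\frac{r^2}{2}\,\frac{\langle\Theta_h(Ae_1,\overline{Ae_1})\xi,\xi\rangle_{h(a)}}{|\xi|^2_{h(a)}}-\frac{s^2}{n}\sum_{j=2}^n\frac{\langle\Theta_h(Ae_j,\overline{Ae_j})\xi,\xi\rangle_{h(a)}}{|\xi|^2_{h(a)}}+O\big((r^2+s^2)^2\big), $$ as $(r,s)\to(0,0)$ with $r,s>0$, for $A\in\mathbf{U}(n)$, where $\{e_1,\dots,e_n\}$ is the standard basis of $\mathbb{C}^n$ and the constant in the $O$-term does not depend on $r,s,A$.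
   Context: $\mathbf{U}(n)$ is the unitary group of degree $n$. $\Delta_r\subset\mathbb{C}$ is the open disc of radius $r$ centered at $0$ and $\mathbb{B}^{k}_s\subset\mathbb{C}^k$ is the open ball of radius $s$ centered at $0$. For $r,s>0$, $A\in\mathbf{U}(n)$, put $P_{r,s,A}=A(\Delta_r\times\mathbb{B}^{n-1}_s)$ (holomorphic cylinder), and let $|P_{r,s,A}|$ be its Lebesgue measure. For $a\in\Omega$, $r,s>0$, $A\in\mathbf{U}(n)$ with $a+P_{r,s,A}\subset\Omega$, and $\xi\in E_a\setminus\{0\}$, the $L^2$-extension index of $h$ is $$L_h(a,r,s,A,\xi)=\inf\left\{\frac{\int_{a+P_{r,s,A}}|\sigma|_h^2}{|P_{r,s,A}|\,|\xi|^2_{h(a)}}\ \middle|\ \sigma\in A^2(a+P_{r,s,A},E;h),\ \sigma(a)=\xi\right\},$$ where $A^2(a+P_{r,s,A},E;h)$ is the space of holomorphic sections of $E$ on $a+P_{r,s,A}$ that are square integrable with respect to $h$ (and Lebesgue measure). Curvature convention: writing $\Theta_h=\sum_{j,k}\Theta_{h,j\bar k}\,dz_j\wedge d\bar z_k$ with $\Theta_{h,j\bar k}\in\mathrm{End}(E)$, we set $\Theta_h(v,\bar v)=\sum_{j,k}\Theta_{h,j\bar k}(a)v_j\bar v_k$ for $v\in\mathbb{C}^n$. The sign is such that for a line bundle with $h=e^{-\varphi}$ one has $\Theta_{h,j\bar k}=\partial^2\varphi/\partial z_j\partial\bar z_k$. *)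

theory Defs
  imports "HOL-Analysis.Analysis"
begin

section \<open>Functions of several complex variables\<close>

text \<open>Holomorphic on an open set: real Frechet differentiable with complex linear derivative.\<close>

definition holomorphic_fun_on :: "(complex^'n \<Rightarrow> complex) \<Rightarrow> (complex^'n) set \<Rightarrow> bool"
  where "holomorphic_fun_on f U \<longleftrightarrow>
    (\<forall>z\<in>U. \<exists>D. (f has_derivative D) (at z) \<and> (\<forall>c v. D (c *s v) = c * D v))"

text \<open>Real differentiability classes on an open set, where \<open>Ck_on k\<close> is $C^k$.\<close>

primrec Ck_on :: "nat \<Rightarrow> ('a::euclidean_space \<Rightarrow> 'b::euclidean_space) \<Rightarrow> 'a set \<Rightarrow> bool" where
  "Ck_on 0 f U \<longleftrightarrow> continuous_on U f"
| "Ck_on (Suc k) f U \<longleftrightarrow>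
     (\<forall>x\<in>U. f differentiable (at x)) \<and>
     (\<forall>v. Ck_on k (\<lambda>x. frechet_derivative f (at x) v) U)"

definition smooth_on :: "('a::euclidean_space \<Rightarrow> 'b::euclidean_space) \<Rightarrow> 'a set \<Rightarrow> bool"
  where "smooth_on f U \<longleftrightarrow> (\<forall>k. Ck_on k f U)"

text \<open>The Wirtinger derivatives $\partial f/\partial z_j$ and $\partial f/\partial \bar z_j$.\<close>

definition dz :: "'n \<Rightarrow> (complex^'n \<Rightarrow> complex) \<Rightarrow> complex^'n \<Rightarrow> complex"
  where "dz j f z =
    (frechet_derivative f (at z) (axis j 1) - \<i> * frechet_derivative f (at z) (axis j \<i>)) / 2"

definition dzbar :: "'n \<Rightarrow> (complex^'n \<Rightarrow> complex) \<Rightarrow> complex^'n \<Rightarrow> complex"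
  where "dzbar j f z =
    (frechet_derivative f (at z) (axis j 1) + \<i> * frechet_derivative f (at z) (axis j \<i>)) / 2"


section \<open>Holomorphic vector bundles\<close>

text \<open>
  A bundle consists of a total space with its projection, the vector space operations of the
  fibres, and an atlas of local trivializations. A member \<open>(U, \<phi>)\<close> of the atlas
  stands for the trivialization $u \mapsto (\pi(u), \phi(u))$ of $\pi^{-1}(U)$; only
  its second component is recorded. The topology and the complex structure of the total space are
  those induced by the atlas. The rank is the cardinality of the type \<open>'r\<close>; over a
  connected base it is constant, and rank 0 is irrelevant for statements about a non-zero vector.
\<close>

record ('e, 'n, 'r) vec_bundle =
  total :: "'e set"
  proj :: "'e \<Rightarrow> complex^'n"
  fib_zero :: "complex^'n \<Rightarrow> 'e"
  fib_add :: "'e \<Rightarrow> 'e \<Rightarrow> 'e"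
  fib_scale :: "complex \<Rightarrow> 'e \<Rightarrow> 'e"
  trivs :: "((complex^'n) set \<times> ('e \<Rightarrow> complex^'r)) set"

definition fiber :: "('e, 'n::finite, 'r::finite) vec_bundle \<Rightarrow> complex^'n \<Rightarrow> 'e set"
  where "fiber E x = {u \<in> total E. proj E u = x}"

definition frame ::
  "('e, 'n::finite, 'r::finite) vec_bundle \<Rightarrow> ('e \<Rightarrow> complex^'r) \<Rightarrow> 'r \<Rightarrow> complex^'n \<Rightarrow> 'e"
  where "frame E \<phi> \<alpha> x = inv_into (fiber E x) \<phi> (axis \<alpha> 1)"

text \<open>
  The entries of the transition matrix from \<open>\<phi>\<close> to \<open>\<psi>\<close> are
  the \<open>\<psi>\<close>-components of the frame belonging to \<open>\<phi>\<close>. The vector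
  space axioms in the fibres follow from the fibrewise linear bijections onto \<open>complex^'r\<close>.
\<close>

locale holomorphic_vector_bundle =
  fixes \<Omega> :: "(complex^'n::finite) set" and E :: "('e, 'n, 'r::finite) vec_bundle"
  assumes proj_in: "u \<in> total E \<Longrightarrow> proj E u \<in> \<Omega>"
    and zero_in: "x \<in> \<Omega> \<Longrightarrow> fib_zero E x \<in> fiber E x"
    and add_in: "\<lbrakk>x \<in> \<Omega>; u \<in> fiber E x; v \<in> fiber E x\<rbrakk> \<Longrightarrow> fib_add E u v \<in> fiber E x"
    and scale_in: "\<lbrakk>x \<in> \<Omega>; u \<in> fiber E x\<rbrakk> \<Longrightarrow> fib_scale E c u \<in> fiber E x"
    and trivs_cover: "x \<in> \<Omega> \<Longrightarrow> \<exists>U \<phi>. (U, \<phi>) \<in> trivs E \<and> x \<in> U"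
    and trivs_open: "(U, \<phi>) \<in> trivs E \<Longrightarrow> open U \<and> U \<subseteq> \<Omega>"
    and trivs_bij: "\<lbrakk>(U, \<phi>) \<in> trivs E; x \<in> U\<rbrakk> \<Longrightarrow> bij_betw \<phi> (fiber E x) UNIV"
    and trivs_zero: "\<lbrakk>(U, \<phi>) \<in> trivs E; x \<in> U\<rbrakk> \<Longrightarrow> \<phi> (fib_zero E x) = 0"
    and trivs_add: "\<lbrakk>(U, \<phi>) \<in> trivs E; x \<in> U; u \<in> fiber E x; v \<in> fiber E x\<rbrakk>
          \<Longrightarrow> \<phi> (fib_add E u v) = \<phi> u + \<phi> v"
    and trivs_scale: "\<lbrakk>(U, \<phi>) \<in> trivs E; x \<in> U; u \<in> fiber E x\<rbrakk>
          \<Longrightarrow> \<phi> (fib_scale E c u) = c *s \<phi> u"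
    and trivs_trans: "\<lbrakk>(U, \<phi>) \<in> trivs E; (V, \<psi>) \<in> trivs E\<rbrakk>
          \<Longrightarrow> holomorphic_fun_on (\<lambda>x. \<psi> (frame E \<phi> \<beta> x) $ \<alpha>) (U \<inter> V)"

definition holomorphic_section_on ::
  "('e, 'n::finite, 'r::finite) vec_bundle \<Rightarrow> (complex^'n) set \<Rightarrow> (complex^'n \<Rightarrow> 'e) \<Rightarrow> bool"
  where "holomorphic_section_on E D \<sigma> \<longleftrightarrow>
    (\<forall>x\<in>D. \<sigma> x \<in> fiber E x) \<and>
    (\<forall>(U, \<phi>)\<in>trivs E. \<forall>\<alpha>. holomorphic_fun_on (\<lambda>x. \<phi> (\<sigma> x) $ \<alpha>) (U \<inter> D))"


section \<open>Hermitian metrics and the Chern curvature\<close>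

text \<open>A metric is linear in its first and conjugate linear in its second argument.\<close>

definition smooth_hermitian_metric ::
  "(complex^'n::finite) set \<Rightarrow> ('e, 'n, 'r::finite) vec_bundle \<Rightarrow> ('e \<Rightarrow> 'e \<Rightarrow> complex) \<Rightarrow> bool"
  where "smooth_hermitian_metric \<Omega> E h \<longleftrightarrow>
    (\<forall>x\<in>\<Omega>. \<forall>u\<in>fiber E x. \<forall>v\<in>fiber E x.
       (\<forall>w\<in>fiber E x. h (fib_add E u v) w = h u w + h v w) \<and>
       (\<forall>c. h (fib_scale E c u) v = c * h u v) \<and>
       h v u = cnj (h u v)) \<and>
    (\<forall>x\<in>\<Omega>. \<forall>u\<in>fiber E x. u \<noteq> fib_zero E x \<longrightarrow> 0 < Re (h u u)) \<and>
    (\<forall>(U, \<phi>)\<in>trivs E. \<forall>\<alpha> \<beta>. smooth_on (\<lambda>x. h (frame E \<phi> \<alpha> x) (frame E \<phi> \<beta> x)) U)"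

definition hnorm2 :: "('e \<Rightarrow> 'e \<Rightarrow> complex) \<Rightarrow> 'e \<Rightarrow> real"
  where "hnorm2 h u = Re (h u u)"

text \<open>
  The Gram matrix $H$ of the holomorphic frame of \<open>\<phi>\<close>, indexed such that
  $\langle u, v\rangle = v^* H u$ for coordinate columns. The Chern connection, i.e. the
  metric connection with (0,1)-part $\bar\partial$, is then $d + \theta$ with
  $\theta = H^{-1}\,\partial H = \sum_j \theta_j\, dz_j$.
\<close>

definition gram ::
  "('e, 'n::finite, 'r::finite) vec_bundle \<Rightarrow> ('e \<Rightarrow> 'e \<Rightarrow> complex) \<Rightarrow> ('e \<Rightarrow> complex^'r)
    \<Rightarrow> complex^'n \<Rightarrow> complex^'r^'r"
  where "gram E h \<phi> x = (\<chi> \<alpha> \<beta>. h (frame E \<phi> \<beta> x) (frame E \<phi> \<alpha> x))"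

definition chern_connection ::
  "('e, 'n::finite, 'r::finite) vec_bundle \<Rightarrow> ('e \<Rightarrow> 'e \<Rightarrow> complex) \<Rightarrow> ('e \<Rightarrow> complex^'r)
    \<Rightarrow> 'n \<Rightarrow> complex^'n \<Rightarrow> complex^'r^'r"
  where "chern_connection E h \<phi> j x =
    matrix_inv (gram E h \<phi> x) ** (\<chi> \<alpha> \<beta>. dz j (\<lambda>y. gram E h \<phi> y $ \<alpha> $ \<beta>) x)"

text \<open>
  The curvature is $d\theta + \theta\wedge\theta = \bar\partial\theta$, so its coefficient of
  $dz_j\wedge d\bar z_k$ is $-\partial\theta_j/\partial\bar z_k$. For a line bundle with
  $H = e^{-\varphi}$ this is $\partial^2\varphi/\partial z_j\partial\bar z_k$.
\<close>

definition curvature_coeff ::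
  "('e, 'n::finite, 'r::finite) vec_bundle \<Rightarrow> ('e \<Rightarrow> 'e \<Rightarrow> complex) \<Rightarrow> ('e \<Rightarrow> complex^'r)
    \<Rightarrow> 'n \<Rightarrow> 'n \<Rightarrow> complex^'n \<Rightarrow> complex^'r^'r"
  where "curvature_coeff E h \<phi> j k x =
    (\<chi> \<alpha> \<beta>. - dzbar k (\<lambda>y. chern_connection E h \<phi> j y $ \<alpha> $ \<beta>) x)"

text \<open>
  \<open>chern_curvature E h a v\<close> is the endomorphism $\Theta_h(v,\bar v)$ of the fibre
  over \<open>a\<close>. A holomorphic change of frame conjugates the curvature matrix, so the
  choice of the trivialization around \<open>a\<close> is immaterial.
\<close>

definition chern_curvature ::
  "('e, 'n::finite, 'r::finite) vec_bundle \<Rightarrow> ('e \<Rightarrow> 'e \<Rightarrow> complex) \<Rightarrow> complex^'n \<Rightarrow> complex^'n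
    \<Rightarrow> 'e \<Rightarrow> 'e"
  where "chern_curvature E h a v u =
    (let \<phi> = (SOME \<phi>. \<exists>U. (U, \<phi>) \<in> trivs E \<and> a \<in> U);
         M = (\<chi> \<alpha> \<beta>. \<Sum>j\<in>UNIV. \<Sum>k\<in>UNIV.
                curvature_coeff E h \<phi> j k a $ \<alpha> $ \<beta> * v $ j * cnj (v $ k))
     in inv_into (fiber E a) \<phi> (M *v \<phi> u))"


section \<open>Holomorphic cylinders and the $L^2$-extension index\<close>

definition unitary_group :: "(complex^'n^'n) set"
  where "unitary_group = {A. (\<chi> i j. cnj (A $ j $ i)) ** A = mat 1 \<and>
                             A ** (\<chi> i j. cnj (A $ j $ i)) = mat 1}"

text \<open>
  The index type has no preferred element, so the coordinate called $z_1$ is given by an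
  index \<open>o1\<close>; the others are the coordinates $z_2, \dots, z_n$.
\<close>

definition cylinder :: "'n \<Rightarrow> real \<Rightarrow> real \<Rightarrow> complex^'n^'n \<Rightarrow> (complex^'n) set"
  where "cylinder o1 r s A =
    (\<lambda>z. A *v z) ` {z. norm (z $ o1) < r \<and> sqrt (\<Sum>j\<in>UNIV - {o1}. (norm (z $ j))\<^sup>2) < s}"

definition A2 ::
  "('e, 'n::finite, 'r::finite) vec_bundle \<Rightarrow> ('e \<Rightarrow> 'e \<Rightarrow> complex) \<Rightarrow> (complex^'n) set
    \<Rightarrow> (complex^'n \<Rightarrow> 'e) set"
  where "A2 E h D =
    {\<sigma>. holomorphic_section_on E D \<sigma> \<and> set_integrable lborel D (\<lambda>x. hnorm2 h (\<sigma> x))}"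

text \<open>The infimum is taken in the extended reals, so it is $\infty$ if there is no such section.\<close>

definition L2_extension_index ::
  "('e, 'n::finite, 'r::finite) vec_bundle \<Rightarrow> ('e \<Rightarrow> 'e \<Rightarrow> complex) \<Rightarrow> 'n
    \<Rightarrow> complex^'n \<Rightarrow> real \<Rightarrow> real \<Rightarrow> complex^'n^'n \<Rightarrow> 'e \<Rightarrow> ereal"
  where "L2_extension_index E h o1 a r s A \<xi> =
    (INF \<sigma>\<in>{\<sigma> \<in> A2 E h ((+) a ` cylinder o1 r s A). \<sigma> a = \<xi>}.
       ereal ((LINT x:(+) a ` cylinder o1 r s A|lborel. hnorm2 h (\<sigma> x))
              / (measure lborel (cylinder o1 r s A) * hnorm2 h \<xi>)))"

end

theory Submission
  imports Defs "HOL-Complex_Analysis.Cauchy_Integral_Formula"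
begin

unbundle no fps_syntax

text \<open>
  In a trivialization around \<open>a\<close> the metric is a positive definite Hermitian matrix \<open>H x\<close> and
  sections are vector valued holomorphic functions \<open>u\<close>, with squared length \<open>(H x *v u x) \<bullet> u x\<close>;
  the real inner product of \<open>complex^'r\<close> is the real part of the Hermitian one. Write \<open>\<xi>\<close> also
  for the coordinates of the given vector, \<open>P\<close> for the translated cylinder, \<open>V\<close> for its volume,
  and \<open>\<theta> v x = H\<inverse> \<partial>\<^sub>v H\<close> for the Chern connection form along \<open>v\<close>.

  The expansion is that of the energy of a single test section, the affine function
  \<open>e x = \<xi> - \<theta> (x - a) a \<xi>\<close>. It is chosen such that the \<open>(1,0)\<close>-part of the derivative of \<open>H e\<close>
  vanishes at \<open>a\<close>, that is, \<open>H e\<close> equals a constant plus an antilinear term up to second order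
  (\<open>dderiv_test_dual_antilinear\<close>).

  Upper bound. The cylinder is symmetric about its centre, so only the even part of the density
  \<open>(H e) \<bullet> e\<close> contributes to its integral: the value at \<open>a\<close>, half of the second derivative, and
  an error of fourth order. The symmetries of the cylinder reduce the integral of the quadratic
  term to the sums of the second derivatives along \<open>A e\<^sub>j\<close> and \<open>\<i> A e\<^sub>j\<close>, weighted with the second
  moments, which are \<open>V r\<^sup>2/2\<close> for the first coordinate and \<open>V s\<^sup>2/n\<close> for the others
  (\<open>integral_quadratic_std_cylinder\<close>). By the choice of \<open>e\<close> these sums are \<open>-4\<close> times the
  curvature terms (\<open>dderiv_dderiv_test_norm2_sum\<close> and \<open>inner_curvature\<close>).

  Lower bound. A competitor is \<open>u = e + \<tau>\<close> with \<open>\<tau>\<close> holomorphic and \<open>\<tau> a = 0\<close>. In the expansion of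
  \<open>(H u) \<bullet> u\<close> the mixed term is \<open>2 (H e) \<bullet> \<tau>\<close>. Replacing \<open>H e\<close> by its constant and antilinear part
  turns it into the real part of a holomorphic function vanishing at \<open>a\<close>, whose integral over the
  circled set \<open>P\<close> is zero (\<open>set_integral_holomorphic_circled_eq_0\<close>). The remainder is at most
  \<open>C (r\<^sup>2 + s\<^sup>2) |\<tau>|\<close>, and \<open>(H \<tau>) \<bullet> \<tau> \<ge> c |\<tau>|\<^sup>2\<close> absorbs it at the cost of a pointwise error of
  order \<open>(r\<^sup>2 + s\<^sup>2)\<^sup>2\<close> (\<open>integral_lower_bound\<close>). All constants come from Taylor bounds and
  positivity of \<open>H\<close> on one fixed ball about \<open>a\<close>, hence they are uniform in \<open>A\<close>.

  Lebesgue measure is invariant under unitary maps because balls are; this gives both the change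
  to cylinder coordinates and the averaging over circles.
\<close>

section \<open>Lebesgue measure and orthogonal transformations\<close>

text \<open>
  By the Vitali covering theorem \<open>W\<close> is a disjoint union of balls up to a null set, and an
  orthogonal map sends these balls to disjoint balls of the same radii inside the image.
\<close>

lemma emeasure_le_orthogonal_image:
  fixes T :: "'a::euclidean_space \<Rightarrow> 'a"
  assumes T: "orthogonal_transformation T" and W: "open W"
  shows "emeasure lborel W \<le> emeasure lborel (T ` W)"
proof -
  define K where "K = {(x::'a, \<rho>::real). 0 < \<rho> \<and> ball x \<rho> \<subseteq> W}"
  have "\<exists>i. i \<in> K \<and> x \<in> ball (fst i) (snd i) \<and> snd i < d" if x: "x \<in> W" "0 < d" for x d
  proof -
    obtain e where e: "e > 0" "ball x e \<subseteq> W" using W x open_contains_ball by blast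
    have "ball x (min e (d/2)) \<subseteq> W" using e by auto
    then show ?thesis using e x by (intro exI[of _ "(x, min e (d/2))"]) (auto simp: K_def)
  qed
  then obtain C where C: "countable C" "C \<subseteq> K"
      "pairwise (\<lambda>i j. disjnt (ball (fst i) (snd i)) (ball (fst j) (snd j))) C"
      "negligible (W - (\<Union>i\<in>C. ball (fst i) (snd i)))"
    using Vitali_covering_theorem_balls[of W K fst snd] by blast
  define B where "B i = ball (fst i) (snd i)" for i :: "'a \<times> real"
  have TB: "T ` B i = ball (T (fst i)) (snd i)" for i
    using image_orthogonal_transformation_ball[OF T] by (simp add: B_def)
  have inj: "inj T" using T by (rule orthogonal_transformation_inj)
  have sub: "(\<Union>i\<in>C. B i) \<subseteq> W" using C(2) by (fastforce simp: K_def B_def)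
  have disj: "disjoint_family_on B C"
    using C(3) by (auto simp: disjoint_family_on_def pairwise_def disjnt_def B_def)
  have disjT: "disjoint_family_on (\<lambda>i. T ` B i) C"
    using disj unfolding disjoint_family_on_def by (metis image_Int[OF inj] image_empty)
  have same: "emeasure lborel (T ` B i) = emeasure lborel (B i)" if "i \<in> C" for i
  proof -
    have "snd i > 0" using that C(2) by (auto simp: K_def)
    then show ?thesis by (simp only: TB) (simp add: B_def emeasure_ball)
  qed
  have null: "W - (\<Union>i\<in>C. B i) \<in> null_sets lborel"
  proof -
    have "W - (\<Union>i\<in>C. B i) \<in> sets borel"
      by (intro sets.Diff borel_open W open_UN) (auto simp: B_def)
    with C(4) show ?thesis
      by (simp add: negligible_iff_null_sets null_sets_completion_iff B_def)
  qed
  have "emeasure lborel W = emeasure lborel (\<Union>i\<in>C. B i)"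
  proof -
    have eq: "W = (\<Union>i\<in>C. B i) \<union> (W - (\<Union>i\<in>C. B i))" using sub by auto
    have "(\<Union>i\<in>C. B i) \<in> sets lborel" by (auto simp: B_def intro!: borel_open open_UN)
    then show ?thesis by (subst eq) (rule emeasure_Un_null_set[OF _ null])
  qed
  also have "\<dots> = (\<integral>\<^sup>+i. emeasure lborel (B i) \<partial>count_space C)"
    by (rule emeasure_UN_countable) (use C(1) disj in \<open>simp_all add: B_def[abs_def]\<close>)
  also have "\<dots> = (\<integral>\<^sup>+i. emeasure lborel (T ` B i) \<partial>count_space C)"
    by (rule nn_integral_cong) (simp add: same)
  also have "\<dots> = emeasure lborel (\<Union>i\<in>C. T ` B i)"
    by (rule emeasure_UN_countable[symmetric]) (use C(1) disjT in \<open>simp_all add: TB\<close>)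
  also have "\<dots> \<le> emeasure lborel (T ` W)"
  proof (rule emeasure_mono)
    show "(\<Union>i\<in>C. T ` B i) \<subseteq> T ` W" using sub by auto
    have "open (T ` W)"
      by (intro open_surjective_linear_image W orthogonal_transformation_linear
          orthogonal_transformation_surj T)
    then show "T ` W \<in> sets lborel" by simp
  qed
  finally show ?thesis .
qed

text \<open>
  The preceding inequality for \<open>T\<close> and for its inverse shows that boxes keep their measure.
\<close>

lemma distr_lborel_orthogonal:
  fixes T :: "'a::euclidean_space \<Rightarrow> 'a"
  assumes T: "orthogonal_transformation T"
  shows "distr lborel borel T = lborel"
proof -
  have lin: "linear T" using T by (rule orthogonal_transformation_linear)
  have bij: "bij T" using T by (rule orthogonal_transformation_bij)
  have cont: "continuous_on UNIV T" using lin by (simp add: linear_continuous_on linear_linear)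
  have meas[measurable]: "T \<in> borel_measurable borel"
    by (rule borel_measurable_continuous_onI[OF cont])
  have "lborel = distr lborel borel T"
  proof (rule lborel_eqI)
    fix l u :: 'a assume lu: "\<And>b. b \<in> Basis \<Longrightarrow> l \<bullet> b \<le> u \<bullet> b"
    have op: "open (T -` box l u)" by (rule open_vimage[OF open_box cont])
    have eq: "inv T ` (box l u) = T -` box l u" using bij by (metis bij_vimage_eq_inv_image)
    have eq2: "T ` (T -` box l u) = box l u" using bij by (metis bij_is_surj surj_image_vimage_eq)
    have "emeasure lborel (T -` box l u) \<le> emeasure lborel (box l u)"
      using emeasure_le_orthogonal_image[OF T op] eq2 by simp
    moreover have "emeasure lborel (box l u) \<le> emeasure lborel (T -` box l u)"
      using emeasure_le_orthogonal_image[OF orthogonal_transformation_inv[OF T] open_box, of l u] eq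
      by simp
    ultimately have "emeasure lborel (T -` box l u) = emeasure lborel (box l u)" by simp
    then show "emeasure (distr lborel borel T) (box l u) = (\<Prod>b\<in>Basis. (u - l) \<bullet> b)"
      by (simp add: emeasure_distr emeasure_lborel_box lu)
  qed simp
  then show ?thesis by simp
qed

lemma set_integral_orthogonal_image:
  fixes T :: "'a::euclidean_space \<Rightarrow> 'a" and g :: "'a \<Rightarrow> 'b::{banach,second_countable_topology}"
  assumes T: "orthogonal_transformation T"
    and meas: "set_borel_measurable lborel ((+) a ` T ` S) g"
  shows "(LINT x:(+) a ` T ` S|lborel. g x) = (LINT w:S|lborel. g (a + T w))"
    and "set_integrable lborel ((+) a ` T ` S) g \<longleftrightarrow> set_integrable lborel S (\<lambda>w. g (a + T w))"
proof -
  have cont: "continuous_on UNIV T"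
    using orthogonal_transformation_linear[OF T] by (simp add: linear_continuous_on linear_linear)
  have [measurable]: "T \<in> borel_measurable borel" by (rule borel_measurable_continuous_onI[OF cont])
  have d: "distr lborel borel (\<lambda>w. a + T w) = lborel"
  proof -
    have "distr lborel borel (\<lambda>w. a + T w) = distr (distr lborel borel T) borel ((+) a)"
      by (simp add: distr_distr o_def)
    then show ?thesis by (simp add: distr_lborel_orthogonal[OF T] lborel_distr_plus)
  qed
  have ind: "indicat_real ((+) a ` T ` S) (a + T w) = indicat_real S w" for w
    using orthogonal_transformation_inj[OF T]
    by (simp add: indicator_def inj_image_mem_iff)
  let ?G = "\<lambda>x. indicat_real ((+) a ` T ` S) x *\<^sub>R g x"
  have G: "?G \<in> borel_measurable borel"
    using meas unfolding set_borel_measurable_def by (simp add: measurable_lborel1)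
  have "(LINT x:(+) a ` T ` S|lborel. g x) = integral\<^sup>L (distr lborel borel (\<lambda>w. a + T w)) ?G"
    by (simp add: d set_lebesgue_integral_def)
  also have "\<dots> = (LINT w|lborel. ?G (a + T w))"
    by (rule integral_distr) (use G in auto)
  finally show "(LINT x:(+) a ` T ` S|lborel. g x) = (LINT w:S|lborel. g (a + T w))"
    by (simp add: ind set_lebesgue_integral_def)
  have "integrable lborel ?G \<longleftrightarrow> integrable (distr lborel borel (\<lambda>w. a + T w)) ?G" by (simp add: d)
  also have "\<dots> \<longleftrightarrow> integrable lborel (\<lambda>w. ?G (a + T w))"
    by (rule integrable_distr_eq) (use G in auto)
  finally show "set_integrable lborel ((+) a ` T ` S) g \<longleftrightarrow> set_integrable lborel S (\<lambda>w. g (a + T w))"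
    by (simp add: ind set_integrable_def)
qed

lemma set_integral_invariant:
  fixes T :: "'a::euclidean_space \<Rightarrow> 'a" and g :: "'a \<Rightarrow> real"
  assumes "orthogonal_transformation T" "T ` C = C" "continuous_on UNIV g" "C \<in> sets borel"
  shows "(LINT z:C|lborel. g (T z)) = (LINT z:C|lborel. g z)"
proof -
  have g: "g \<in> borel_measurable borel" using assms(3) by (rule borel_measurable_continuous_onI)
  have "set_borel_measurable lborel ((+) 0 ` T ` C) g"
    unfolding set_borel_measurable_def using g assms by (simp add: image_image)
  from set_integral_orthogonal_image(1)[OF assms(1) this] show ?thesis
    using assms(2) by simp
qed

lemma set_integral_const:
  fixes c :: real and S :: "'a::euclidean_space set"
  assumes "S \<in> sets borel"
  shows "(LINT x:S|lborel. c) = c * measure lborel S"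
  using assms by (simp add: set_lebesgue_integral_def mult.commute)

lemma set_borel_measurable_continuous_open:
  fixes g :: "'a::euclidean_space \<Rightarrow> 'b::euclidean_space"
  assumes "open S" "continuous_on S g"
  shows "set_borel_measurable lborel S g"
  using borel_measurable_continuous_on_indicator[of S g] assms
  by (simp add: set_borel_measurable_def)

lemma set_integrable_continuous_bounded:
  fixes g :: "'a::euclidean_space \<Rightarrow> real"
  assumes "bounded C" "C \<in> sets borel" "continuous_on UNIV g"
  shows "set_integrable lborel C g"
proof -
  obtain R where "\<forall>x\<in>C. norm x \<le> R" using assms(1) unfolding bounded_iff by (elim exE)
  then have R: "C \<subseteq> cball 0 R" by auto
  have "set_integrable lborel (cball 0 R) g"
    unfolding set_integrable_def
    by (rule borel_integrable_compact[OF compact_cball continuous_on_subset[OF assms(3) subset_UNIV]])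
  then show ?thesis by (rule set_integrable_subset) (use R assms(2) in auto)
qed

section \<open>Holomorphic functions of several variables\<close>

lemma holomorphic_fun_on_slice:
  fixes g :: "complex^'n \<Rightarrow> complex"
  assumes g: "holomorphic_fun_on g U" and W: "\<And>c. c \<in> W \<Longrightarrow> a + c *s z \<in> U" and op: "open W"
  shows "(\<lambda>c. g (a + c *s z)) holomorphic_on W"
  unfolding holomorphic_on_def
proof
  fix c assume c: "c \<in> W"
  obtain D where D: "(g has_derivative D) (at (a + c *s z))" "\<And>c v. D (c *s v) = c * D v"
    using g W[OF c] unfolding holomorphic_fun_on_def by blast
  have lin: "linear (\<lambda>c. c *s z)"
    by (rule linearI) (simp_all add: vec_eq_iff algebra_simps)
  have "((\<lambda>c. a + c *s z) has_derivative (\<lambda>c. c *s z)) (at c)"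
    using bounded_linear_imp_has_derivative[OF linear_conv_bounded_linear[THEN iffD1, OF lin]]
    by (auto intro!: derivative_eq_intros)
  from has_derivative_compose[OF this D(1)]
  have "((\<lambda>c. g (a + c *s z)) has_derivative (\<lambda>c. D (c *s z))) (at c)" .
  then have "((\<lambda>c. g (a + c *s z)) has_field_derivative D z) (at c)"
    unfolding has_field_derivative_def by (simp add: D(2) mult.commute[of _ "D z"])
  then show "(\<lambda>c. g (a + c *s z)) field_differentiable at c within W"
    using field_differentiable_at_within field_differentiable_def by blast
qed

lemma holomorphic_fun_on_imp_continuous_on:
  "holomorphic_fun_on g U \<Longrightarrow> continuous_on U g"
  unfolding holomorphic_fun_on_def
  by (meson continuous_at_imp_continuous_on has_derivative_continuous)

lemma holomorphic_fun_onI: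
  assumes "\<And>z. z \<in> U \<Longrightarrow> (f has_derivative D z) (at z)" "\<And>z c v. z \<in> U \<Longrightarrow> D z (c *s v) = c * D z v"
  shows "holomorphic_fun_on f U"
  using assms unfolding holomorphic_fun_on_def by blast

lemma holomorphic_fun_on_mult:
  assumes "holomorphic_fun_on f U" "holomorphic_fun_on g U"
  shows "holomorphic_fun_on (\<lambda>z. f z * g z) U"
  unfolding holomorphic_fun_on_def
proof
  fix z assume z: "z \<in> U"
  obtain D1 where D1: "(f has_derivative D1) (at z)" "\<And>c v. D1 (c *s v) = c * D1 v"
    using assms(1) z unfolding holomorphic_fun_on_def by blast
  obtain D2 where D2: "(g has_derivative D2) (at z)" "\<And>c v. D2 (c *s v) = c * D2 v"
    using assms(2) z unfolding holomorphic_fun_on_def by blast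
  have "((\<lambda>z. f z * g z) has_derivative (\<lambda>v. f z * D2 v + D1 v * g z)) (at z)"
    by (rule has_derivative_mult[OF D1(1) D2(1)])
  moreover have "f z * D2 (c *s v) + D1 (c *s v) * g z = c * (f z * D2 v + D1 v * g z)" for c v
    by (simp add: D1 D2 algebra_simps)
  ultimately show "\<exists>D. ((\<lambda>z. f z * g z) has_derivative D) (at z) \<and> (\<forall>c v. D (c *s v) = c * D v)" by blast
qed

lemma holomorphic_fun_on_sum:
  assumes "\<And>i. i \<in> I \<Longrightarrow> holomorphic_fun_on (f i) U"
  shows "holomorphic_fun_on (\<lambda>z. \<Sum>i\<in>I. f i z) U"
  unfolding holomorphic_fun_on_def
proof
  fix z assume z: "z \<in> U"
  then have "\<forall>i\<in>I. \<exists>D. (f i has_derivative D) (at z) \<and> (\<forall>c v. D (c *s v) = c * D v)"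
    using assms unfolding holomorphic_fun_on_def by blast
  then obtain D where D: "\<And>i. i \<in> I \<Longrightarrow> (f i has_derivative D i) (at z) \<and> (\<forall>c v. D i (c *s v) = c * D i v)"
    by metis
  have "((\<lambda>z. \<Sum>i\<in>I. f i z) has_derivative (\<lambda>v. \<Sum>i\<in>I. D i v)) (at z)"
    by (rule has_derivative_sum) (use D in auto)
  moreover have "(\<Sum>i\<in>I. D i (c *s v)) = c * (\<Sum>i\<in>I. D i v)" for c v
    using D by (simp add: sum_distrib_left)
  ultimately show "\<exists>D. ((\<lambda>z. \<Sum>i\<in>I. f i z) has_derivative D) (at z) \<and> (\<forall>c v. D (c *s v) = c * D v)" by blast
qed

lemma holomorphic_fun_on_diff:
  assumes "holomorphic_fun_on f U" "holomorphic_fun_on g U"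
  shows "holomorphic_fun_on (\<lambda>z. f z - g z) U"
  unfolding holomorphic_fun_on_def
proof
  fix z assume z: "z \<in> U"
  obtain D1 where D1: "(f has_derivative D1) (at z)" "\<And>c v. D1 (c *s v) = c * D1 v"
    using assms(1) z unfolding holomorphic_fun_on_def by blast
  obtain D2 where D2: "(g has_derivative D2) (at z)" "\<And>c v. D2 (c *s v) = c * D2 v"
    using assms(2) z unfolding holomorphic_fun_on_def by blast
  have "((\<lambda>z. f z - g z) has_derivative (\<lambda>v. D1 v - D2 v)) (at z)"
    by (rule has_derivative_diff[OF D1(1) D2(1)])
  moreover have "D1 (c *s v) - D2 (c *s v) = c * (D1 v - D2 v)" for c v
    by (simp add: D1 D2 algebra_simps)
  ultimately show "\<exists>D. ((\<lambda>z. f z - g z) has_derivative D) (at z) \<and> (\<forall>c v. D (c *s v) = c * D v)" by blast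
qed

lemma holomorphic_fun_on_affine:
  assumes "linear T" "\<And>c v. T (c *s v) = c * T v"
  shows "holomorphic_fun_on (\<lambda>x. b + T (x - a)) U"
proof (rule holomorphic_fun_onI)
  fix z c v
  have bl: "bounded_linear T" using assms(1) by (simp add: linear_conv_bounded_linear)
  have "((\<lambda>x. b + T (x - a)) has_derivative (\<lambda>v. 0 + T (v - 0))) (at z)"
    by (intro has_derivative_add has_derivative_const bounded_linear.has_derivative[OF bl]
        has_derivative_diff has_derivative_ident)
  then show "((\<lambda>x. b + T (x - a)) has_derivative T) (at z)" by simp
  show "T (c *s v) = c * T v" by (rule assms(2))
qed

lemma holomorphic_fun_on_subset: "holomorphic_fun_on f U \<Longrightarrow> V \<subseteq> U \<Longrightarrow> holomorphic_fun_on f V"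
  unfolding holomorphic_fun_on_def by blast

lemma holomorphic_fun_on_cong:
  assumes "open U" "\<And>z. z \<in> U \<Longrightarrow> f z = g z" "holomorphic_fun_on f U"
  shows "holomorphic_fun_on g U"
  using assms(3) unfolding holomorphic_fun_on_def
  by (meson assms(1,2) has_derivative_transform_within_open)

text \<open>
  A way to obtain the complex linearity in \<open>holomorphic_fun_on\<close> from real derivatives.
\<close>

lemma linear_imp_complex_linear:
  fixes T :: "complex^'n \<Rightarrow> complex"
  assumes lin: "linear T" and i: "\<And>v. T (\<i> *s v) = \<i> * T v"
  shows "T (c *s v) = c * T v"
proof -
  have "c * x = of_real (Re c) * x + of_real (Im c) * (\<i> * x)" for x
    by (simp add: complex_eq_iff algebra_simps)
  then have "c *s v = Re c *\<^sub>R v + Im c *\<^sub>R (\<i> *s v)"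
    by (simp add: vec_eq_iff scaleR_conv_of_real[where 'a=complex])
  then have "T (c *s v) = Re c *\<^sub>R T v + Im c *\<^sub>R (\<i> * T v)"
    by (simp add: linear_add[OF lin] linear_scale[OF lin] i)
  also have "\<dots> = c * T v" by (simp add: complex_eq_iff)
  finally show ?thesis .
qed

section \<open>The mean value property on circled domains\<close>

lemma orthogonal_transformation_unit_scalar:
  assumes "cmod c = 1"
  shows "orthogonal_transformation (\<lambda>z::complex^'n. c *s z)"
proof -
  have "(c * x) \<bullet> (c * y) = x \<bullet> y" for x y :: complex
  proof -
    have "(c * x) \<bullet> (c * y) = (cmod c)\<^sup>2 * (x \<bullet> y)"
      by (simp add: inner_complex_def cmod_power2) (simp add: algebra_simps power2_eq_square)
    then show ?thesis using assms by simp
  qed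
  moreover have "linear (\<lambda>z::complex^'n. c *s z)"
    by (rule linearI) (simp_all add: vec_eq_iff algebra_simps)
  ultimately show ?thesis
    by (simp add: orthogonal_transformation_def inner_vec_def)
qed

lemma continuous_on_vec_scale[continuous_intros]:
  "continuous_on S f \<Longrightarrow> continuous_on S g \<Longrightarrow> continuous_on S (\<lambda>x. (f x :: complex) *s (g x :: complex^'n))"
  unfolding continuous_on_vec_lambda vector_scalar_mult_def
  by (intro continuous_on_vec_lambda continuous_intros) auto

lemma circle_mean_value:
  fixes f :: "complex \<Rightarrow> complex"
  assumes "f holomorphic_on S" "open S" "cball 0 1 \<subseteq> S"
  shows "((\<lambda>t. f (exp (2 * of_real pi * \<i> * of_real t))) has_integral f 0) {0..1}"
proof -
  have "((\<lambda>u. f u / (u - 0)) has_contour_integral (2 * of_real pi * \<i> * f 0)) (circlepath 0 1)"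
    by (rule Cauchy_integral_circlepath_simple) (use assms in \<open>auto intro: holomorphic_on_subset\<close>)
  then have "((\<lambda>t. f (circlepath 0 1 t) / circlepath 0 1 t * vector_derivative (circlepath 0 1) (at t))
        has_integral (2 * of_real pi * \<i> * f 0)) {0..1}"
    by (simp add: has_contour_integral)
  then have "((\<lambda>t. 2 * of_real pi * \<i> * f (exp (2 * of_real pi * \<i> * of_real t)))
        has_integral (2 * of_real pi * \<i> * f 0)) {0..1}"
    unfolding vector_derivative_circlepath by (simp add: circlepath mult_ac)
  then have "((\<lambda>t. (1 / (2 * of_real pi * \<i>)) * (2 * of_real pi * \<i> * f (exp (2 * of_real pi * \<i> * of_real t))))
        has_integral (1 / (2 * of_real pi * \<i>)) * (2 * of_real pi * \<i> * f 0)) {0..1}"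
    by (rule has_integral_mult_right)
  then show ?thesis by simp
qed

text \<open>
  The rotations \<open>z \<mapsto> e\<^sup>i\<^sup>t z\<close> preserve \<open>D\<close> and Lebesgue measure, so the integral equals the integral of
  the mean of \<open>g\<close> over the circles through the points of \<open>D\<close>. Along the complex line through \<open>a\<close>
  the Cauchy integral formula gives the value \<open>g a\<close> for each of these means.
\<close>

lemma set_integral_holomorphic_circled_eq_0:
  fixes g :: "complex^'n \<Rightarrow> complex"
  assumes D: "open D" and disc: "\<And>c z. cmod c \<le> 1 \<Longrightarrow> z \<in> D \<Longrightarrow> c *s z \<in> D"
    and g: "holomorphic_fun_on g ((+) a ` D)" and g0: "g a = 0"
    and int: "set_integrable lborel ((+) a ` D) g"
  shows "(LINT x:(+) a ` D|lborel. g x) = 0"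
proof -
  define e where "e t = exp (2 * of_real pi * \<i> * of_real t)" for t :: real
  define G where "G z = indicat_real D z *\<^sub>R g (a + z)" for z
  have e1: "cmod (e t) = 1" for t by (simp add: e_def)
  have e0: "e t \<noteq> 0" for t by (simp add: e_def)
  have ce: "continuous_on UNIV e" unfolding e_def by (intro continuous_intros)
  have rot: "e t *s z \<in> D \<longleftrightarrow> z \<in> D" for t z
  proof
    assume "e t *s z \<in> D"
    then have "inverse (e t) *s (e t *s z) \<in> D"
      by (rule disc[rotated]) (simp add: norm_inverse e1)
    moreover have "inverse (e t) *s (e t *s z) = z"
      using e0[of t] by (simp add: vec_eq_iff)
    ultimately show "z \<in> D" by (simp only:)
  qed (auto intro!: disc simp: e1)
  have sm: "set_borel_measurable lborel ((+) a ` D) g"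
    using int unfolding set_integrable_def set_borel_measurable_def by (rule borel_measurable_integrable)
  have id: "orthogonal_transformation (\<lambda>z::complex^'n. z)" by simp
  have Gint: "integrable lborel G" and LG: "(LINT x:(+) a ` D|lborel. g x) = integral\<^sup>L lborel G"
    using set_integral_orthogonal_image[OF id, of a D g] sm int
    by (simp_all add: G_def[abs_def] set_integrable_def set_lebesgue_integral_def)
  have Gm[measurable]: "G \<in> borel_measurable borel"
    using Gint by (simp add: borel_measurable_integrable)
  have [measurable]: "(\<lambda>(t,z). e t *s z) \<in> borel_measurable (borel \<Otimes>\<^sub>M borel)"
    unfolding borel_prod split_beta
    by (intro borel_measurable_continuous_onI continuous_intros continuous_on_compose2[OF ce]) auto
  have Gt: "integrable lborel (\<lambda>z. G (e t *s z))" "(LINT z|lborel. G (e t *s z)) = integral\<^sup>L lborel G"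
    "(\<integral>\<^sup>+z. norm (G (e t *s z)) \<partial>lborel) = (\<integral>\<^sup>+z. norm (G z) \<partial>lborel)" for t
  proof -
    have d: "distr lborel borel (\<lambda>z::complex^'n. e t *s z) = lborel"
      by (rule distr_lborel_orthogonal[OF orthogonal_transformation_unit_scalar[OF e1]])
    have [measurable]: "(\<lambda>z::complex^'n. e t *s z) \<in> borel_measurable borel"
      by (intro borel_measurable_continuous_onI continuous_intros)
    show "integrable lborel (\<lambda>z. G (e t *s z))"
      by (rule integrable_distr[of _ _ borel]) (use Gint d in auto)
    show "(LINT z|lborel. G (e t *s z)) = integral\<^sup>L lborel G"
      by (subst (2) d[symmetric], subst integral_distr) auto
    show "(\<integral>\<^sup>+z. norm (G (e t *s z)) \<partial>lborel) = (\<integral>\<^sup>+z. norm (G z) \<partial>lborel)"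
      by (subst (2) d[symmetric], subst nn_integral_distr) auto
  qed
  define F where "F = (\<lambda>(t::real, z). indicat_real {0..1} t *\<^sub>R G (e t *s z))"
  have Fm[measurable]: "F \<in> borel_measurable (lborel \<Otimes>\<^sub>M lborel)"
    unfolding F_def by measurable
  have "(\<integral>\<^sup>+x. norm (F x) \<partial>(lborel \<Otimes>\<^sub>M lborel)) = (\<integral>\<^sup>+t. \<integral>\<^sup>+z. norm (F (t, z)) \<partial>lborel \<partial>lborel)"
    by (rule lborel.nn_integral_fst[symmetric]) measurable
  also have "\<dots> = (\<integral>\<^sup>+t. indicator {0..1} (t::real) * (\<integral>\<^sup>+z. norm (G z) \<partial>lborel) \<partial>lborel)"
    by (intro nn_integral_cong) (auto simp: F_def indicator_def Gt(3))
  also have "\<dots> = (\<integral>\<^sup>+z. norm (G z) \<partial>lborel)"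
    by (subst nn_integral_multc) auto
  also have "\<dots> < \<infinity>" using Gint by (simp add: integrable_iff_bounded)
  finally have Fint: "integrable (lborel \<Otimes>\<^sub>M lborel) F"
    by (intro integrableI_bounded) auto
  \<comment> \<open>Integrating first over the points: every rotation preserves the integral.\<close>
  have "(LINT t|lborel. LINT z|lborel. F (t, z)) = (LINT t|lborel. indicat_real {0..1} (t::real) *\<^sub>R integral\<^sup>L lborel G)"
    by (intro Bochner_Integration.integral_cong) (auto simp: F_def Gt(2))
  also have "\<dots> = integral\<^sup>L lborel G"
    by simp
  finally have one: "(LINT t|lborel. LINT z|lborel. F (t, z)) = integral\<^sup>L lborel G" .
  \<comment> \<open>Integrating first over the circle: the mean value property in one variable.\<close>
  have inner: "(LINT t|lborel. F (t, z)) = 0" for z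
  proof (cases "z \<in> D")
    case False
    then show ?thesis by (simp add: F_def G_def rot)
  next
    case True
    let ?f = "\<lambda>c. g (a + c *s z)"
    define W where "W = (\<lambda>c::complex. c *s z) -` D"
    have W: "open W" unfolding W_def by (intro open_vimage D continuous_intros)
    have hol: "?f holomorphic_on W"
      by (rule holomorphic_fun_on_slice[OF g _ W]) (auto simp: W_def)
    have cb: "cball 0 1 \<subseteq> W" using True by (auto simp: W_def intro!: disc)
    have "((\<lambda>t. ?f (e t)) has_integral ?f 0) {0..1}"
      unfolding e_def by (rule circle_mean_value[OF hol W cb])
    moreover have "continuous_on {0..1} (\<lambda>t. ?f (e t))"
      by (rule continuous_on_compose2[OF holomorphic_on_imp_continuous_on[OF hol]])
         (use ce cb e1 in \<open>auto intro: continuous_on_subset simp: subset_eq\<close>)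
    ultimately have "(LINT t:{0..1}|lborel. ?f (e t)) = ?f 0"
      using borel_integrable_atLeastAtMost' set_borel_integral_eq_integral(2) integral_unique by metis
    moreover have "a + 0 *s z = a" by (simp add: vec_eq_iff)
    ultimately show ?thesis using True g0
      by (simp add: F_def G_def rot set_lebesgue_integral_def)
  qed
  have "integral\<^sup>L lborel G = (LINT z|lborel. LINT t|lborel. F (t, z))"
    using lborel_pair.Fubini_integral[of "\<lambda>t z. F (t, z)"] Fint one by simp
  also have "\<dots> = 0" by (simp add: inner)
  finally show ?thesis using LG by simp
qed

section \<open>Second moments of a cylinder\<close>

lemma bij_betw_axis_Basis:
  "bij_betw (\<lambda>p. axis (fst p) (snd p)) (UNIV \<times> (Basis :: complex set)) (Basis :: (complex^'n::finite) set)"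
  unfolding bij_betw_def
proof
  show "inj_on (\<lambda>p. axis (fst p) (snd p) :: complex^'n) (UNIV \<times> Basis)"
    by (auto simp: inj_on_def axis_eq_axis)
  show "(\<lambda>p. axis (fst p) (snd p) :: complex^'n) ` (UNIV \<times> Basis) = Basis"
    by (force simp: Basis_vec_def)
qed

lemma sum_Basis_complex_vec:
  fixes g :: "complex^'n::finite \<Rightarrow> 'b::comm_monoid_add"
  shows "sum g Basis = (\<Sum>j\<in>UNIV. g (axis j 1) + g (axis j \<i>))"
proof -
  have "sum g Basis = (\<Sum>p\<in>UNIV \<times> (Basis :: complex set). g (axis (fst p) (snd p)))"
    by (rule sum.reindex_bij_betw[OF bij_betw_axis_Basis, symmetric])
  also have "\<dots> = (\<Sum>j\<in>UNIV. \<Sum>u\<in>(Basis :: complex set). g (axis j u))"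
    by (simp add: sum.cartesian_product split_beta)
  finally show ?thesis by (simp add: Basis_complex_def)
qed

lemma prod_Basis_complex_vec:
  fixes g :: "complex^'n::finite \<Rightarrow> 'b::comm_monoid_mult"
  shows "prod g Basis = (\<Prod>j\<in>UNIV. g (axis j 1) * g (axis j \<i>))"
proof -
  have "prod g Basis = (\<Prod>p\<in>UNIV \<times> (Basis :: complex set). g (axis (fst p) (snd p)))"
    by (rule prod.reindex_bij_betw[OF bij_betw_axis_Basis, symmetric])
  also have "\<dots> = (\<Prod>j\<in>UNIV. \<Prod>u\<in>(Basis :: complex set). g (axis j u))"
    by (simp add: prod.cartesian_product split_beta)
  finally show ?thesis by (simp add: Basis_complex_def)
qed

definition scale_on :: "'n set \<Rightarrow> real \<Rightarrow> complex^'n \<Rightarrow> complex^'n"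
  where "scale_on S c z = (\<chi> j. if j \<in> S then of_real c * z $ j else z $ j)"

definition norm2_on :: "'n set \<Rightarrow> complex^'n \<Rightarrow> real"
  where "norm2_on S z = (\<Sum>j\<in>S. (norm (z $ j))\<^sup>2)"

text \<open>
  The exponent counts two real dimensions for every scaled complex coordinate.
\<close>

lemma distr_lborel_scale_on:
  fixes S :: "'n::finite set"
  assumes c: "c > 0"
  shows "lborel = density (distr lborel borel (scale_on S c)) (\<lambda>_. ennreal (c ^ (2 * card S)))"
proof -
  define k where "k b = (if \<exists>j\<in>S. b $ j \<noteq> 0 then c else 1)" for b :: "complex^'n"
  have k_axis: "k (axis j u) = (if j \<in> S then c else 1)" if "u \<noteq> 0" for j u
    using that by (auto simp: k_def axis_def)
  have prod: "(\<Prod>b\<in>Basis. \<bar>k b\<bar>) = c ^ (2 * card S)"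
  proof -
    have "(\<Prod>b\<in>Basis. \<bar>k b\<bar>) = (\<Prod>j\<in>UNIV. \<bar>k (axis j 1)\<bar> * \<bar>k (axis j \<i>)\<bar>)"
      by (rule prod_Basis_complex_vec)
    also have "\<dots> = (\<Prod>j\<in>UNIV. if j \<in> S then c\<^sup>2 else 1)"
      using c by (intro prod.cong) (auto simp: k_axis power2_eq_square)
    also have "\<dots> = (\<Prod>j\<in>S. c\<^sup>2)" by (subst prod.inter_restrict[symmetric]) auto
    finally show ?thesis by (simp add: power_mult)
  qed
  have T: "(\<lambda>x. 0 + (\<Sum>b\<in>Basis. (k b * (x \<bullet> b)) *\<^sub>R b)) = scale_on S c"
  proof
    fix x
    show "0 + (\<Sum>b\<in>Basis. (k b * (x \<bullet> b)) *\<^sub>R b) = scale_on S c x"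
    proof (rule euclidean_eqI)
      fix b :: "complex^'n" assume b: "b \<in> Basis"
      then obtain j u where bj: "b = axis j u" "u \<in> Basis" by (auto simp: Basis_vec_def)
      have "(of_real c * x $ j) \<bullet> u = c * (x $ j \<bullet> u)"
        by (metis inner_scaleR_left scaleR_conv_of_real)
      moreover have "u \<noteq> 0" using bj by auto
      ultimately have "k b * (x \<bullet> b) = scale_on S c x \<bullet> b"
        by (simp add: k_axis bj(1) inner_axis scale_on_def)
      moreover have "(0 + (\<Sum>b\<in>Basis. (k b * (x \<bullet> b)) *\<^sub>R b)) \<bullet> b = k b * (x \<bullet> b)"
        using b by (simp only: add_0 inner_sum_left_Basis)
      ultimately show "(0 + (\<Sum>b\<in>Basis. (k b * (x \<bullet> b)) *\<^sub>R b)) \<bullet> b = scale_on S c x \<bullet> b"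
        by simp
    qed
  qed
  have "lborel = density (distr lborel borel (scale_on S c)) (\<lambda>_. ennreal (\<Prod>b\<in>Basis. \<bar>k b\<bar>))"
    unfolding T[symmetric] by (rule lborel_affine_euclidean) (use c in \<open>auto simp: k_def\<close>)
  then show ?thesis by (simp only: prod)
qed

lemma measurable_scale_on[measurable]: "scale_on S c \<in> borel_measurable borel"
  unfolding scale_on_def[abs_def]
  by (rule borel_measurable_continuous_onI, rule continuous_on_vec_lambda, rename_tac j,
      case_tac "j \<in> S") (auto intro!: continuous_intros)

lemma norm2_on_measurable[measurable]: "norm2_on S \<in> borel_measurable borel"
  unfolding norm2_on_def[abs_def]
  by (intro borel_measurable_continuous_onI continuous_intros)

lemma integral_scale_on:
  fixes g :: "complex^'n::finite \<Rightarrow> real"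
  assumes c: "c > 0" and g: "g \<in> borel_measurable borel"
  shows "integral\<^sup>L lborel g = c ^ (2 * card S) * (LINT z|lborel. g (scale_on S c z))"
proof -
  have "integral\<^sup>L lborel g = integral\<^sup>L (density (distr lborel borel (scale_on S c)) (\<lambda>_. ennreal (c ^ (2 * card S)))) g"
    by (subst distr_lborel_scale_on[OF c, of S]) simp
  also have "\<dots> = (LINT z|distr lborel borel (scale_on S c). (c ^ (2 * card S)) *\<^sub>R g z)"
    by (rule integral_density) (use c g in auto)
  also have "\<dots> = (LINT z|lborel. (c ^ (2 * card S)) *\<^sub>R g (scale_on S c z))"
    by (rule integral_distr) (use g in auto)
  finally show ?thesis by simp
qed

lemma norm2_on_scale_on: "norm2_on S (scale_on S c z) = c\<^sup>2 * norm2_on S z"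
  by (simp add: norm2_on_def scale_on_def norm_mult power_mult_distrib sum_distrib_left)

lemma norm2_on_nonneg[simp]: "0 \<le> norm2_on S z"
  by (simp add: norm2_on_def sum_nonneg)

text \<open>
  With \<open>m = card S\<close>, the volume \<open>V t\<close> and the moment \<open>K t\<close> of the part \<open>C t\<close> of \<open>W\<close> where the norm of
  the coordinates in \<open>S\<close> is less than \<open>t\<close> are homogeneous in \<open>t\<close> of degrees \<open>2 m\<close> and \<open>2 m + 2\<close>. On
  the thin shell between \<open>c s\<close> and \<open>s\<close> the integrand lies between \<open>(c s)\<^sup>2\<close> and \<open>s\<^sup>2\<close>; comparing
  volume and moment of the shell and letting \<open>c\<close> tend to 1 gives \<open>(2 m + 2) K s = s\<^sup>2 (2 m) V s\<close>.
\<close>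

lemma integral_norm2_on_cylinder:
  fixes W :: "(complex^'n::finite) set"
  assumes W[measurable]: "W \<in> sets borel" and inv: "\<And>c z. c > 0 \<Longrightarrow> scale_on S c z \<in> W \<longleftrightarrow> z \<in> W"
    and fin: "emeasure lborel {z\<in>W. norm2_on S z < s\<^sup>2} < \<infinity>" and s: "s > 0"
  shows "(LINT z:{z\<in>W. norm2_on S z < s\<^sup>2}|lborel. norm2_on S z)
     = s\<^sup>2 * card S / (card S + 1) * measure lborel {z\<in>W. norm2_on S z < s\<^sup>2}"
proof -
  define m where "m = card S"
  define C where "C t = {z\<in>W. norm2_on S z < t\<^sup>2}" for t :: real
  have [measurable]: "C t \<in> sets borel" for t
  proof -
    have "C t = W \<inter> (norm2_on S -` {..<t\<^sup>2} \<inter> space borel)" by (auto simp: C_def)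
    then show ?thesis by (metis W norm2_on_measurable measurable_sets lessThan_borel sets.Int)
  qed
  define V where "V t = measure lborel (C t)" for t
  define K where "K t = (LINT z|lborel. indicat_real (C t) z * norm2_on S z)" for t
  have mono: "C t \<subseteq> C t'" if "0 \<le> t" "t \<le> t'" for t t'
    using power_mono[OF that(2,1), of 2] by (auto simp: C_def)
  have finC: "emeasure lborel (C t) < \<infinity>" if "0 \<le> t" "t \<le> s" for t
  proof -
    have "emeasure lborel (C t) \<le> emeasure lborel (C s)"
      using mono[OF that] by (intro emeasure_mono) auto
    then show ?thesis using fin by (auto simp: C_def intro: le_less_trans)
  qed
  have intC: "integrable lborel (indicat_real (C t))" if "0 \<le> t" "t \<le> s" for t
    using finC[OF that] by simp
  have intK: "integrable lborel (\<lambda>z. indicat_real (C t) z * norm2_on S z)" if "0 \<le> t" "t \<le> s" for t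
  proof (rule Bochner_Integration.integrable_bound)
    show "integrable lborel (\<lambda>z. s\<^sup>2 * indicat_real (C s) z)" using intC[of s] s by simp
    show "AE z in lborel. norm (indicat_real (C t) z * norm2_on S z) \<le> norm (s\<^sup>2 * indicat_real (C s) z)"
      using mono[OF that] by (auto simp: indicator_def C_def)
  qed measurable
  have ind: "indicat_real (C (c * s)) (scale_on S c z) = indicat_real (C s) z" if "c > 0" for c z
    using that inv[OF that, of z] by (auto simp: C_def indicator_def norm2_on_scale_on power_mult_distrib)
  have V_scale: "V (c * s) = c ^ (2*m) * V s" if "c > 0" for c
    using integral_scale_on[OF that, of "indicat_real (C (c * s))" S] ind[OF that]
    by (simp add: V_def m_def)
  have K_scale: "K (c * s) = c ^ (2*m+2) * K s" if "c > 0" for c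
    using integral_scale_on[OF that, of "\<lambda>z. indicat_real (C (c * s)) z * norm2_on S z" S] ind[OF that]
    by (simp add: K_def m_def norm2_on_scale_on power_add mult_ac power2_eq_square)
  \<comment> \<open>Dividing \<open>1 - c ^ k\<close> by \<open>1 - c\<close> keeps the comparison meaningful in the limit.\<close>
  define P where "P k c = (\<Sum>i<k. c ^ i)" for k and c :: real
  have P: "(1 - c) * P k c = 1 - c ^ k" for c k
    unfolding P_def by (rule one_diff_power_eq[symmetric])
  have bounds: "(c * s)\<^sup>2 * (P (2*m) c * V s) \<le> P (2*m+2) c * K s \<and>
       P (2*m+2) c * K s \<le> s\<^sup>2 * (P (2*m) c * V s)" if c: "0 < c" "c < 1" for c
  proof -
    have cs: "0 \<le> c * s" "c * s \<le> s" using c s by (auto simp: mult_le_cancel_right2)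
    have eq: "indicat_real (C s - C (c * s)) z = indicat_real (C s) z - indicat_real (C (c * s)) z" for z
      using mono[OF cs] by (auto simp: indicator_def)
    have diffV: "(LINT z|lborel. indicat_real (C s - C (c * s)) z) = V s - V (c * s)"
      unfolding eq using intC[of s] intC[OF cs] s by (subst Bochner_Integration.integral_diff) (auto simp: V_def)
    have intV: "integrable lborel (indicat_real (C s - C (c * s)))"
      unfolding eq[abs_def] using intC[of s] intC[OF cs] s by (intro Bochner_Integration.integrable_diff) auto
    have diffK: "(LINT z|lborel. indicat_real (C s - C (c * s)) z * norm2_on S z) = K s - K (c * s)"
      unfolding eq left_diff_distrib using intK[of s] intK[OF cs] s
      by (subst Bochner_Integration.integral_diff) (auto simp: K_def)
    have intK': "integrable lborel (\<lambda>z. indicat_real (C s - C (c * s)) z * norm2_on S z)"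
      unfolding eq left_diff_distrib using intK[of s] intK[OF cs] s
      by (intro Bochner_Integration.integrable_diff) auto
    have "(c * s)\<^sup>2 * (V s - V (c * s)) = (LINT z|lborel. (c * s)\<^sup>2 * indicat_real (C s - C (c * s)) z)"
      by (simp add: diffV[symmetric])
    also have "\<dots> \<le> (LINT z|lborel. indicat_real (C s - C (c * s)) z * norm2_on S z)"
    proof (rule integral_mono)
      show "integrable lborel (\<lambda>z. (c * s)\<^sup>2 * indicat_real (C s - C (c * s)) z)" using intV by simp
    qed (use intK' in \<open>auto simp: indicator_def C_def\<close>)
    finally have 1: "(c * s)\<^sup>2 * (V s - V (c * s)) \<le> K s - K (c * s)" by (simp add: diffK)
    have "(LINT z|lborel. indicat_real (C s - C (c * s)) z * norm2_on S z) \<le> (LINT z|lborel. s\<^sup>2 * indicat_real (C s - C (c * s)) z)"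
    proof (rule integral_mono)
      show "integrable lborel (\<lambda>z. s\<^sup>2 * indicat_real (C s - C (c * s)) z)" using intV by simp
    qed (use intK' in \<open>auto simp: indicator_def C_def\<close>)
    also have "\<dots> = s\<^sup>2 * (V s - V (c * s))" by (simp add: diffV[symmetric])
    finally have 2: "K s - K (c * s) \<le> s\<^sup>2 * (V s - V (c * s))" by (simp add: diffK)
    have 3: "V s - V (c * s) = (1 - c) * (P (2*m) c * V s)"
      unfolding V_scale[OF c(1)] mult.assoc[symmetric] P by (simp add: algebra_simps)
    have 4: "K s - K (c * s) = (1 - c) * (P (2*m+2) c * K s)"
      unfolding K_scale[OF c(1)] mult.assoc[symmetric] P by (simp add: algebra_simps)
    have "(1 - c) * ((c * s)\<^sup>2 * (P (2*m) c * V s)) \<le> (1 - c) * (P (2*m+2) c * K s)"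
      "(1 - c) * (P (2*m+2) c * K s) \<le> (1 - c) * (s\<^sup>2 * (P (2*m) c * V s))"
      using 1 2 unfolding 3 4 by (simp_all only: mult_ac)
    then show ?thesis using c by (auto simp: mult_le_cancel_left_pos)
  qed
  have Pt: "(P k \<longlongrightarrow> real k) (at_left 1)" for k
  proof -
    have "(P k \<longlongrightarrow> P k 1) (at_left 1)"
      unfolding P_def[abs_def] by (intro tendsto_intros)
    then show ?thesis by (simp add: P_def)
  qed
  have ev: "eventually (\<lambda>c::real. 0 < c \<and> c < 1) (at_left 1)"
    by (rule eventually_at_leftI[of 0]) auto
  have lim: "((\<lambda>c. (c * s)\<^sup>2 * (P (2*m) c * V s)) \<longlongrightarrow> (1 * s)\<^sup>2 * (real (2*m) * V s)) (at_left 1)"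
    "((\<lambda>c. P (2*m+2) c * K s) \<longlongrightarrow> real (2*m+2) * K s) (at_left 1)"
    "((\<lambda>c. s\<^sup>2 * (P (2*m) c * V s)) \<longlongrightarrow> s\<^sup>2 * (real (2*m) * V s)) (at_left 1)"
    by (intro tendsto_intros Pt)+
  have "(1 * s)\<^sup>2 * (real (2*m) * V s) \<le> real (2*m+2) * K s"
    by (rule tendsto_le[OF trivial_limit_at_left_real lim(2,1) eventually_mono[OF ev]])
       (use bounds in blast)
  moreover have "real (2*m+2) * K s \<le> s\<^sup>2 * (real (2*m) * V s)"
    by (rule tendsto_le[OF trivial_limit_at_left_real lim(3,2) eventually_mono[OF ev]])
       (use bounds in blast)
  ultimately have "K s = s\<^sup>2 * m / (m + 1) * V s"
    by (simp add: field_simps)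
  then show ?thesis
    by (simp add: K_def V_def C_def m_def set_lebesgue_integral_def)
qed

text \<open>
  The cylinder in its own coordinates, before the unitary matrix is applied.
\<close>

definition std_cylinder :: "'n::finite \<Rightarrow> real \<Rightarrow> real \<Rightarrow> (complex^'n) set"
  where "std_cylinder o1 r s =
    {z. norm (z $ o1) < r \<and> sqrt (\<Sum>j\<in>UNIV - {o1}. (norm (z $ j))\<^sup>2) < s}"

lemma cylinder_eq_image: "cylinder o1 r s A = (*v) A ` std_cylinder o1 r s"
  by (simp add: cylinder_def std_cylinder_def)

lemma std_cylinder_eq:
  fixes o1 :: "'n::finite"
  assumes "r > 0" "s > 0"
  shows "std_cylinder o1 r s = {z. norm2_on {o1} z < r\<^sup>2 \<and> norm2_on (UNIV - {o1}) z < s\<^sup>2}"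
proof -
  have 1: "norm (z $ o1) < r \<longleftrightarrow> norm2_on {o1} z < r\<^sup>2" for z :: "complex^'n"
    unfolding norm2_on_def
    using assms power2_less_imp_less[of "norm (z $ o1)" r] power_strict_mono[of "norm (z $ o1)" r 2] by auto
  have "sqrt x < s \<longleftrightarrow> x < s\<^sup>2" if "x \<ge> 0" for x
    using assms that by (subst real_sqrt_less_iff[of x "s\<^sup>2", symmetric]) simp
  then have 2: "sqrt (norm2_on (UNIV - {o1}) z) < s \<longleftrightarrow> norm2_on (UNIV - {o1}) z < s\<^sup>2" for z :: "complex^'n"
    by simp
  show ?thesis
    unfolding std_cylinder_def norm2_on_def[symmetric] 1 2 ..
qed

lemma norm_power2_eq_norm2_on: "(norm z)\<^sup>2 = norm2_on UNIV z"
  by (simp add: norm_vec_def L2_set_def norm2_on_def sum_nonneg)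

lemma norm_std_cylinder:
  assumes "r > 0" "s > 0" "z \<in> std_cylinder o1 r s"
  shows "(norm z)\<^sup>2 < r\<^sup>2 + s\<^sup>2"
proof -
  have "norm2_on UNIV z = norm2_on {o1} z + norm2_on (UNIV - {o1}) z"
    unfolding norm2_on_def by (subst sum.remove[of _ o1]) auto
  then show ?thesis using assms by (simp add: norm_power2_eq_norm2_on std_cylinder_eq)
qed

lemma continuous_on_norm2_on[continuous_intros]: "continuous_on X (norm2_on S)"
  unfolding norm2_on_def[abs_def] by (intro continuous_intros)

lemma open_std_cylinder:
  fixes o1 :: "'n::finite"
  shows "open (std_cylinder o1 r s)"
proof -
  have "open {z::complex^'n. sqrt (\<Sum>j\<in>UNIV - {o1}. (norm (z $ j))\<^sup>2) < s}"
    "open {z::complex^'n. norm (z $ o1) < r}"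
    by (intro open_Collect_less continuous_intros)+
  then show ?thesis unfolding std_cylinder_def by (auto simp: Collect_conj_eq)
qed

lemma std_cylinder_borel: "std_cylinder o1 r s \<in> sets borel"
  by (rule borel_open[OF open_std_cylinder])

lemma bounded_std_cylinder:
  assumes "r > 0" "s > 0" shows "bounded (std_cylinder o1 r s)"
proof (rule boundedI)
  fix z assume "z \<in> std_cylinder o1 r s"
  from norm_std_cylinder[OF assms this] show "norm z \<le> sqrt (r\<^sup>2 + s\<^sup>2)"
    by (simp add: real_le_rsqrt)
qed

lemma emeasure_std_cylinder_finite:
  assumes "r > 0" "s > 0" shows "emeasure lborel (std_cylinder o1 r s) < \<infinity>"
  by (rule emeasure_bounded_finite[OF bounded_std_cylinder[OF assms]])

lemma measure_std_cylinder_pos: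
  fixes o1 :: "'n::finite"
  assumes "r > 0" "s > 0" shows "measure lborel (std_cylinder o1 r s) > 0"
proof -
  have "0 \<in> std_cylinder o1 r s" using assms by (simp add: std_cylinder_def)
  then obtain e where e: "e > 0" "ball 0 e \<subseteq> std_cylinder o1 r s"
    using open_std_cylinder[of o1 r s] open_contains_ball by blast
  have "0 < measure lborel (ball (0::complex^'n) e)"
    using content_ball_pos[OF e(1)] by simp
  also have "\<dots> \<le> measure lborel (std_cylinder o1 r s)"
    by (rule measure_mono_fmeasurable[OF e(2)])
       (use emeasure_std_cylinder_finite[OF assms, of o1] in \<open>auto simp: fmeasurable_def std_cylinder_borel\<close>)
  finally show ?thesis .
qed

text \<open>
  Applied below to reflections and rotations of one coordinate (with \<open>p = id\<close>) and to the exchange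
  of two coordinates other than \<open>o1\<close>.
\<close>

lemma std_cylinder_invariant:
  fixes T :: "complex^'n::finite \<Rightarrow> complex^'n"
  assumes lin: "linear T" and p: "p permutes (UNIV - {o1})"
    and T: "\<And>z j. norm (T z $ j) = norm (z $ p j)"
  shows "orthogonal_transformation T" "T ` std_cylinder o1 r s = std_cylinder o1 r s"
proof -
  have p1: "p o1 = o1" using p by (simp add: permutes_def)
  have pp: "p permutes UNIV" using p by (rule permutes_subset) simp
  have "norm2_on UNIV (T z) = norm2_on UNIV z" for z
    unfolding norm2_on_def T using sum.permute[OF pp, of "\<lambda>j. (norm (z $ j))\<^sup>2"] by (simp add: o_def)
  then have "norm (T z) = norm z" for z
    by (intro power2_eq_imp_eq[of "norm (T _)"]) (simp_all add: norm_power2_eq_norm2_on)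
  then show o: "orthogonal_transformation T" using lin by (simp add: orthogonal_transformation)
  have "T z \<in> std_cylinder o1 r s \<longleftrightarrow> z \<in> std_cylinder o1 r s" for z
    unfolding std_cylinder_def T p1 mem_Collect_eq
    using sum.permute[OF p, of "\<lambda>j. (norm (z $ j))\<^sup>2"] by (simp add: o_def)
  then have "T -` std_cylinder o1 r s = std_cylinder o1 r s" by auto
  then show "T ` std_cylinder o1 r s = std_cylinder o1 r s"
    using orthogonal_transformation_surj[OF o] by (metis surj_image_vimage_eq)
qed

text \<open>
  Both factors are sublevel sets as in \<open>integral_norm2_on_cylinder\<close>, the other one playing the role
  of \<open>W\<close>. In the second factor, whose complex dimension is \<open>CARD('n) - 1\<close>, all coordinates contribute
  equally since they can be exchanged.
\<close>

lemma integral_coordinate_norm_std_cylinder: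
  fixes o1 :: "'n::finite"
  assumes rs: "r > 0" "s > 0" and n: "CARD('n) \<ge> 2"
  defines "C \<equiv> std_cylinder o1 r s"
  shows "(LINT z:C|lborel. norm2_on {o1} z) = r\<^sup>2 / 2 * measure lborel C"
    and "j \<noteq> o1 \<Longrightarrow> (LINT z:C|lborel. norm2_on {j} z) = s\<^sup>2 / CARD('n) * measure lborel C"
proof -
  define R where "R = UNIV - {o1}"
  have fin: "emeasure lborel C < \<infinity>"
    unfolding C_def by (rule emeasure_std_cylinder_finite[OF rs])
  have Cb: "C \<in> sets borel" unfolding C_def by (rule std_cylinder_borel)
  have m: "{z. norm2_on S z < t} \<in> sets borel" for S :: "'n set" and t
    by (intro borel_open open_Collect_less continuous_intros)
  have C1: "C = {z \<in> {z. norm2_on R z < s\<^sup>2}. norm2_on {o1} z < r\<^sup>2}"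
    and C2: "C = {z \<in> {z. norm2_on {o1} z < r\<^sup>2}. norm2_on R z < s\<^sup>2}"
    unfolding C_def std_cylinder_eq[OF rs] R_def by auto
  have inv1: "norm2_on R (scale_on {o1} c z) = norm2_on R z" for c z
    unfolding norm2_on_def by (intro sum.cong) (auto simp: scale_on_def R_def)
  have inv2: "norm2_on {o1} (scale_on R c z) = norm2_on {o1} z" for c z
    unfolding norm2_on_def by (intro sum.cong) (auto simp: scale_on_def R_def)
  have "(LINT z:C|lborel. norm2_on {o1} z) = r\<^sup>2 * card {o1} / (card {o1} + 1) * measure lborel C"
    unfolding C1
  proof (rule integral_norm2_on_cylinder[OF m _ _ rs(1)])
    show "emeasure lborel {z \<in> {z. norm2_on R z < s\<^sup>2}. norm2_on {o1} z < r\<^sup>2} < \<infinity>"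
      using fin by (subst (asm) C1)
  qed (simp add: inv1)
  then show "(LINT z:C|lborel. norm2_on {o1} z) = r\<^sup>2 / 2 * measure lborel C" by simp
  have cR: "card R = CARD('n) - 1" by (simp add: R_def)
  have "(LINT z:C|lborel. norm2_on R z) = s\<^sup>2 * card R / (card R + 1) * measure lborel C"
    unfolding C2
  proof (rule integral_norm2_on_cylinder[OF m _ _ rs(2)])
    show "emeasure lborel {z \<in> {z. norm2_on {o1} z < r\<^sup>2}. norm2_on R z < s\<^sup>2} < \<infinity>"
      using fin by (subst (asm) C2)
  qed (simp add: inv2)
  then have tot: "(LINT z:C|lborel. norm2_on R z) = s\<^sup>2 * real (CARD('n) - 1) / CARD('n) * measure lborel C"
    using n by (simp add: cR)
  assume j: "j \<noteq> o1"
  have int: "set_integrable lborel C (norm2_on S)" for S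
    unfolding C_def by (rule set_integrable_continuous_bounded[OF bounded_std_cylinder[OF rs]])
      (auto intro: continuous_intros std_cylinder_borel)
  have eq: "(LINT z:C|lborel. norm2_on {k} z) = (LINT z:C|lborel. norm2_on {j} z)" if k: "k \<in> R" for k
  proof -
    define T where "T z = (\<chi> i. z $ (Transposition.transpose j k i))" for z :: "complex^'n"
    have lin: "linear T" by (rule linearI) (auto simp: T_def vec_eq_iff)
    have p: "Transposition.transpose j k permutes (UNIV - {o1})"
      by (rule permutes_swap_id) (use j k in \<open>auto simp: R_def\<close>)
    have TC: "orthogonal_transformation T" "T ` C = C"
      unfolding C_def by (rule std_cylinder_invariant[OF lin p], simp add: T_def)+
    have "(LINT z:C|lborel. norm2_on {j} (T z)) = (LINT z:C|lborel. norm2_on {j} z)"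
      by (rule set_integral_invariant[OF TC _ Cb]) (intro continuous_intros)
    then show ?thesis by (simp add: T_def norm2_on_def)
  qed
  have "(LINT z:C|lborel. norm2_on R z) = (\<Sum>k\<in>R. (LINT z:C|lborel. norm2_on {k} z))"
  proof -
    have "(LINT z:C|lborel. norm2_on R z) = (LINT z:C|lborel. (\<Sum>k\<in>R. norm2_on {k} z))"
      by (simp add: norm2_on_def)
    also have "\<dots> = (\<Sum>k\<in>R. (LINT z:C|lborel. norm2_on {k} z))"
      unfolding set_lebesgue_integral_def scaleR_sum_right
      by (rule Bochner_Integration.integral_sum) (use int in \<open>simp add: set_integrable_def\<close>)
    finally show ?thesis .
  qed
  also have "\<dots> = (CARD('n) - 1) * (LINT z:C|lborel. norm2_on {j} z)"
    by (simp add: eq cR)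
  finally have "real (CARD('n) - 1) * (LINT z:C|lborel. norm2_on {j} z)
      = real (CARD('n) - 1) * (s\<^sup>2 / CARD('n) * measure lborel C)"
    using tot by (simp add: field_simps)
  then show "(LINT z:C|lborel. norm2_on {j} z) = s\<^sup>2 / CARD('n) * measure lborel C"
    using n by (subst (asm) mult_cancel_left) auto
qed

text \<open>
  Reflecting one real coordinate shows that mixed products of coordinates integrate to zero, and
  multiplying one complex coordinate by \<open>\<i>\<close> shows that its real and imaginary part have the same
  second moment.
\<close>

lemma integral_quadratic_std_cylinder:
  fixes B :: "complex^'n::finite \<Rightarrow> complex^'n \<Rightarrow> real" and o1 :: 'n
  assumes rs: "r > 0" "s > 0" and n: "CARD('n) \<ge> 2" and B: "bilinear B"
  defines "C \<equiv> std_cylinder o1 r s"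
  shows "(LINT z:C|lborel. B z z) = measure lborel C *
     (r\<^sup>2 / 2 * ((B (axis o1 1) (axis o1 1) + B (axis o1 \<i>) (axis o1 \<i>)) / 2)
      + s\<^sup>2 / CARD('n) * (\<Sum>j\<in>UNIV-{o1}. (B (axis j 1) (axis j 1) + B (axis j \<i>) (axis j \<i>)) / 2))"
proof -
  define I where "I b b' = (LINT z:C|lborel. (z \<bullet> b) * (z \<bullet> b'))" for b b' :: "complex^'n"
  have Cb: "C \<in> sets borel" unfolding C_def by (rule std_cylinder_borel)
  have int: "set_integrable lborel C (\<lambda>z. (z \<bullet> b) * (z \<bullet> b'))" for b b'
    unfolding C_def by (rule set_integrable_continuous_bounded[OF bounded_std_cylinder[OF rs]])
      (auto intro!: continuous_intros std_cylinder_borel)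
  have expand: "B z z = (\<Sum>b\<in>Basis. \<Sum>b'\<in>Basis. B b b' * ((z \<bullet> b) * (z \<bullet> b')))" for z
  proof -
    have "B z z = B (\<Sum>b\<in>Basis. (z \<bullet> b) *\<^sub>R b) (\<Sum>b\<in>Basis. (z \<bullet> b) *\<^sub>R b)"
      by (simp add: euclidean_representation)
    also have "\<dots> = (\<Sum>(b,b')\<in>Basis\<times>Basis. B ((z \<bullet> b) *\<^sub>R b) ((z \<bullet> b') *\<^sub>R b'))"
      by (rule bilinear_sum[OF B])
    finally show ?thesis
      by (simp add: sum.cartesian_product bilinear_lmul[OF B] bilinear_rmul[OF B] split_beta mult_ac)
  qed
  have "(LINT z:C|lborel. B z z) = (\<Sum>b\<in>Basis. \<Sum>b'\<in>Basis. B b b' * I b b')"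
  proof -
    have i1: "integrable lborel (\<lambda>z. indicat_real C z *\<^sub>R (B b b' * ((z \<bullet> b) * (z \<bullet> b'))))" for b b'
      using set_integrable_mult_right[of "B b b'", OF int] by (simp add: set_integrable_def)
    have "(LINT z:C|lborel. B z z)
        = (LINT z|lborel. (\<Sum>b\<in>Basis. \<Sum>b'\<in>Basis. indicat_real C z *\<^sub>R (B b b' * ((z \<bullet> b) * (z \<bullet> b')))))"
      by (simp only: expand set_lebesgue_integral_def scaleR_sum_right)
    also have "\<dots> = (\<Sum>b\<in>Basis. (LINT z|lborel. (\<Sum>b'\<in>Basis. indicat_real C z *\<^sub>R (B b b' * ((z \<bullet> b) * (z \<bullet> b'))))))"
      by (rule Bochner_Integration.integral_sum, rule Bochner_Integration.integrable_sum, rule i1)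
    also have "\<dots> = (\<Sum>b\<in>Basis. \<Sum>b'\<in>Basis.
        (LINT z|lborel. indicat_real C z *\<^sub>R (B b b' * ((z \<bullet> b) * (z \<bullet> b')))))"
      by (rule sum.cong[OF refl], rule Bochner_Integration.integral_sum, rule i1)
    also have "\<dots> = (\<Sum>b\<in>Basis. \<Sum>b'\<in>Basis. B b b' * I b b')"
    proof (intro sum.cong refl)
      fix b b' :: "complex^'n"
      have "(LINT z:C|lborel. B b b' * ((z \<bullet> b) * (z \<bullet> b'))) = B b b' * I b b'"
        unfolding I_def by (rule set_integral_mult_right)
      then show "(LINT z|lborel. indicat_real C z *\<^sub>R (B b b' * ((z \<bullet> b) * (z \<bullet> b')))) = B b b' * I b b'"
        by (simp only: set_lebesgue_integral_def)
    qed
    finally show ?thesis .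
  qed
  also have "\<dots> = (\<Sum>b\<in>Basis. B b b * I b b)"
  proof (rule sum.cong[OF refl])
    fix b :: "complex^'n" assume b: "b \<in> Basis"
    have "I b b' = 0" if b': "b' \<in> Basis" "b' \<noteq> b" for b'
    proof -
      obtain k u where bk: "b = axis k u" "u \<in> Basis" using b by (auto simp: Basis_vec_def)
      define T where "T z = z - (2 * (z \<bullet> b)) *\<^sub>R b" for z :: "complex^'n"
      have lin: "linear T"
        by (rule linearI) (simp_all add: T_def inner_add_left scaleR_add_left scaleR_diff_right distrib_left)
      have nm: "norm (T z $ j) = norm (z $ id j)" for z j
      proof (cases "j = k")
        case True
        have "norm (w - (2 * (w \<bullet> u)) *\<^sub>R u) = norm w" for w :: complex
          using bk(2) by (auto simp: Basis_complex_def cmod_def)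
        then show ?thesis using True by (simp add: T_def bk(1) inner_axis)
      qed (simp add: T_def bk(1) axis_def)
      have TC: "orthogonal_transformation T" "T ` C = C"
        unfolding C_def by (rule std_cylinder_invariant[OF lin permutes_id nm])+
      have "(LINT z:C|lborel. (T z \<bullet> b) * (T z \<bullet> b')) = I b b'"
        unfolding I_def
        by (rule set_integral_invariant[OF TC _ Cb, of "\<lambda>z. (z \<bullet> b) * (z \<bullet> b')"])
          (intro continuous_on_mult continuous_on_inner continuous_on_id continuous_on_const)
      moreover have "(T z \<bullet> b) * (T z \<bullet> b') = - ((z \<bullet> b) * (z \<bullet> b'))" for z
        using b b' by (simp add: T_def inner_diff_left inner_Basis)
      ultimately show ?thesis by (simp add: I_def set_lebesgue_integral_def)
    qed
    then have "(\<Sum>b'\<in>Basis. B b b' * I b b') = (\<Sum>b'\<in>Basis. if b' = b then B b b * I b b else 0)"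
      by (intro sum.cong) auto
    then show "(\<Sum>b'\<in>Basis. B b b' * I b b') = B b b * I b b" using b by simp
  qed
  also have "\<dots> = (\<Sum>j\<in>UNIV. B (axis j 1) (axis j 1) * I (axis j 1) (axis j 1)
        + B (axis j \<i>) (axis j \<i>) * I (axis j \<i>) (axis j \<i>))"
    by (rule sum_Basis_complex_vec)
  also have "\<dots> = (\<Sum>j\<in>UNIV. (LINT z:C|lborel. norm2_on {j} z) *
        ((B (axis j 1) (axis j 1) + B (axis j \<i>) (axis j \<i>)) / 2))"
  proof (rule sum.cong[OF refl])
    fix j :: 'n
    define T where "T z = (\<chi> k. if k = j then \<i> * z $ k else z $ k)" for z :: "complex^'n"
    have lin: "linear T" by (rule linearI) (simp_all add: T_def vec_eq_iff distrib_left)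
    have nm: "norm (T z $ k) = norm (z $ id k)" for z k by (simp add: T_def norm_mult)
    have TC: "orthogonal_transformation T" "T ` C = C"
      unfolding C_def by (rule std_cylinder_invariant[OF lin permutes_id nm])+
    have "(LINT z:C|lborel. (T z \<bullet> axis j \<i>) * (T z \<bullet> axis j \<i>)) = I (axis j \<i>) (axis j \<i>)"
      unfolding I_def
      by (rule set_integral_invariant[OF TC _ Cb, of "\<lambda>z. (z \<bullet> axis j \<i>) * (z \<bullet> axis j \<i>)"])
        (intro continuous_on_mult continuous_on_inner continuous_on_id continuous_on_const)
    moreover have "T z \<bullet> axis j \<i> = z \<bullet> axis j 1" for z by (simp add: T_def inner_axis inner_complex_def)
    ultimately have eq: "I (axis j \<i>) (axis j \<i>) = I (axis j 1) (axis j 1)" by (simp add: I_def)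
    have "norm2_on {j} z = (z \<bullet> axis j 1) * (z \<bullet> axis j 1) + (z \<bullet> axis j \<i>) * (z \<bullet> axis j \<i>)" for z
      unfolding norm2_on_def inner_axis inner_complex_def
      using cmod_power2[of "z $ j"] by (simp add: power2_eq_square)
    then have "(LINT z:C|lborel. norm2_on {j} z)
        = (LINT z:C|lborel. (z \<bullet> axis j 1) * (z \<bullet> axis j 1) + (z \<bullet> axis j \<i>) * (z \<bullet> axis j \<i>))"
      by (simp only:)
    also have "\<dots> = I (axis j 1) (axis j 1) + I (axis j \<i>) (axis j \<i>)"
      unfolding I_def by (rule set_integral_add(2)[OF int int])
    finally have "(LINT z:C|lborel. norm2_on {j} z) = 2 * I (axis j 1) (axis j 1)" by (simp add: eq)
    then show "B (axis j 1) (axis j 1) * I (axis j 1) (axis j 1)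
        + B (axis j \<i>) (axis j \<i>) * I (axis j \<i>) (axis j \<i>)
       = (LINT z:C|lborel. norm2_on {j} z) * ((B (axis j 1) (axis j 1) + B (axis j \<i>) (axis j \<i>)) / 2)"
      unfolding eq by algebra
  qed
  finally have main: "(LINT z:C|lborel. B z z) = (\<Sum>j\<in>UNIV. (LINT z:C|lborel. norm2_on {j} z) *
        ((B (axis j 1) (axis j 1) + B (axis j \<i>) (axis j \<i>)) / 2))" .
  have mom1: "(LINT z:C|lborel. norm2_on {o1} z) = r\<^sup>2 / 2 * measure lborel C"
    unfolding C_def by (rule integral_coordinate_norm_std_cylinder(1)[OF rs n])
  have mom2: "(LINT z:C|lborel. norm2_on {j} z) = s\<^sup>2 / CARD('n) * measure lborel C" if "j \<noteq> o1" for j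
    unfolding C_def by (rule integral_coordinate_norm_std_cylinder(2)[OF rs n that])
  define q where "q j = (B (axis j 1) (axis j 1) + B (axis j \<i>) (axis j \<i>)) / 2" for j
  have "(LINT z:C|lborel. B z z) = (\<Sum>j\<in>UNIV. (LINT z:C|lborel. norm2_on {j} z) * q j)"
    unfolding main q_def ..
  also have "\<dots> = (LINT z:C|lborel. norm2_on {o1} z) * q o1 + (\<Sum>j\<in>UNIV-{o1}. (LINT z:C|lborel. norm2_on {j} z) * q j)"
    by (rule sum.remove) auto
  also have "\<dots> = r\<^sup>2 / 2 * measure lborel C * q o1 + (\<Sum>j\<in>UNIV-{o1}. s\<^sup>2 / CARD('n) * measure lborel C * q j)"
    using mom2 by (simp add: mom1)
  also have "\<dots> = measure lborel C * (r\<^sup>2 / 2 * q o1 + s\<^sup>2 / CARD('n) * (\<Sum>j\<in>UNIV-{o1}. q j))"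
    unfolding sum_distrib_left[symmetric] by algebra
  finally show ?thesis unfolding q_def .
qed

section \<open>Iterated directional derivatives and Taylor bounds\<close>

text \<open>
  The directional derivative as a function of the point, so that it can be iterated.
\<close>

definition dderiv :: "'a \<Rightarrow> ('a::euclidean_space \<Rightarrow> 'b::euclidean_space) \<Rightarrow> 'a \<Rightarrow> 'b"
  where "dderiv v f x = frechet_derivative f (at x) v"

lemma Ck_on_Suc_iff:
  "Ck_on (Suc k) f U \<longleftrightarrow> (\<forall>x\<in>U. f differentiable (at x)) \<and> (\<forall>v. Ck_on k (dderiv v f) U)"
  by (simp add: dderiv_def[abs_def])

declare Ck_on.simps(2)[simp del]

lemma dderiv_eq: "(f has_derivative f') (at x) \<Longrightarrow> dderiv v f x = f' v"
  by (simp add: dderiv_def frechet_derivative_at[symmetric])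

lemma has_derivative_dderiv: "f differentiable (at x) \<Longrightarrow> (f has_derivative (\<lambda>v. dderiv v f x)) (at x)"
  unfolding dderiv_def by (simp add: frechet_derivative_works)

lemma linear_dderiv: "f differentiable (at x) \<Longrightarrow> linear (\<lambda>v. dderiv v f x)"
  by (rule has_derivative_linear[OF has_derivative_dderiv])

lemma dderiv_add_direction: "f differentiable (at x) \<Longrightarrow> dderiv (u + v) f x = dderiv u f x + dderiv v f x"
  by (rule linear_add[OF linear_dderiv])

lemma dderiv_scaleR_direction: "f differentiable (at x) \<Longrightarrow> dderiv (c *\<^sub>R v) f x = c *\<^sub>R dderiv v f x"
  by (rule linear_scale[OF linear_dderiv])

lemma dderiv_cong:
  assumes "open U" "x \<in> U" "\<And>y. y \<in> U \<Longrightarrow> f y = g y"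
  shows "dderiv v f x = dderiv v g x"
proof -
  have "(f has_derivative D) (at x) \<longleftrightarrow> (g has_derivative D) (at x)" for D
    using assms has_derivative_transform_within_open by metis
  then show ?thesis by (simp add: dderiv_def frechet_derivative_def)
qed

lemma differentiable_cong_open:
  assumes "open U" "x \<in> U" "\<And>y. y \<in> U \<Longrightarrow> f y = g y" "f differentiable (at x)"
  shows "g differentiable (at x)"
  using assms has_derivative_transform_within_open unfolding differentiable_def by metis

lemma Ck_on_cong:
  assumes "open U" "\<And>y. y \<in> U \<Longrightarrow> f y = g y" "Ck_on k f U"
  shows "Ck_on k g U"
  using assms(2,3)
proof (induction k arbitrary: f g)
  case 0
  then show ?case using continuous_on_cong by (metis Ck_on.simps(1))
next
  case (Suc k)
  have "g differentiable (at x)" if "x \<in> U" for x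
    using differentiable_cong_open[OF assms(1) that Suc.prems(1)] Suc.prems(2) that
    by (simp add: Ck_on_Suc_iff)
  moreover have "Ck_on k (dderiv v g) U" for v
    using Suc.IH[of "dderiv v f" "dderiv v g"] dderiv_cong[OF assms(1) _ Suc.prems(1)] Suc.prems(2)
    by (simp add: Ck_on_Suc_iff)
  ultimately show ?case by (simp add: Ck_on_Suc_iff)
qed

lemma Ck_on_Suc_imp: "Ck_on (Suc k) f U \<Longrightarrow> Ck_on k f U"
proof (induction k arbitrary: f)
  case 0
  then show ?case
    by (simp add: Ck_on_Suc_iff continuous_at_imp_continuous_on differentiable_imp_continuous_within)
qed (simp add: Ck_on_Suc_iff)

lemma Ck_on_mono: "k \<le> m \<Longrightarrow> Ck_on m f U \<Longrightarrow> Ck_on k f U"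
  by (induction m rule: dec_induct) (auto intro: Ck_on_Suc_imp)

lemma dderiv_bounded_linear:
  assumes "bounded_linear T" "f differentiable (at x)"
  shows "dderiv v (\<lambda>x. T (f x)) x = T (dderiv v f x)"
  by (rule dderiv_eq) (rule bounded_linear.has_derivative[OF assms(1) has_derivative_dderiv[OF assms(2)]])

lemma dderiv_bilinear:
  assumes "bounded_bilinear B" "f differentiable (at x)" "g differentiable (at x)"
  shows "dderiv v (\<lambda>x. B (f x) (g x)) x = B (f x) (dderiv v g x) + B (dderiv v f x) (g x)"
  by (rule dderiv_eq)
    (rule bounded_bilinear.FDERIV[OF assms(1) has_derivative_dderiv[OF assms(2)] has_derivative_dderiv[OF assms(3)]])

lemma dderiv_add:
  assumes "f differentiable (at x)" "g differentiable (at x)"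
  shows "dderiv v (\<lambda>x. f x + g x) x = dderiv v f x + dderiv v g x"
  by (rule dderiv_eq) (intro has_derivative_add has_derivative_dderiv assms)

lemma differentiable_bilinear:
  fixes f :: "'a::euclidean_space \<Rightarrow> 'b::euclidean_space" and g :: "'a \<Rightarrow> 'c::euclidean_space"
    and B :: "'b \<Rightarrow> 'c \<Rightarrow> 'd::euclidean_space"
  assumes "bounded_bilinear B" "f differentiable (at x)" "g differentiable (at x)"
  shows "(\<lambda>x. B (f x) (g x)) differentiable (at x)"
  using bounded_bilinear.FDERIV[OF assms(1) has_derivative_dderiv[OF assms(2)] has_derivative_dderiv[OF assms(3)]]
  by (rule differentiableI)

lemma differentiable_bounded_linear:
  fixes f :: "'a::euclidean_space \<Rightarrow> 'b::euclidean_space" and T :: "'b \<Rightarrow> 'd::euclidean_space"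
  assumes "bounded_linear T" "f differentiable (at x)"
  shows "(\<lambda>x. T (f x)) differentiable (at x)"
  using bounded_linear.has_derivative[OF assms(1) has_derivative_dderiv[OF assms(2)]]
  by (rule differentiableI)

lemma Ck_on_bounded_linear:
  assumes "open U" "bounded_linear T" "Ck_on k f U"
  shows "Ck_on k (\<lambda>x. T (f x)) U"
  using assms(3)
proof (induction k arbitrary: f)
  case 0
  then show ?case using bounded_linear.continuous_on[OF assms(2)] by simp
next
  case (Suc k)
  have "Ck_on k (dderiv v (\<lambda>x. T (f x))) U" for v
    by (rule Ck_on_cong[OF assms(1), of "\<lambda>x. T (dderiv v f x)"])
      (use Suc in \<open>auto simp: Ck_on_Suc_iff dderiv_bounded_linear[OF assms(2)]\<close>)
  then show ?case
    using Suc.prems by (auto simp: Ck_on_Suc_iff intro: differentiable_bounded_linear[OF assms(2)])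
qed

lemma Ck_on_add:
  assumes "open U" "Ck_on k f U" "Ck_on k g U"
  shows "Ck_on k (\<lambda>x. f x + g x) U"
  using assms(2,3)
proof (induction k arbitrary: f g)
  case 0
  then show ?case by (simp add: continuous_on_add)
next
  case (Suc k)
  have "Ck_on k (dderiv v (\<lambda>x. f x + g x)) U" for v
    by (rule Ck_on_cong[OF assms(1), of "\<lambda>x. dderiv v f x + dderiv v g x"])
      (use Suc in \<open>auto simp: Ck_on_Suc_iff dderiv_add\<close>)
  then show ?case using Suc.prems by (simp add: Ck_on_Suc_iff)
qed

lemma Ck_on_bilinear:
  assumes "open U" "bounded_bilinear B" "Ck_on k f U" "Ck_on k g U"
  shows "Ck_on k (\<lambda>x. B (f x) (g x)) U"
  using assms(3,4)
proof (induction k arbitrary: f g)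
  case 0
  then show ?case by (simp add: bounded_bilinear.continuous_on[OF assms(2)])
next
  case (Suc k)
  have "Ck_on k (dderiv v (\<lambda>x. B (f x) (g x))) U" for v
  proof (rule Ck_on_cong[OF assms(1), of "\<lambda>x. B (f x) (dderiv v g x) + B (dderiv v f x) (g x)"])
    show "Ck_on k (\<lambda>x. B (f x) (dderiv v g x) + B (dderiv v f x) (g x)) U"
      using Suc.prems Ck_on_Suc_imp[OF Suc.prems(1)] Ck_on_Suc_imp[OF Suc.prems(2)]
      by (intro Ck_on_add assms(1) Suc.IH) (auto simp: Ck_on_Suc_iff)
  qed (use Suc.prems in \<open>auto simp: Ck_on_Suc_iff dderiv_bilinear[OF assms(2)]\<close>)
  then show ?case
    using Suc.prems by (auto simp: Ck_on_Suc_iff intro: differentiable_bilinear[OF assms(2)])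
qed

lemma Ck_on_const: "Ck_on k (\<lambda>x. c) U"
proof (induction k arbitrary: c)
  case (Suc k)
  have "dderiv v (\<lambda>x. c) = (\<lambda>x. 0)" for v :: 'a by (rule ext, rule dderiv_eq) (rule has_derivative_const)
  then show ?case using Suc by (simp add: Ck_on_Suc_iff)
qed simp

lemma dderiv_affine:
  assumes "bounded_linear T"
  shows "dderiv v (\<lambda>x. c + T (x - a)) = (\<lambda>x. T v)"
proof
  fix x
  have "((\<lambda>x. c + T (x - a)) has_derivative (\<lambda>v. 0 + T (v - 0))) (at x)"
    by (intro has_derivative_add has_derivative_const bounded_linear.has_derivative[OF assms]
        has_derivative_diff has_derivative_ident)
  then show "dderiv v (\<lambda>x. c + T (x - a)) x = T v" by (simp add: dderiv_eq)
qed

lemma differentiable_affine: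
  assumes "bounded_linear T"
  shows "(\<lambda>x. c + T (x - a)) differentiable (at x)"
proof -
  have "((\<lambda>x. c + T (x - a)) has_derivative (\<lambda>v. 0 + T (v - 0))) (at x)"
    by (intro has_derivative_add has_derivative_const bounded_linear.has_derivative[OF assms]
        has_derivative_diff has_derivative_ident)
  then show ?thesis by (rule differentiableI)
qed

lemma Ck_on_affine:
  assumes "bounded_linear T"
  shows "Ck_on k (\<lambda>x. c + T (x - a)) U"
proof (cases k)
  case 0
  then show ?thesis
    using differentiable_affine[OF assms]
    by (simp add: continuous_at_imp_continuous_on differentiable_imp_continuous_within)
next
  case (Suc m)
  then show ?thesis
    using differentiable_affine[OF assms] by (simp add: Ck_on_Suc_iff dderiv_affine[OF assms] Ck_on_const)
qed

lemma Ck_on_sum: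
  assumes "open U" "\<And>i. i \<in> I \<Longrightarrow> Ck_on k (f i) U"
  shows "Ck_on k (\<lambda>x. \<Sum>i\<in>I. f i x) U"
  using assms(2) by (induction I rule: infinite_finite_induct) (auto intro: Ck_on_const Ck_on_add assms(1))

lemma Ck_on_smooth: "smooth_on f U \<Longrightarrow> Ck_on k f U"
  by (simp add: smooth_on_def)

lemma dderiv_Basis_expand:
  assumes "f differentiable (at x)"
  shows "dderiv z f x = (\<Sum>b\<in>Basis. (z \<bullet> b) *\<^sub>R dderiv b f x)"
proof -
  have "dderiv z f x = dderiv (\<Sum>b\<in>Basis. (z \<bullet> b) *\<^sub>R b) f x" by (simp add: euclidean_representation)
  also have "\<dots> = (\<Sum>b\<in>Basis. (z \<bullet> b) *\<^sub>R dderiv b f x)"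
    by (subst linear_sum[OF linear_dderiv[OF assms]]) (simp add: dderiv_scaleR_direction[OF assms])
  finally show ?thesis .
qed

lemma Ck_on_funpow_dderiv: "Ck_on (m + k) f U \<Longrightarrow> Ck_on k ((dderiv z ^^ m) f) U"
  by (induction m arbitrary: f) (auto simp: Ck_on_Suc_iff funpow_Suc_right simp del: funpow.simps)

lemma funpow_dderiv_cong:
  assumes "open U" "\<And>y. y \<in> U \<Longrightarrow> f y = g y" "x \<in> U"
  shows "(dderiv z ^^ k) f x = (dderiv z ^^ k) g x"
  using assms(2)
proof (induction k arbitrary: f g)
  case 0 then show ?case using assms(3) by simp
next
  case (Suc k)
  have "dderiv z f y = dderiv z g y" if "y \<in> U" for y by (rule dderiv_cong[OF assms(1) that Suc.prems])
  from Suc.IH[OF this] show ?case by (simp add: funpow_Suc_right del: funpow.simps)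
qed

lemma funpow_dderiv_sum:
  assumes "open U" "finite I" "\<And>i. i \<in> I \<Longrightarrow> Ck_on k (f i) U" "x \<in> U"
  shows "(dderiv z ^^ k) (\<lambda>x. \<Sum>i\<in>I. c i *\<^sub>R f i x) x = (\<Sum>i\<in>I. c i *\<^sub>R (dderiv z ^^ k) (f i) x)"
  using assms(3)
proof (induction k arbitrary: f)
  case 0 then show ?case by simp
next
  case (Suc k)
  have "dderiv z (\<lambda>x. \<Sum>i\<in>I. c i *\<^sub>R f i x) y = (\<Sum>i\<in>I. c i *\<^sub>R dderiv z (f i) y)" if "y \<in> U" for y
    by (rule dderiv_eq) (use Suc.prems that in \<open>auto intro!: has_derivative_sum has_derivative_scaleR_right
        has_derivative_dderiv simp: Ck_on_Suc_iff\<close>)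
  then have "(dderiv z ^^ k) (dderiv z (\<lambda>x. \<Sum>i\<in>I. c i *\<^sub>R f i x)) x = (dderiv z ^^ k) (\<lambda>y. \<Sum>i\<in>I. c i *\<^sub>R dderiv z (f i) y) x"
    by (intro funpow_dderiv_cong[OF assms(1) _ assms(4)])
  also have "\<dots> = (\<Sum>i\<in>I. c i *\<^sub>R (dderiv z ^^ k) (dderiv z (f i)) x)"
    by (rule Suc.IH) (use Suc.prems in \<open>auto simp: Ck_on_Suc_iff\<close>)
  finally show ?case by (simp add: funpow_Suc_right del: funpow.simps)
qed

text \<open>
  The point is the uniformity in the direction \<open>z\<close>: expanding \<open>z\<close> in the basis reduces the claim to
  finitely many derivatives, each bounded on the compact set.
\<close>

lemma funpow_dderiv_bound:
  fixes f :: "'a::euclidean_space \<Rightarrow> 'b::euclidean_space"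
  assumes U: "open U" and K: "compact K" "K \<subseteq> U" and f: "Ck_on k f U"
  shows "\<exists>C\<ge>0. \<forall>z. \<forall>x\<in>K. norm ((dderiv z ^^ k) f x) \<le> C * norm z ^ k"
  using f
proof (induction k arbitrary: f)
  case 0
  then have "compact (f ` K)" using K by (intro compact_continuous_image) (auto intro: continuous_on_subset)
  then obtain C where C: "\<forall>y\<in>f ` K. norm y \<le> C" using compact_imp_bounded bounded_iff by metis
  have "norm (f x) \<le> max C 0" if "x \<in> K" for x
    using C that by (meson image_eqI max.coboundedI1)
  then show ?case by (intro exI[of _ "max C 0"]) auto
next
  case (Suc k)
  have "\<exists>C\<ge>0. \<forall>z. \<forall>x\<in>K. norm ((dderiv z ^^ k) (dderiv b f) x) \<le> C * norm z ^ k" for b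
    by (rule Suc.IH) (use Suc.prems in \<open>simp add: Ck_on_Suc_iff\<close>)
  then obtain C where C: "\<And>b. C b \<ge> 0" "\<And>b z x. x \<in> K \<Longrightarrow> norm ((dderiv z ^^ k) (dderiv b f) x) \<le> C b * norm z ^ k"
    by metis
  have "norm ((dderiv z ^^ Suc k) f x) \<le> sum C Basis * norm z ^ Suc k" if x: "x \<in> K" for z x
  proof -
    have "(dderiv z ^^ Suc k) f x = (dderiv z ^^ k) (dderiv z f) x"
      by (simp add: funpow_Suc_right del: funpow.simps)
    also have "\<dots> = (dderiv z ^^ k) (\<lambda>y. \<Sum>b\<in>Basis. (z \<bullet> b) *\<^sub>R dderiv b f y) x"
      using Suc.prems K(2) x
      by (intro funpow_dderiv_cong[OF U] dderiv_Basis_expand) (auto simp: Ck_on_Suc_iff)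
    also have "\<dots> = (\<Sum>b\<in>Basis. (z \<bullet> b) *\<^sub>R (dderiv z ^^ k) (dderiv b f) x)"
      using Suc.prems K(2) x by (intro funpow_dderiv_sum[OF U]) (auto simp: Ck_on_Suc_iff)
    also have "norm \<dots> \<le> (\<Sum>b\<in>Basis. norm z * (C b * norm z ^ k))"
    proof (rule order_trans[OF norm_sum], rule sum_mono)
      fix b :: 'a assume "b \<in> Basis"
      then have "\<bar>z \<bullet> b\<bar> * norm ((dderiv z ^^ k) (dderiv b f) x) \<le> norm z * (C b * norm z ^ k)"
        by (intro mult_mono C(2) x Basis_le_norm) auto
      then show "norm ((z \<bullet> b) *\<^sub>R (dderiv z ^^ k) (dderiv b f) x) \<le> norm z * (C b * norm z ^ k)" by simp
    qed
    also have "\<dots> = sum C Basis * norm z ^ Suc k"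
      by (simp add: sum_distrib_right sum_distrib_left mult_ac)
    finally show ?thesis .
  qed
  then show ?case using C(1) by (intro exI[of _ "sum C Basis"]) (auto intro: sum_nonneg)
qed

lemma Taylor_dderiv:
  fixes f :: "'a::euclidean_space \<Rightarrow> real"
  assumes U: "open U" and f: "Ck_on n f U" "n > 0" and seg: "\<And>t. 0 \<le> t \<Longrightarrow> t \<le> 1 \<Longrightarrow> a + t *\<^sub>R z \<in> U"
  shows "\<exists>t. 0 < t \<and> t \<le> 1 \<and> f (a + z) =
     (\<Sum>m<n. (dderiv z ^^ m) f a / fact m) + (dderiv z ^^ n) f (a + t *\<^sub>R z) / fact n"
proof -
  define d where "d m t = (dderiv z ^^ m) f (a + t *\<^sub>R z)" for m and t :: real
  have "DERIV (d m) t :> d (Suc m) t" if "m < n" "0 \<le> t" "t \<le> 1" for m t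
  proof -
    have "Ck_on (Suc 0) ((dderiv z ^^ m) f) U"
      by (rule Ck_on_funpow_dderiv) (rule Ck_on_mono[OF _ f(1)], use that in simp)
    then have "((dderiv z ^^ m) f) differentiable (at (a + t *\<^sub>R z))"
      using seg[OF that(2,3)] by (simp add: Ck_on_Suc_iff)
    from has_derivative_dderiv[OF this]
    have 1: "((dderiv z ^^ m) f has_derivative (\<lambda>v. dderiv v ((dderiv z ^^ m) f) (a + t *\<^sub>R z))) (at (a + t *\<^sub>R z))" .
    have "((\<lambda>t. a + t *\<^sub>R z) has_derivative (\<lambda>s. s *\<^sub>R z)) (at t)"
      by (auto intro!: derivative_eq_intros)
    from has_derivative_compose[OF this 1]
    have "(d m has_derivative (\<lambda>s. dderiv (s *\<^sub>R z) ((dderiv z ^^ m) f) (a + t *\<^sub>R z))) (at t)"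
      by (simp add: d_def[abs_def])
    moreover have "dderiv (s *\<^sub>R z) ((dderiv z ^^ m) f) (a + t *\<^sub>R z) = d (Suc m) t * s" for s
      using linear_scale[OF has_derivative_linear[OF 1]] by (simp add: d_def)
    ultimately show ?thesis by (simp add: has_field_derivative_def)
  qed
  then have "\<exists>t>0. t \<le> 1 \<and> d 0 1 = (\<Sum>m<n. d m 0 / fact m * 1 ^ m) + d n t / fact n * 1 ^ n"
    by (intro Maclaurin2) auto
  then show ?thesis by (auto simp: d_def)
qed

lemma Taylor1_bound_real:
  fixes f :: "'a::euclidean_space \<Rightarrow> real"
  assumes U: "open U" and f: "Ck_on 2 f U" and R: "cball a R \<subseteq> U"
  shows "\<exists>C\<ge>0. \<forall>z. norm z \<le> R \<longrightarrow> \<bar>f (a + z) - f a - dderiv z f a\<bar> \<le> C * (norm z)\<^sup>2"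
proof -
  obtain C where C: "C \<ge> 0" "\<And>z x. x \<in> cball a R \<Longrightarrow> norm ((dderiv z ^^ 2) f x) \<le> C * norm z ^ 2"
    using funpow_dderiv_bound[OF U compact_cball R f] by blast
  have "\<bar>f (a + z) - f a - dderiv z f a\<bar> \<le> C * (norm z)\<^sup>2" if z: "norm z \<le> R" for z
  proof -
    have in_ball: "a + t *\<^sub>R z \<in> cball a R" if "0 \<le> t" "t \<le> 1" for t
      using mult_mono[of t 1 "norm z" R] that z by (simp add: dist_norm)
    have "\<exists>t. 0 < t \<and> t \<le> 1 \<and>
        f (a + z) = (\<Sum>m<2. (dderiv z ^^ m) f a / fact m) + (dderiv z ^^ 2) f (a + t *\<^sub>R z) / fact 2"
      by (rule Taylor_dderiv[OF U f]) (use in_ball R in auto)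
    then obtain t where t: "0 < t" "t \<le> 1"
      "f (a + z) = (\<Sum>m<2. (dderiv z ^^ m) f a / fact m) + (dderiv z ^^ 2) f (a + t *\<^sub>R z) / fact 2"
      by blast
    then have "f (a + z) - f a - dderiv z f a = (dderiv z ^^ 2) f (a + t *\<^sub>R z) / 2"
      by (simp add: numeral_2_eq_2)
    moreover have "\<bar>(dderiv z ^^ 2) f (a + t *\<^sub>R z)\<bar> \<le> C * (norm z)\<^sup>2"
      using C(2)[OF in_ball[of t]] t by simp
    ultimately show ?thesis by simp
  qed
  then show ?thesis using C(1) by blast
qed

lemma Taylor1_bound:
  fixes f :: "'a::euclidean_space \<Rightarrow> 'b::euclidean_space"
  assumes U: "open U" and f: "Ck_on 2 f U" and R: "cball a R \<subseteq> U" "a \<in> U"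
  shows "\<exists>C\<ge>0. \<forall>z. norm z \<le> R \<longrightarrow> norm (f (a + z) - f a - dderiv z f a) \<le> C * (norm z)\<^sup>2"
proof -
  have d: "f differentiable (at a)" using f R(2) by (simp add: numeral_2_eq_2 Ck_on_Suc_iff)
  have bl: "bounded_linear (\<lambda>y. y \<bullet> b)" for b :: 'b by (rule bounded_linear_inner_left)
  have "\<exists>C\<ge>0. \<forall>z. norm z \<le> R \<longrightarrow> \<bar>f (a + z) \<bullet> b - f a \<bullet> b - dderiv z (\<lambda>x. f x \<bullet> b) a\<bar> \<le> C * (norm z)\<^sup>2" for b
    by (rule Taylor1_bound_real[OF U Ck_on_bounded_linear[OF U bl f] R(1)])
  then obtain C where C: "\<And>b. C b \<ge> 0"
    "\<And>b z. norm z \<le> R \<Longrightarrow> \<bar>f (a + z) \<bullet> b - f a \<bullet> b - dderiv z (\<lambda>x. f x \<bullet> b) a\<bar> \<le> C b * (norm z)\<^sup>2"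
    by metis
  have "norm (f (a + z) - f a - dderiv z f a) \<le> sum C Basis * (norm z)\<^sup>2" if "norm z \<le> R" for z
  proof -
    have "norm (f (a + z) - f a - dderiv z f a) \<le> (\<Sum>b\<in>Basis. \<bar>(f (a + z) - f a - dderiv z f a) \<bullet> b\<bar>)"
      by (rule norm_le_l1)
    also have "\<dots> \<le> (\<Sum>b\<in>Basis. C b * (norm z)\<^sup>2)"
      using C(2)[OF that] by (intro sum_mono) (simp add: inner_diff_left dderiv_bounded_linear[OF bl d])
    finally show ?thesis by (simp add: sum_distrib_right)
  qed
  then show ?thesis using C(1) by (intro exI[of _ "sum C Basis"]) (auto intro: sum_nonneg)
qed

text \<open>
  Along \<open>z\<close> and \<open>-z\<close> the terms of odd order cancel, which makes the error one order better than
  for \<open>f (a + z)\<close> alone.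
\<close>

lemma Taylor_even_bound:
  fixes f :: "'a::euclidean_space \<Rightarrow> real"
  assumes U: "open U" and f: "Ck_on 4 f U" and R: "cball a R \<subseteq> U" "a \<in> U"
  shows "\<exists>C\<ge>0. \<forall>z. norm z \<le> R \<longrightarrow> \<bar>f (a + z) + f (a - z) - 2 * f a - dderiv z (dderiv z f) a\<bar> \<le> C * (norm z) ^ 4"
proof -
  obtain C where C: "C \<ge> 0" "\<And>z x. x \<in> cball a R \<Longrightarrow> norm ((dderiv z ^^ 4) f x) \<le> C * norm z ^ 4"
    using funpow_dderiv_bound[OF U compact_cball R(1) f] by blast
  have neg: "(dderiv (-z) ^^ m) f x = (-1) ^ m * (dderiv z ^^ m) f x" if "x \<in> U" "m \<le> 4" for m z x
    using that
  proof (induction m arbitrary: x)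
    case (Suc m)
    have "Ck_on (Suc 0) ((dderiv z ^^ m) f) U"
      by (rule Ck_on_funpow_dderiv) (rule Ck_on_mono[OF _ f], use Suc.prems in simp)
    then have d: "((dderiv z ^^ m) f) differentiable (at x)" using Suc.prems by (simp add: Ck_on_Suc_iff)
    have "(dderiv (-z) ^^ Suc m) f x = dderiv (-z) (\<lambda>y. (-1) ^ m * (dderiv z ^^ m) f y) x"
      using Suc by (auto intro!: dderiv_cong[OF U])
    also have "\<dots> = (-1) ^ m * dderiv (-z) ((dderiv z ^^ m) f) x"
      by (rule dderiv_bounded_linear[OF bounded_linear_mult_right d])
    also have "dderiv (-z) ((dderiv z ^^ m) f) x = - dderiv z ((dderiv z ^^ m) f) x"
      by (rule linear_neg[OF linear_dderiv[OF d]])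
    finally show ?case by simp
  qed simp
  have "\<bar>f (a + z) + f (a - z) - 2 * f a - dderiv z (dderiv z f) a\<bar> \<le> C * (norm z) ^ 4" if z: "norm z \<le> R" for z
  proof -
    have T: "\<exists>t. 0 < t \<and> t \<le> 1 \<and> f (a + z) = (\<Sum>m<4. (dderiv z ^^ m) f a / fact m) + (dderiv z ^^ 4) f (a + t *\<^sub>R z) / fact 4
          \<and> a + t *\<^sub>R z \<in> cball a R"
      if "norm z \<le> R" for z
    proof -
      have in_ball: "a + t *\<^sub>R z \<in> cball a R" if "0 \<le> t" "t \<le> 1" for t
        using mult_mono[of t 1 "norm z" R] that \<open>norm z \<le> R\<close> by (simp add: dist_norm)
      then show ?thesis using Taylor_dderiv[OF U f _, of a z] R(1) by (force simp: subset_eq)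
    qed
    obtain t where t: "f (a + z) = (\<Sum>m<4. (dderiv z ^^ m) f a / fact m) + (dderiv z ^^ 4) f (a + t *\<^sub>R z) / fact 4"
      "a + t *\<^sub>R z \<in> cball a R" using T[OF z] by blast
    obtain t' where t': "f (a + (-z)) = (\<Sum>m<4. (dderiv (-z) ^^ m) f a / fact m) + (dderiv (-z) ^^ 4) f (a + t' *\<^sub>R (-z)) / fact 4"
      "a + t' *\<^sub>R (-z) \<in> cball a R" using T[of "-z"] z by auto
    have four: "{..<4} = {0,1,2,3::nat}" by auto
    have "f (a - z) = (\<Sum>m<4. (-1) ^ m * (dderiv z ^^ m) f a / fact m) + (dderiv (-z) ^^ 4) f (a + t' *\<^sub>R (-z)) / fact 4"
      using t'(1) neg[OF R(2)] by simp
    then have "f (a + z) + f (a - z) - 2 * f a - dderiv z (dderiv z f) a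
       = ((dderiv z ^^ 4) f (a + t *\<^sub>R z) + (dderiv (-z) ^^ 4) f (a + t' *\<^sub>R (-z))) / 24"
      unfolding t(1) by (simp add: four fact_numeral power3_eq_cube numeral_2_eq_2 field_simps)
    moreover have "\<bar>(dderiv z ^^ 4) f (a + t *\<^sub>R z)\<bar> \<le> C * norm z ^ 4"
      using C(2)[OF t(2)] by simp
    moreover have "\<bar>(dderiv (-z) ^^ 4) f (a + t' *\<^sub>R (-z))\<bar> \<le> C * norm z ^ 4"
      using C(2)[OF t'(2), of "-z"] by simp
    ultimately show ?thesis by (simp only: abs_divide) (auto simp: abs_le_iff field_simps)
  qed
  then show ?thesis using C(1) by blast
qed

text \<open>
  This makes the second order Taylor term a quadratic form, to which
  \<open>integral_quadratic_std_cylinder\<close> applies.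
\<close>

lemma bilinear_dderiv_dderiv:
  assumes U: "open U" and f: "Ck_on 2 f U" and a: "a \<in> U"
  shows "bilinear (\<lambda>u v. dderiv u (dderiv v f) a)"
proof -
  have d1: "f differentiable (at x)" if "x \<in> U" for x
    using f that by (simp add: numeral_2_eq_2 Ck_on_Suc_iff)
  have d2: "dderiv v f differentiable (at a)" for v
    using f a by (simp add: numeral_2_eq_2 Ck_on_Suc_iff)
  have "linear (\<lambda>v. dderiv u (dderiv v f) a)" for u
  proof (rule linearI)
    fix v w
    have "dderiv u (dderiv (v + w) f) a = dderiv u (\<lambda>x. dderiv v f x + dderiv w f x) a"
      by (rule dderiv_cong[OF U a]) (simp add: dderiv_add_direction[OF d1])
    then show "dderiv u (dderiv (v + w) f) a = dderiv u (dderiv v f) a + dderiv u (dderiv w f) a"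
      by (simp add: dderiv_add d2)
  next
    fix c v
    have "dderiv u (dderiv (c *\<^sub>R v) f) a = dderiv u (\<lambda>x. c *\<^sub>R dderiv v f x) a"
      by (rule dderiv_cong[OF U a]) (simp add: dderiv_scaleR_direction[OF d1])
    then show "dderiv u (dderiv (c *\<^sub>R v) f) a = c *\<^sub>R dderiv u (dderiv v f) a"
      by (simp add: dderiv_bounded_linear[OF bounded_linear_scaleR_right d2])
  qed
  then show ?thesis using linear_dderiv[OF d2] by (simp add: bilinear_def)
qed

section \<open>Wirtinger derivatives along a direction\<close>

lemma inner_smult_left: "((c::complex) *s x) \<bullet> y = x \<bullet> (cnj c *s (y :: complex^'n))"
  by (simp add: inner_vec_def inner_complex_def algebra_simps)

lemma bounded_bilinear_matrix_vector_mult: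
  "bounded_bilinear ((*v) :: complex^'m^'n \<Rightarrow> complex^'m \<Rightarrow> complex^'n)"
proof -
  have "bilinear ((*v) :: complex^'m^'n \<Rightarrow> complex^'m \<Rightarrow> complex^'n)"
    unfolding bilinear_def
    by (auto intro!: linearI simp: vec_eq_iff matrix_vector_mult_def sum.distrib scaleR_sum_right algebra_simps)
  then show ?thesis by (simp add: bilinear_conv_bounded_bilinear)
qed

lemma bounded_linear_vec_scale: "bounded_linear (\<lambda>x::complex^'n. c *s x)"
  unfolding linear_conv_bounded_linear[symmetric]
  by (rule linearI) (simp_all add: vec_eq_iff algebra_simps)

lemma dderiv_complex_coordinates:
  fixes f :: "complex^'n::finite \<Rightarrow> complex"
  assumes "f differentiable (at x)"
  shows "dderiv v f x = (\<Sum>j\<in>UNIV. of_real (Re (v $ j)) * dderiv (axis j 1) f x + of_real (Im (v $ j)) * dderiv (axis j \<i>) f x)"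
  using dderiv_Basis_expand[OF assms, of v]
  by (simp add: sum_Basis_complex_vec inner_axis inner_complex_def scaleR_conv_of_real)

text \<open>
  This and the next lemma express the \<open>(1,0)\<close>-derivative \<open>\<partial>\<^sub>v\<close> and the \<open>(0,1)\<close>-derivative \<open>dbar\<^sub>v\<close> along
  a vector through real derivatives along \<open>v\<close> and \<open>\<i> v\<close>; the curvature computations use one such
  vector at a time.
\<close>

lemma sum_dz_direction:
  fixes f :: "complex^'n::finite \<Rightarrow> complex"
  assumes "f differentiable (at x)"
  shows "(\<Sum>j\<in>UNIV. v $ j * dz j f x) = (dderiv v f x - \<i> * dderiv (\<i> *s v) f x) / 2"
proof -
  have t: "v $ j * dz j f x
    = ((of_real (Re (v $ j)) * dderiv (axis j 1) f x + of_real (Im (v $ j)) * dderiv (axis j \<i>) f x)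
      - \<i> * (of_real (Re ((\<i> *s v) $ j)) * dderiv (axis j 1) f x + of_real (Im ((\<i> *s v) $ j)) * dderiv (axis j \<i>) f x)) / 2" for j
    unfolding dz_def dderiv_def[symmetric]
    by (subst complex_eq[of "v $ j"]) (simp add: field_simps)
  show ?thesis
    unfolding t dderiv_complex_coordinates[OF assms, of v] dderiv_complex_coordinates[OF assms, of "\<i> *s v"]
    by (simp only: sum_divide_distrib[symmetric] sum_subtractf sum_distrib_left[symmetric])
qed

lemma sum_dzbar_direction:
  fixes f :: "complex^'n::finite \<Rightarrow> complex"
  assumes "f differentiable (at x)"
  shows "(\<Sum>j\<in>UNIV. cnj (v $ j) * dzbar j f x) = (dderiv v f x + \<i> * dderiv (\<i> *s v) f x) / 2"
proof -
  have t: "cnj (v $ j) * dzbar j f x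
    = ((of_real (Re (v $ j)) * dderiv (axis j 1) f x + of_real (Im (v $ j)) * dderiv (axis j \<i>) f x)
      + \<i> * (of_real (Re ((\<i> *s v) $ j)) * dderiv (axis j 1) f x + of_real (Im ((\<i> *s v) $ j)) * dderiv (axis j \<i>) f x)) / 2" for j
    unfolding dzbar_def dderiv_def[symmetric]
    by (subst complex_eq[of "v $ j"]) (simp add: field_simps)
  show ?thesis
    unfolding t dderiv_complex_coordinates[OF assms, of v] dderiv_complex_coordinates[OF assms, of "\<i> *s v"]
    by (simp only: sum_divide_distrib[symmetric] sum.distrib sum_distrib_left[symmetric])
qed

section \<open>Differentiability of the inverse matrix\<close>

lemma differentiable_prod:
  fixes f :: "'i \<Rightarrow> 'a::real_normed_vector \<Rightarrow> complex"
  assumes "\<And>i. i \<in> I \<Longrightarrow> f i differentiable (at x)"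
  shows "(\<lambda>y. \<Prod>i\<in>I. f i y) differentiable (at x)"
  using assms by (induction I rule: infinite_finite_induct) (auto intro!: differentiable_mult)

lemma differentiable_det:
  fixes A :: "'a::real_normed_vector \<Rightarrow> complex^'r^'r"
  assumes "\<And>i j. (\<lambda>y. A y $ i $ j) differentiable (at x)"
  shows "(\<lambda>y. det (A y)) differentiable (at x)"
  unfolding det_def
  by (intro differentiable_sum differentiable_mult differentiable_const differentiable_prod ballI assms)
    auto

lemma matrix_inv_right:
  fixes A :: "complex^'r^'r"
  assumes "det A \<noteq> 0"
  shows "A ** matrix_inv A = mat 1"
proof -
  obtain B where "A ** B = mat 1 \<and> B ** A = mat 1"
    using assms invertible_det_nz[of A] unfolding invertible_def by blast
  then show ?thesis unfolding matrix_inv_def by (rule someI2) simp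
qed

text \<open>
  By Cramer's rule the entries of the inverse are quotients of determinants, hence differentiable
  functions of the matrix.
\<close>

lemma matrix_inv_entry:
  fixes A :: "complex^'r^'r"
  assumes "det A \<noteq> 0"
  shows "matrix_inv A $ k $ l = det (\<chi> i j. if j = k then axis l 1 $ i else A $ i $ j) / det A"
proof -
  from matrix_inv_right[OF assms] have "A *v (matrix_inv A *v axis l 1) = axis l 1"
    by (simp add: matrix_vector_mul_assoc)
  then have "matrix_inv A *v axis l 1 = (\<chi> k. det (\<chi> i j. if j = k then axis l 1 $ i else A $ i $ j) / det A)"
    by (simp only: cramer[OF assms])
  then have "(matrix_inv A *v axis l 1) $ k = det (\<chi> i j. if j = k then axis l 1 $ i else A $ i $ j) / det A"
    by (simp only: vec_lambda_beta)
  moreover have "(\<Sum>j\<in>UNIV. matrix_inv A $ k $ j * axis l 1 $ j) = (\<Sum>j\<in>UNIV. if j = l then matrix_inv A $ k $ j else 0)"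
    by (intro sum.cong) (auto simp: axis_def)
  then have "(matrix_inv A *v axis l 1) $ k = matrix_inv A $ k $ l"
    by (simp add: matrix_vector_mult_def)
  ultimately show ?thesis by (simp only:)
qed

lemma bounded_linear_entry: "bounded_linear (\<lambda>M::complex^'m^'n. M $ i $ j)"
  by (rule bounded_linear_compose[OF bounded_linear_vec_nth bounded_linear_vec_nth])

lemma differentiable_matrix_inv_entry:
  fixes H :: "'a::euclidean_space \<Rightarrow> complex^'r^'r"
  assumes U: "open U" "x \<in> U" and d: "\<And>y. y \<in> U \<Longrightarrow> det (H y) \<noteq> 0" and H: "H differentiable (at x)"
  shows "(\<lambda>y. matrix_inv (H y) $ k $ l) differentiable (at x)"
proof (rule differentiable_cong_open[OF U])
  show "det (\<chi> i j. if j = k then axis l 1 $ i else H y $ i $ j) / det (H y) = matrix_inv (H y) $ k $ l"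
    if "y \<in> U" for y by (rule matrix_inv_entry[OF d[OF that], symmetric])
  have e: "(\<lambda>y. H y $ i $ j) differentiable (at x)" for i j
    by (rule differentiable_bounded_linear[OF bounded_linear_entry H])
  have "(\<lambda>y. det (\<chi> i j. if j = k then axis l 1 $ i else H y $ i $ j)) differentiable (at x)"
  proof (rule differentiable_det)
    fix i j show "(\<lambda>y. (\<chi> i j. if j = k then axis l 1 $ i else H y $ i $ j) $ i $ j) differentiable (at x)"
      by (cases "j = k") (simp_all add: e)
  qed
  then show "(\<lambda>y. det (\<chi> i j. if j = k then axis l 1 $ i else H y $ i $ j) / det (H y)) differentiable (at x)"
    by (rule differentiable_divide[OF _ differentiable_det[OF e] d[OF U(2)]])
qed

section \<open>Fields of Hermitian matrices and their curvature\<close>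

text \<open>
  The Gram matrix of a Hermitian metric in a holomorphic frame. Hermitian symmetry and positivity
  are expressed with the real inner product, which is the real part of the Hermitian product; since
  \<open>H x\<close> is complex linear, this is equivalent to the conditions for the Hermitian product itself.
\<close>

locale hermitian_matrix_field =
  fixes U :: "(complex^'n::finite) set" and H :: "complex^'n \<Rightarrow> complex^'r^'r::finite"
  assumes open_U: "open U" and Ck_H: "Ck_on 4 H U"
    and selfadjoint: "x \<in> U \<Longrightarrow> (H x *v u) \<bullet> v = u \<bullet> (H x *v v)"
    and pos: "x \<in> U \<Longrightarrow> u \<noteq> 0 \<Longrightarrow> (H x *v u) \<bullet> u > 0"
begin

lemma det_nonzero: "x \<in> U \<Longrightarrow> det (H x) \<noteq> 0"
proof
  assume x: "x \<in> U" and "det (H x) = 0"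
  then have "\<not> (\<exists>B. B ** H x = mat 1)"
    by (metis invertible_det_nz invertible_left_inverse)
  then obtain u where "u \<noteq> 0" "H x *v u = 0"
    using matrix_left_invertible_ker by blast
  with pos[OF x, of u] show False by simp
qed

lemma matrix_inv_right_apply: "x \<in> U \<Longrightarrow> H x *v (matrix_inv (H x) *v u) = u"
proof -
  assume "x \<in> U"
  then have "H x ** matrix_inv (H x) = mat 1"
    by (intro matrix_inv_right det_nonzero)
  then show ?thesis by (simp add: matrix_vector_mul_assoc)
qed

lemma differentiable_H: "x \<in> U \<Longrightarrow> H differentiable (at x)"
  using Ck_H by (simp add: numeral_eq_Suc Ck_on_Suc_iff)

lemma differentiable_dderiv_H: "x \<in> U \<Longrightarrow> dderiv u H differentiable (at x)"
  using Ck_H by (simp add: numeral_eq_Suc Ck_on_Suc_iff)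

lemma dderiv_selfadjoint:
  assumes G: "\<And>y. y \<in> U \<Longrightarrow> G differentiable (at y)"
    and s: "\<And>y p q. y \<in> U \<Longrightarrow> (G y *v p) \<bullet> q = p \<bullet> ((G y :: complex^'r^'r) *v q)"
    and x: "x \<in> U"
  shows "(dderiv u G x *v p) \<bullet> q = p \<bullet> (dderiv u G x *v q)"
proof -
  have bl: "bounded_linear (\<lambda>M::complex^'r^'r. (M *v p) \<bullet> q)" for p q
    by (rule bounded_linear_compose[OF bounded_linear_inner_left
          bounded_bilinear.bounded_linear_left[OF bounded_bilinear_matrix_vector_mult]])
  have "(dderiv u G x *v p) \<bullet> q = dderiv u (\<lambda>y. (G y *v p) \<bullet> q) x"
    using dderiv_bounded_linear[OF bl G[OF x]] by simp
  also have "\<dots> = dderiv u (\<lambda>y. (G y *v q) \<bullet> p) x"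
    by (rule dderiv_cong[OF open_U x]) (metis s inner_commute)
  also have "\<dots> = (dderiv u G x *v q) \<bullet> p"
    using dderiv_bounded_linear[OF bl G[OF x]] by simp
  finally show ?thesis by (simp add: inner_commute)
qed

lemma dderiv_H_selfadjoint: "x \<in> U \<Longrightarrow> (dderiv u H x *v p) \<bullet> q = p \<bullet> (dderiv u H x *v q)"
  by (rule dderiv_selfadjoint[OF differentiable_H selfadjoint])

lemma dderiv_dderiv_H_selfadjoint: "x \<in> U \<Longrightarrow> (dderiv w (dderiv u H) x *v p) \<bullet> q = p \<bullet> (dderiv w (dderiv u H) x *v q)"
  by (rule dderiv_selfadjoint[OF differentiable_dderiv_H dderiv_H_selfadjoint])

text \<open>
  The vector \<open>(\<partial>\<^sub>v H)(x) w\<close>, where \<open>\<partial>\<^sub>v\<close> is the \<open>(1,0)\<close>-derivative along \<open>v\<close>.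
\<close>

definition dH :: "complex^'n \<Rightarrow> complex^'n \<Rightarrow> complex^'r \<Rightarrow> complex^'r"
  where "dH v x w = (1/2) *s (dderiv v H x *v w - \<i> *s (dderiv (\<i> *s v) H x *v w))"

text \<open>
  The Chern connection form \<open>H\<inverse> \<partial>H\<close>, evaluated along \<open>v\<close> and applied to \<open>w\<close>.
\<close>

definition \<theta> :: "complex^'n \<Rightarrow> complex^'n \<Rightarrow> complex^'r \<Rightarrow> complex^'r"
  where "\<theta> v x w = matrix_inv (H x) *v dH v x w"

text \<open>
  The real part of \<open>\<langle>\<Theta>(v, cnj v)\<xi>, \<xi>\<rangle>\<close> (see \<open>inner_curvature\<close>), written through real derivatives
  of \<open>H\<close>: the squared length of \<open>\<theta>\<^sub>v \<xi>\<close> minus the Levi form of \<open>H\<close> along \<open>v\<close>, paired with \<open>\<xi>\<close>.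
\<close>

definition curv_form :: "complex^'n \<Rightarrow> complex^'n \<Rightarrow> complex^'r \<Rightarrow> real"
  where "curv_form v a \<xi> = (H a *v \<theta> v a \<xi>) \<bullet> \<theta> v a \<xi>
     - ((dderiv v (dderiv v H) a *v \<xi>) \<bullet> \<xi> + (dderiv (\<i> *s v) (dderiv (\<i> *s v) H) a *v \<xi>) \<bullet> \<xi>) / 4"

lemma H_\<theta>: "x \<in> U \<Longrightarrow> H x *v \<theta> v x w = dH v x w"
  by (simp add: \<theta>_def matrix_inv_right_apply)

lemma i_smult_i: "\<i> *s (\<i> *s (v :: complex^'m)) = - v"
  by (simp add: vec_eq_iff)

lemma dH_imaginary: "x \<in> U \<Longrightarrow> dH (\<i> *s v) x w = \<i> *s dH v x w"
proof -
  assume x: "x \<in> U"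
  have "dderiv (- v) H x = - dderiv v H x" by (rule linear_neg[OF linear_dderiv[OF differentiable_H[OF x]]])
  then have 1: "dderiv (- v) H x *v w = - (dderiv v H x *v w)"
    by (simp add: bounded_bilinear.minus_left[OF bounded_bilinear_matrix_vector_mult])
  show ?thesis
    unfolding dH_def i_smult_i 1 by (simp add: vec_eq_iff algebra_simps)
qed

lemma linear_\<theta>: "x \<in> U \<Longrightarrow> linear (\<lambda>v. \<theta> v x w)"
proof -
  assume x: "x \<in> U"
  note d = differentiable_H[OF x]
  have i1: "\<i> *s (u + v) = \<i> *s u + \<i> *s v" "\<i> *s (c *\<^sub>R u) = c *\<^sub>R (\<i> *s u)" for u v :: "complex^'m" and c
    by (simp_all add: vec_eq_iff algebra_simps)
  have l: "linear (\<lambda>v. dH v x w)"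
    unfolding dH_def
    by (rule linearI) (simp_all add: dderiv_add_direction[OF d] dderiv_scaleR_direction[OF d] i1
        bounded_bilinear.add_left[OF bounded_bilinear_matrix_vector_mult]
        bounded_bilinear.scaleR_left[OF bounded_bilinear_matrix_vector_mult] vec_eq_iff algebra_simps)
  have m: "linear (\<lambda>y. matrix_inv (H x) *v y)"
    using bounded_bilinear.bounded_linear_right[OF bounded_bilinear_matrix_vector_mult]
    by (simp add: linear_conv_bounded_linear)
  show ?thesis
    unfolding \<theta>_def using linear_compose[OF l m] by (simp add: o_def)
qed

lemma \<theta>_imaginary: "x \<in> U \<Longrightarrow> \<theta> (\<i> *s v) x w = \<i> *s \<theta> v x w"
  by (simp add: \<theta>_def dH_imaginary vector_scalar_commute)

text \<open>
  The affine holomorphic section through \<open>\<xi>\<close> whose covariant derivative vanishes at \<open>a\<close>. It is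
  optimal to the order of the expansion.
\<close>

definition test_section :: "complex^'n \<Rightarrow> complex^'r \<Rightarrow> complex^'n \<Rightarrow> complex^'r"
  where "test_section a \<xi> x = \<xi> + - \<theta> (x - a) a \<xi>"

lemma bounded_linear_neg_\<theta>: "a \<in> U \<Longrightarrow> bounded_linear (\<lambda>v. - \<theta> v a \<xi>)"
  unfolding linear_conv_bounded_linear[symmetric] by (rule linear_compose_neg[OF linear_\<theta>])

lemma test_section_at: "a \<in> U \<Longrightarrow> test_section a \<xi> a = \<xi>"
  using linear_0[OF linear_\<theta>, of a \<xi>] by (simp add: test_section_def)

lemma dderiv_test_section: "a \<in> U \<Longrightarrow> dderiv v (test_section a \<xi>) x = - \<theta> v a \<xi>"
  unfolding test_section_def[abs_def] by (subst dderiv_affine[OF bounded_linear_neg_\<theta>]) auto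

lemma differentiable_test_section: "a \<in> U \<Longrightarrow> test_section a \<xi> differentiable (at x)"
  unfolding test_section_def[abs_def] by (rule differentiable_affine[OF bounded_linear_neg_\<theta>])

lemma Ck_on_test_section: "a \<in> U \<Longrightarrow> Ck_on k (test_section a \<xi>) V"
  unfolding test_section_def[abs_def] by (rule Ck_on_affine[OF bounded_linear_neg_\<theta>])

definition test_dual :: "complex^'n \<Rightarrow> complex^'r \<Rightarrow> complex^'n \<Rightarrow> complex^'r"
  where "test_dual a \<xi> x = H x *v test_section a \<xi> x"

definition test_norm2 :: "complex^'n \<Rightarrow> complex^'r \<Rightarrow> complex^'n \<Rightarrow> real"
  where "test_norm2 a \<xi> x = test_dual a \<xi> x \<bullet> test_section a \<xi> x"

lemma Ck_on_test_dual: "a \<in> U \<Longrightarrow> Ck_on 4 (test_dual a \<xi>) U"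
  unfolding test_dual_def[abs_def]
  by (rule Ck_on_bilinear[OF open_U bounded_bilinear_matrix_vector_mult Ck_H Ck_on_test_section])

lemma Ck_on_test_norm2: "a \<in> U \<Longrightarrow> Ck_on 4 (test_norm2 a \<xi>) U"
  unfolding test_norm2_def[abs_def]
  by (rule Ck_on_bilinear[OF open_U bounded_bilinear_inner Ck_on_test_dual Ck_on_test_section])

lemma dderiv_test_dual: "a \<in> U \<Longrightarrow> x \<in> U \<Longrightarrow> dderiv v (test_dual a \<xi>) x = H x *v (- \<theta> v a \<xi>) + dderiv v H x *v test_section a \<xi> x"
  unfolding test_dual_def[abs_def]
  by (subst dderiv_bilinear[OF bounded_bilinear_matrix_vector_mult differentiable_H differentiable_test_section])
    (simp_all add: dderiv_test_section)

text \<open>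
  \<open>\<partial>\<^sub>v (H e) = (\<partial>\<^sub>v H) \<xi> - H \<theta>\<^sub>v \<xi> = 0\<close> at \<open>a\<close>, by the choice of the linear part of the test section.
\<close>

lemma dderiv_test_dual_antilinear:
  assumes a: "a \<in> U"
  shows "dderiv (\<i> *s v) (test_dual a \<xi>) a = - (\<i> *s dderiv v (test_dual a \<xi>) a)"
proof -
  have neg: "M *v (- y) = - (M *v y)" for M :: "complex^'r^'r" and y
    by (simp add: vec_eq_iff matrix_vector_mult_def sum_negf)
  have 1: "dderiv u (test_dual a \<xi>) a = - dH u a \<xi> + dderiv u H a *v \<xi>" for u
    by (simp add: dderiv_test_dual[OF a a] test_section_at[OF a] neg H_\<theta>[OF a])
  show ?thesis
    unfolding 1 dH_imaginary[OF a]
    by (simp add: dH_def vec_eq_iff field_simps)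
qed

lemma dderiv_dderiv_test_norm2:
  assumes a: "a \<in> U"
  shows "dderiv v (dderiv v (test_norm2 a \<xi>)) a = 2 * ((H a *v \<theta> v a \<xi>) \<bullet> \<theta> v a \<xi>)
     - 4 * ((dderiv v H a *v \<xi>) \<bullet> \<theta> v a \<xi>) + (dderiv v (dderiv v H) a *v \<xi>) \<bullet> \<xi>"
proof -
  define w where "w = - \<theta> v a \<xi>"
  note bbm = bounded_bilinear_matrix_vector_mult
  have dF: "test_dual a \<xi> differentiable (at x)" "dderiv v (test_dual a \<xi>) differentiable (at x)" if "x \<in> U" for x
    using Ck_on_test_dual[OF a] that by (simp_all add: numeral_eq_Suc Ck_on_Suc_iff)
  have pe: "dderiv v (test_section a \<xi>) x = w" for x by (simp add: dderiv_test_section[OF a] w_def)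
  have pf: "dderiv v (test_norm2 a \<xi>) x = test_dual a \<xi> x \<bullet> w + dderiv v (test_dual a \<xi>) x \<bullet> test_section a \<xi> x" if "x \<in> U" for x
    unfolding test_norm2_def[abs_def]
    by (subst dderiv_bilinear[OF bounded_bilinear_inner dF(1)[OF that] differentiable_test_section[OF a]]) (simp add: pe)
  have pF: "dderiv v (test_dual a \<xi>) x = H x *v w + dderiv v H x *v test_section a \<xi> x" if "x \<in> U" for x
    using dderiv_test_dual[OF a that] by (simp add: w_def)
  have dHw: "(\<lambda>x. H x *v w) differentiable (at a)"
    by (rule differentiable_bilinear[OF bbm differentiable_H[OF a] differentiable_const])
  have c0: "dderiv v (\<lambda>x. w) a = 0" by (rule dderiv_eq) (rule has_derivative_const)
  have "dderiv v (dderiv v (test_dual a \<xi>)) a = dderiv v (\<lambda>x. H x *v w + dderiv v H x *v test_section a \<xi> x) a"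
    by (rule dderiv_cong[OF open_U a pF])
  also have "\<dots> = dderiv v (\<lambda>x. H x *v w) a + dderiv v (\<lambda>x. dderiv v H x *v test_section a \<xi> x) a"
    by (rule dderiv_add[OF dHw differentiable_bilinear[OF bbm differentiable_dderiv_H[OF a] differentiable_test_section[OF a]]])
  also have "dderiv v (\<lambda>x. H x *v w) a = dderiv v H a *v w"
    by (subst dderiv_bilinear[OF bbm differentiable_H[OF a] differentiable_const]) (simp add: c0)
  also have "dderiv v (\<lambda>x. dderiv v H x *v test_section a \<xi> x) a = dderiv v H a *v w + dderiv v (dderiv v H) a *v \<xi>"
    by (subst dderiv_bilinear[OF bbm differentiable_dderiv_H[OF a] differentiable_test_section[OF a]])
      (simp add: pe test_section_at[OF a])
  finally have ppF: "dderiv v (dderiv v (test_dual a \<xi>)) a = 2 *\<^sub>R (dderiv v H a *v w) + dderiv v (dderiv v H) a *v \<xi>"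
    by (simp add: scaleR_2)
  have "dderiv v (dderiv v (test_norm2 a \<xi>)) a = dderiv v (\<lambda>x. test_dual a \<xi> x \<bullet> w + dderiv v (test_dual a \<xi>) x \<bullet> test_section a \<xi> x) a"
    by (rule dderiv_cong[OF open_U a pf])
  also have "\<dots> = dderiv v (\<lambda>x. test_dual a \<xi> x \<bullet> w) a + dderiv v (\<lambda>x. dderiv v (test_dual a \<xi>) x \<bullet> test_section a \<xi> x) a"
    by (intro dderiv_add differentiable_bilinear[OF bounded_bilinear_inner] dF[OF a] differentiable_const differentiable_test_section[OF a])
  also have "dderiv v (\<lambda>x. test_dual a \<xi> x \<bullet> w) a = dderiv v (test_dual a \<xi>) a \<bullet> w"
    by (rule dderiv_bounded_linear[OF bounded_linear_inner_left dF(1)[OF a]])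
  also have "dderiv v (\<lambda>x. dderiv v (test_dual a \<xi>) x \<bullet> test_section a \<xi> x) a = dderiv v (test_dual a \<xi>) a \<bullet> w + dderiv v (dderiv v (test_dual a \<xi>)) a \<bullet> \<xi>"
    by (subst dderiv_bilinear[OF bounded_bilinear_inner dF(2)[OF a] differentiable_test_section[OF a]])
      (simp add: pe test_section_at[OF a])
  finally have "dderiv v (dderiv v (test_norm2 a \<xi>)) a = 2 * (dderiv v (test_dual a \<xi>) a \<bullet> w) + dderiv v (dderiv v (test_dual a \<xi>)) a \<bullet> \<xi>"
    by simp
  also have "\<dots> = 2 * ((H a *v w) \<bullet> w) + 2 * ((dderiv v H a *v \<xi>) \<bullet> w) + 2 * ((dderiv v H a *v w) \<bullet> \<xi>) + (dderiv v (dderiv v H) a *v \<xi>) \<bullet> \<xi>"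
    by (simp add: pF[OF a] ppF test_section_at[OF a] inner_add_left)
  also have "(dderiv v H a *v w) \<bullet> \<xi> = (dderiv v H a *v \<xi>) \<bullet> w"
    using dderiv_H_selfadjoint[OF a] by (metis inner_commute)
  also have "(H a *v w) \<bullet> w = (H a *v \<theta> v a \<xi>) \<bullet> \<theta> v a \<xi>"
    by (simp add: w_def bounded_bilinear.minus_right[OF bbm])
  finally show ?thesis by (simp add: w_def)
qed

text \<open>
  The left-hand side is four times the Levi form of \<open>|e|\<^sup>2\<close> at \<open>a\<close> along \<open>v\<close>. Since the covariant
  derivative of the holomorphic section \<open>e\<close> vanishes at \<open>a\<close>, only the curvature is left.
\<close>

lemma dderiv_dderiv_test_norm2_sum:
  assumes a: "a \<in> U"
  shows "dderiv v (dderiv v (test_norm2 a \<xi>)) a + dderiv (\<i> *s v) (dderiv (\<i> *s v) (test_norm2 a \<xi>)) a = - 4 * curv_form v a \<xi>"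
proof -
  define Y where "Y = \<theta> v a \<xi>"
  have iY: "\<theta> (\<i> *s v) a \<xi> = \<i> *s Y" by (simp add: Y_def \<theta>_imaginary[OF a])
  have 1: "(H a *v (\<i> *s Y)) \<bullet> (\<i> *s Y) = (H a *v Y) \<bullet> Y"
    by (simp add: vector_scalar_commute inner_smult_left vector_smult_assoc)
  have "(dderiv v H a *v \<xi>) \<bullet> Y + (dderiv (\<i> *s v) H a *v \<xi>) \<bullet> (\<i> *s Y)
     = (dderiv v H a *v \<xi> - \<i> *s (dderiv (\<i> *s v) H a *v \<xi>)) \<bullet> Y"
    by (simp add: inner_diff_left inner_smult_left)
  also have "dderiv v H a *v \<xi> - \<i> *s (dderiv (\<i> *s v) H a *v \<xi>) = 2 *\<^sub>R (H a *v Y)"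
    unfolding Y_def H_\<theta>[OF a] dH_def by (simp add: vec_eq_iff scaleR_conv_of_real)
  finally have 2: "(dderiv v H a *v \<xi>) \<bullet> Y + (dderiv (\<i> *s v) H a *v \<xi>) \<bullet> (\<i> *s Y) = 2 * ((H a *v Y) \<bullet> Y)"
    by simp
  show ?thesis
    unfolding dderiv_dderiv_test_norm2[OF a] iY 1 curv_form_def Y_def[symmetric] using 2 by algebra
qed

text \<open>
  For a Gram matrix these are the matrices in \<open>chern_connection\<close> and \<open>chern_curvature\<close>.
\<close>

definition connection :: "'n \<Rightarrow> complex^'n \<Rightarrow> complex^'r^'r"
  where "connection j x = matrix_inv (H x) ** (\<chi> \<alpha> \<beta>. dz j (\<lambda>y. H y $ \<alpha> $ \<beta>) x)"

definition curvature :: "complex^'n \<Rightarrow> complex^'n \<Rightarrow> complex^'r^'r"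
  where "curvature v a = (\<chi> \<alpha> \<beta>. \<Sum>j\<in>UNIV. \<Sum>k\<in>UNIV. - dzbar k (\<lambda>y. connection j y $ \<alpha> $ \<beta>) a * v $ j * cnj (v $ k))"

lemma dderiv_H_entry: "x \<in> U \<Longrightarrow> dderiv u (\<lambda>y. H y $ \<alpha> $ \<beta>) x = dderiv u H x $ \<alpha> $ \<beta>"
  by (rule dderiv_bounded_linear[OF bounded_linear_entry differentiable_H])

lemma differentiable_connection_entry:
  assumes a: "a \<in> U"
  shows "(\<lambda>y. connection j y $ \<alpha> $ \<beta>) differentiable (at a)"
proof (rule differentiable_cong_open[OF open_U a])
  show "(\<Sum>\<gamma>\<in>UNIV. matrix_inv (H y) $ \<alpha> $ \<gamma> * ((dderiv (axis j 1) H y $ \<gamma> $ \<beta> - \<i> * dderiv (axis j \<i>) H y $ \<gamma> $ \<beta>) / 2))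
     = connection j y $ \<alpha> $ \<beta>" if "y \<in> U" for y
    by (simp add: connection_def matrix_matrix_mult_def dz_def dderiv_def[symmetric] dderiv_H_entry[OF that])
  have e: "(\<lambda>y. dderiv u H y $ \<gamma> $ \<beta>) differentiable (at a)" for u \<gamma>
    by (rule differentiable_bounded_linear[OF bounded_linear_entry differentiable_dderiv_H[OF a]])
  show "(\<lambda>y. \<Sum>\<gamma>\<in>UNIV. matrix_inv (H y) $ \<alpha> $ \<gamma> * ((dderiv (axis j 1) H y $ \<gamma> $ \<beta> - \<i> * dderiv (axis j \<i>) H y $ \<gamma> $ \<beta>) / 2)) differentiable (at a)"
    by (intro differentiable_sum differentiable_mult differentiable_divide differentiable_diff
        differentiable_const e ballI differentiable_matrix_inv_entry[OF open_U a det_nonzero differentiable_H[OF a]])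
      auto
qed

lemma sum_connection_entries:
  assumes x: "x \<in> U"
  shows "(\<Sum>\<beta>\<in>UNIV. \<Sum>j\<in>UNIV. (v $ j * \<xi> $ \<beta>) * connection j x $ \<alpha> $ \<beta>) = \<theta> v x \<xi> $ \<alpha>"
proof -
  have entry: "(\<Sum>j\<in>UNIV. v $ j * dz j (\<lambda>y. H y $ \<gamma> $ \<beta>) x) = (dderiv v H x $ \<gamma> $ \<beta> - \<i> * dderiv (\<i> *s v) H x $ \<gamma> $ \<beta>) / 2" for \<gamma> \<beta>
    by (subst sum_dz_direction[OF differentiable_bounded_linear[OF bounded_linear_entry differentiable_H[OF x]]])
      (simp add: dderiv_H_entry[OF x])
  have "(\<Sum>\<beta>\<in>UNIV. \<Sum>j\<in>UNIV. (v $ j * \<xi> $ \<beta>) * connection j x $ \<alpha> $ \<beta>)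
     = (\<Sum>\<beta>\<in>UNIV. \<Sum>j\<in>UNIV. \<Sum>\<gamma>\<in>UNIV. matrix_inv (H x) $ \<alpha> $ \<gamma> * (\<xi> $ \<beta> * (v $ j * dz j (\<lambda>y. H y $ \<gamma> $ \<beta>) x)))"
    by (simp add: connection_def matrix_matrix_mult_def sum_distrib_left mult_ac)
  also have "\<dots> = (\<Sum>\<beta>\<in>UNIV. \<Sum>\<gamma>\<in>UNIV. \<Sum>j\<in>UNIV. matrix_inv (H x) $ \<alpha> $ \<gamma> * (\<xi> $ \<beta> * (v $ j * dz j (\<lambda>y. H y $ \<gamma> $ \<beta>) x)))"
    by (rule sum.cong[OF refl], rule sum.swap)
  also have "\<dots> = (\<Sum>\<gamma>\<in>UNIV. \<Sum>\<beta>\<in>UNIV. \<Sum>j\<in>UNIV. matrix_inv (H x) $ \<alpha> $ \<gamma> * (\<xi> $ \<beta> * (v $ j * dz j (\<lambda>y. H y $ \<gamma> $ \<beta>) x)))"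
    by (rule sum.swap)
  also have "\<dots> = (\<Sum>\<gamma>\<in>UNIV. matrix_inv (H x) $ \<alpha> $ \<gamma> * (\<Sum>\<beta>\<in>UNIV. \<xi> $ \<beta> * ((dderiv v H x $ \<gamma> $ \<beta> - \<i> * dderiv (\<i> *s v) H x $ \<gamma> $ \<beta>) / 2)))"
    by (simp only: entry[symmetric] sum_distrib_left)
  also have "\<dots> = (\<Sum>\<gamma>\<in>UNIV. matrix_inv (H x) $ \<alpha> $ \<gamma> * dH v x \<xi> $ \<gamma>)"
  proof (rule sum.cong[OF refl])
    fix \<gamma>
    have "dH v x \<xi> $ \<gamma> = 1/2 * ((\<Sum>\<beta>\<in>UNIV. dderiv v H x $ \<gamma> $ \<beta> * \<xi> $ \<beta>) - \<i> * (\<Sum>\<beta>\<in>UNIV. dderiv (\<i> *s v) H x $ \<gamma> $ \<beta> * \<xi> $ \<beta>))"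
      by (simp add: dH_def matrix_vector_mult_def)
    also have "\<dots> = (\<Sum>\<beta>\<in>UNIV. 1/2 * (dderiv v H x $ \<gamma> $ \<beta> * \<xi> $ \<beta> - \<i> * (dderiv (\<i> *s v) H x $ \<gamma> $ \<beta> * \<xi> $ \<beta>)))"
      by (simp only: sum_distrib_left[symmetric] sum_subtractf)
    also have "\<dots> = (\<Sum>\<beta>\<in>UNIV. \<xi> $ \<beta> * ((dderiv v H x $ \<gamma> $ \<beta> - \<i> * dderiv (\<i> *s v) H x $ \<gamma> $ \<beta>) / 2))"
      by (rule sum.cong[OF refl]) (simp add: field_simps)
    finally show "matrix_inv (H x) $ \<alpha> $ \<gamma> * (\<Sum>\<beta>\<in>UNIV. \<xi> $ \<beta> * ((dderiv v H x $ \<gamma> $ \<beta> - \<i> * dderiv (\<i> *s v) H x $ \<gamma> $ \<beta>) / 2))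
        = matrix_inv (H x) $ \<alpha> $ \<gamma> * dH v x \<xi> $ \<gamma>" by simp
  qed
  finally show ?thesis by (simp add: \<theta>_def matrix_vector_mult_def)
qed

text \<open>
  Contracting the curvature coefficients with \<open>v\<close> turns the coefficientwise definition into a
  single \<open>(0,1)\<close>-derivative of the vector function \<open>x \<mapsto> \<theta>\<^sub>v \<xi>\<close>.
\<close>

lemma curvature_apply:
  fixes v :: "complex^'n" and \<xi> :: "complex^'r"
  assumes a: "a \<in> U"
  defines "Y \<equiv> \<lambda>x. \<theta> v x \<xi>"
  shows "Y differentiable (at a)"
    and "curvature v a *v \<xi> = - ((1/2) *s (dderiv v Y a + \<i> *s dderiv (\<i> *s v) Y a))"
proof -
  define S where "S \<alpha> x = (\<Sum>\<beta>\<in>UNIV. \<Sum>j\<in>UNIV. (v $ j * \<xi> $ \<beta>) * connection j x $ \<alpha> $ \<beta>)" for \<alpha> x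
  have bl: "bounded_linear (\<lambda>y. c * y)" for c :: complex by (rule bounded_linear_mult_right)
  have dS: "S \<alpha> differentiable (at a)" for \<alpha>
    unfolding S_def[abs_def]
    by (intro differentiable_sum finite ballI differentiable_mult differentiable_const differentiable_connection_entry a)
  have pdS: "dderiv u (S \<alpha>) a = (\<Sum>\<beta>\<in>UNIV. \<Sum>j\<in>UNIV. (v $ j * \<xi> $ \<beta>) * dderiv u (\<lambda>y. connection j y $ \<alpha> $ \<beta>) a)" for u \<alpha>
    unfolding S_def[abs_def]
    by (rule dderiv_eq) (intro has_derivative_sum has_derivative_mult_right has_derivative_dderiv differentiable_connection_entry a)
  have ax: "bounded_linear (axis \<alpha> :: complex \<Rightarrow> complex^'r)" for \<alpha>
    unfolding linear_conv_bounded_linear[symmetric] by (rule linearI) (simp_all add: axis_def vec_eq_iff)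
  have YS: "(\<Sum>\<alpha>\<in>UNIV. axis \<alpha> (S \<alpha> x)) = Y x" if "x \<in> U" for x
    unfolding S_def Y_def sum_connection_entries[OF that]
    by (simp add: vec_eq_iff axis_def)
  show dY: "Y differentiable (at a)"
    by (rule differentiable_cong_open[OF open_U a YS], assumption)
      (intro differentiable_sum finite ballI differentiable_bounded_linear[OF ax] dS)
  have pdY: "dderiv u Y a $ \<alpha> = dderiv u (S \<alpha>) a" for u \<alpha>
  proof -
    have "dderiv u Y a $ \<alpha> = dderiv u (\<lambda>x. Y x $ \<alpha>) a"
      by (rule dderiv_bounded_linear[OF bounded_linear_vec_nth dY, symmetric])
    also have "\<dots> = dderiv u (S \<alpha>) a"
      by (rule dderiv_cong[OF open_U a]) (simp add: S_def Y_def sum_connection_entries)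
    finally show ?thesis .
  qed
  show "curvature v a *v \<xi> = - ((1/2) *s (dderiv v Y a + \<i> *s dderiv (\<i> *s v) Y a))"
  proof (rule vec_eq_iff[THEN iffD2], rule allI)
    fix \<alpha>
    let ?c = "\<lambda>j \<beta> y. connection j y $ \<alpha> $ \<beta>"
    have "(curvature v a *v \<xi>) $ \<alpha> = (\<Sum>\<beta>\<in>UNIV. (\<Sum>j\<in>UNIV. \<Sum>k\<in>UNIV. - dzbar k (?c j \<beta>) a * v $ j * cnj (v $ k)) * \<xi> $ \<beta>)"
      by (simp add: curvature_def matrix_vector_mult_def)
    also have "\<dots> = - (\<Sum>\<beta>\<in>UNIV. \<Sum>j\<in>UNIV. (v $ j * \<xi> $ \<beta>) * (\<Sum>k\<in>UNIV. cnj (v $ k) * dzbar k (?c j \<beta>) a))"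
      by (simp add: sum_distrib_left sum_distrib_right sum_negf mult_ac)
    also have "\<dots> = - (\<Sum>\<beta>\<in>UNIV. \<Sum>j\<in>UNIV. (v $ j * \<xi> $ \<beta>) * ((dderiv v (?c j \<beta>) a + \<i> * dderiv (\<i> *s v) (?c j \<beta>) a) / 2))"
      by (simp only: sum_dzbar_direction[OF differentiable_connection_entry[OF a]])
    also have "\<dots> = - (\<Sum>\<beta>\<in>UNIV. \<Sum>j\<in>UNIV. 1/2 * ((v $ j * \<xi> $ \<beta>) * dderiv v (?c j \<beta>) a + \<i> * ((v $ j * \<xi> $ \<beta>) * dderiv (\<i> *s v) (?c j \<beta>) a)))"
      by (simp add: field_simps)
    also have "\<dots> = - (1/2 * (dderiv v (S \<alpha>) a + \<i> * dderiv (\<i> *s v) (S \<alpha>) a))"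
      unfolding pdS by (simp only: sum_distrib_left[symmetric] sum.distrib)
    finally show "(curvature v a *v \<xi>) $ \<alpha> = (- ((1/2) *s (dderiv v Y a + \<i> *s dderiv (\<i> *s v) Y a))) $ \<alpha>"
      by (simp add: pdY add_divide_distrib)
  qed
qed

text \<open>
  Differentiating \<open>H Y = (\<partial>\<^sub>v H) \<xi>\<close> for \<open>Y = \<theta>\<^sub>v \<xi>\<close> avoids the derivative of the inverse matrix:
  \<open>H (dbar\<^sub>v Y) = (dbar\<^sub>v \<partial>\<^sub>v H) \<xi> - (dbar\<^sub>v H) Y\<close>. Paired with \<open>\<xi>\<close>, the last term is \<open>\<langle>Y, (\<partial>\<^sub>v H) \<xi>\<rangle>\<close>, which
  is \<open>\<langle>Y, H Y\<rangle>\<close>.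
\<close>

lemma inner_curvature:
  assumes a: "a \<in> U"
  shows "(H a *v (curvature v a *v \<xi>)) \<bullet> \<xi> = curv_form v a \<xi>"
proof -
  define Y where "Y = (\<lambda>x. \<theta> v x \<xi>)"
  define iv where "iv = \<i> *s v"
  note bbm = bounded_bilinear_matrix_vector_mult
  note dY = curvature_apply(1)[OF a, of v \<xi>, folded Y_def]
  define P where "P u w = dderiv u (dderiv w H) a *v \<xi>" for u w
  have bl: "bounded_linear (\<lambda>M::complex^'r^'r. M *v \<xi>)"
    by (rule bounded_bilinear.bounded_linear_left[OF bbm])
  have pdN: "dderiv u (\<lambda>x. dH v x \<xi>) a = (1/2) *s (P u v - \<i> *s P u iv)" for u
    unfolding dH_def P_def iv_def[symmetric]
  proof (rule dderiv_eq)
    have 1: "((\<lambda>x. dderiv w H x *v \<xi>) has_derivative (\<lambda>u. dderiv u (dderiv w H) a *v \<xi>)) (at a)" for w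
      by (rule bounded_linear.has_derivative[OF bl has_derivative_dderiv[OF differentiable_dderiv_H[OF a]]])
    show "((\<lambda>x. (1/2) *s (dderiv v H x *v \<xi> - \<i> *s (dderiv iv H x *v \<xi>))) has_derivative
       (\<lambda>u. (1/2) *s (dderiv u (dderiv v H) a *v \<xi> - \<i> *s (dderiv u (dderiv iv H) a *v \<xi>)))) (at a)"
      by (intro bounded_linear.has_derivative[OF bounded_linear_vec_scale] has_derivative_diff 1)
  qed
  have pdN': "dderiv u (\<lambda>x. dH v x \<xi>) a = H a *v dderiv u Y a + dderiv u H a *v Y a" for u
  proof -
    have "dderiv u (\<lambda>x. dH v x \<xi>) a = dderiv u (\<lambda>x. H x *v Y x) a"
      by (rule dderiv_cong[OF open_U a]) (simp add: Y_def H_\<theta>)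
    also have "\<dots> = H a *v dderiv u Y a + dderiv u H a *v Y a"
      by (rule dderiv_bilinear[OF bbm differentiable_H[OF a] dY])
    finally show ?thesis .
  qed
  have HY: "H a *v dderiv u Y a = (1/2) *s (P u v - \<i> *s P u iv) - dderiv u H a *v Y a" for u
    unfolding eq_diff_eq pdN'[symmetric] pdN ..
  have "H a *v (curvature v a *v \<xi>) = - ((1/2) *s (H a *v dderiv v Y a + \<i> *s (H a *v dderiv iv Y a)))"
    unfolding curvature_apply(2)[OF a, of v \<xi>, folded Y_def iv_def]
    by (simp add: bounded_bilinear.minus_right[OF bbm] bounded_bilinear.add_right[OF bbm]
        bounded_bilinear.diff_right[OF bbm] vector_scalar_commute)
  also have "\<dots> = (1/2) *s (dderiv v H a *v Y a + \<i> *s (dderiv iv H a *v Y a))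
      - (1/4) *\<^sub>R (P v v + P iv iv) - (1/4) *\<^sub>R (\<i> *s (P iv v - P v iv))"
    unfolding HY by (simp add: vec_eq_iff scaleR_conv_of_real[where 'a=complex] field_simps)
  finally have 1: "(H a *v (curvature v a *v \<xi>)) \<bullet> \<xi> =
      ((1/2) *s (dderiv v H a *v Y a + \<i> *s (dderiv iv H a *v Y a))) \<bullet> \<xi>
      - (1/4) * (P v v \<bullet> \<xi> + P iv iv \<bullet> \<xi>) - (1/4) * ((\<i> *s (P iv v - P v iv)) \<bullet> \<xi>)"
    by (simp add: inner_diff_left inner_add_left)
  have sa: "P u w \<bullet> (c *s \<xi>) = \<xi> \<bullet> (c *s P u w)" for u w and c :: complex
    unfolding P_def by (subst dderiv_dderiv_H_selfadjoint[OF a]) (simp add: vector_scalar_commute)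
  \<comment> \<open>The commutator of the derivatives along \<open>v\<close> and \<open>\<i> v\<close> enters with the factor \<open>\<i>\<close>. Second
    derivatives of \<open>H\<close> are Hermitian, so it contributes an imaginary number.\<close>
  have iP: "(\<i> *s P u w) \<bullet> \<xi> = 0" for u w
    using sa[of u w "- \<i>"] inner_smult_left[of \<i> "P u w" \<xi>]
    by (simp add: inner_commute[of \<xi>] vector_smult_lneg inner_minus_left)
  have 2: "(\<i> *s (P iv v - P v iv)) \<bullet> \<xi> = 0"
    using iP[of iv v] iP[of v iv] by (simp add: vector_ssub_ldistrib inner_diff_left)
  have "((1/2) *s (dderiv v H a *v Y a + \<i> *s (dderiv iv H a *v Y a))) \<bullet> \<xi>
     = Y a \<bullet> ((1/2) *s (dderiv v H a *v \<xi> - \<i> *s (dderiv iv H a *v \<xi>)))"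
    unfolding inner_smult_left inner_add_left vector_smult_assoc
    by (simp add: dderiv_H_selfadjoint[OF a] vector_scalar_commute vector_ssub_ldistrib vector_smult_assoc
        vector_smult_lneg inner_diff_right inner_minus_right)
  also have "\<dots> = Y a \<bullet> (H a *v Y a)"
    using H_\<theta>[OF a, of v \<xi>] by (simp add: Y_def dH_def iv_def)
  finally have 3: "((1/2) *s (dderiv v H a *v Y a + \<i> *s (dderiv iv H a *v Y a))) \<bullet> \<xi> = Y a \<bullet> (H a *v Y a)" .
  show ?thesis
    unfolding 1 2 3 curv_form_def by (simp add: P_def iv_def Y_def inner_commute)
qed

end

section \<open>Cylinders in unitary coordinates\<close>

lemma linear_matrix_vector_mult_complex: "linear (\<lambda>z. (A :: complex^'m^'n) *v z)"
  using bounded_bilinear.bounded_linear_right[OF bounded_bilinear_matrix_vector_mult]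
  by (simp add: linear_conv_bounded_linear)

lemma inner_matrix_vector_mult:
  "(A *v x) \<bullet> y = x \<bullet> ((\<chi> i j. cnj (A $ j $ i)) *v (y :: complex^'n))"
proof -
  have "(A *v x) \<bullet> y = (\<Sum>i\<in>UNIV. \<Sum>j\<in>UNIV. (A $ i $ j * x $ j) \<bullet> y $ i)"
    by (simp add: inner_vec_def matrix_vector_mult_def inner_sum_left)
  also have "\<dots> = (\<Sum>j\<in>UNIV. \<Sum>i\<in>UNIV. (A $ i $ j * x $ j) \<bullet> y $ i)" by (rule sum.swap)
  also have "\<dots> = (\<Sum>j\<in>UNIV. \<Sum>i\<in>UNIV. x $ j \<bullet> (cnj (A $ i $ j) * y $ i))"
    by (intro sum.cong refl) (simp add: inner_complex_def algebra_simps)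
  finally show ?thesis by (simp add: inner_vec_def matrix_vector_mult_def inner_sum_right)
qed

lemma orthogonal_transformation_unitary:
  assumes "A \<in> unitary_group"
  shows "orthogonal_transformation ((*v) A)"
proof -
  have "(A *v x) \<bullet> (A *v y) = x \<bullet> y" for x y
    using assms by (simp add: inner_matrix_vector_mult matrix_vector_mul_assoc unitary_group_def)
  then show ?thesis
    using linear_matrix_vector_mult_complex by (auto simp: orthogonal_transformation_def)
qed

lemma std_cylinder_disc:
  assumes "cmod c \<le> 1" "z \<in> std_cylinder o1 r s"
  shows "c *s z \<in> std_cylinder o1 r s"
proof -
  have 1: "norm (c * w) \<le> norm w" for w using assms(1) mult_left_le_one_le[of "norm w" "cmod c"] by (simp add: norm_mult)
  have "sqrt (\<Sum>j\<in>UNIV - {o1}. (norm ((c *s z) $ j))\<^sup>2) \<le> sqrt (\<Sum>j\<in>UNIV - {o1}. (norm (z $ j))\<^sup>2)"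
    by (intro real_sqrt_le_mono sum_mono power_mono) (auto simp: 1)
  then show ?thesis using assms(2) le_less_trans[OF 1[of "z $ o1"]]
    unfolding std_cylinder_def mem_Collect_eq by (auto simp del: real_sqrt_le_iff intro: le_less_trans)
qed

locale unitary_cylinder =
  fixes o1 :: "'n::finite" and r s :: real and A :: "complex^'n^'n"
  assumes rs: "r > 0" "s > 0" and A: "A \<in> unitary_group"
begin

lemma orth: "orthogonal_transformation ((*v) A)"
  by (rule orthogonal_transformation_unitary[OF A])

lemma open_cylinder: "open (cylinder o1 r s A)"
  unfolding cylinder_eq_image
  by (rule open_surjective_linear_image[OF open_std_cylinder linear_matrix_vector_mult_complex
      orthogonal_transformation_surj[OF orth]])

lemma open_translated: "open ((+) a ` cylinder o1 r s A)"
  by (rule open_translation[OF open_cylinder])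

lemma norm_cylinder: "z \<in> cylinder o1 r s A \<Longrightarrow> (norm z)\<^sup>2 \<le> r\<^sup>2 + s\<^sup>2"
  using norm_std_cylinder[OF rs] orthogonal_transformation_norm[OF orth]
  unfolding cylinder_eq_image by force

lemma cylinder_disc: "cmod c \<le> 1 \<Longrightarrow> z \<in> cylinder o1 r s A \<Longrightarrow> c *s z \<in> cylinder o1 r s A"
  unfolding cylinder_eq_image using std_cylinder_disc[of c _ o1 r s]
  by (auto simp: vector_scalar_commute[symmetric])

lemma zero_in_cylinder: "0 \<in> cylinder o1 r s A"
proof -
  have "0 \<in> std_cylinder o1 r s" using rs by (simp add: std_cylinder_def)
  then show ?thesis unfolding cylinder_eq_image
    using linear_0[OF linear_matrix_vector_mult_complex[of A]] by (metis imageI)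
qed

lemma measurable_cylinder: "cylinder o1 r s A \<in> sets borel" "(+) a ` cylinder o1 r s A \<in> sets borel"
  using open_cylinder open_translated by (auto intro: borel_open)

lemma integral_cylinder:
  fixes g :: "complex^'n \<Rightarrow> real"
  assumes "continuous_on ((+) a ` cylinder o1 r s A) g"
  shows "(LINT x:(+) a ` cylinder o1 r s A|lborel. g x) = (LINT w:std_cylinder o1 r s|lborel. g (a + A *v w))"
    and "(LINT x:(+) a ` cylinder o1 r s A|lborel. g x) = (LINT w:std_cylinder o1 r s|lborel. g (a - A *v w))"
proof -
  have m: "set_borel_measurable lborel ((+) a ` cylinder o1 r s A) g"
    by (rule set_borel_measurable_continuous_open[OF open_translated assms])
  then show "(LINT x:(+) a ` cylinder o1 r s A|lborel. g x) = (LINT w:std_cylinder o1 r s|lborel. g (a + A *v w))"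
    unfolding cylinder_eq_image by (rule set_integral_orthogonal_image(1)[OF orth])
  have o: "orthogonal_transformation (\<lambda>w. - (A *v w))"
    using orth by (simp add: orthogonal_transformation_neg)
  have im: "(\<lambda>w. - (A *v w)) ` std_cylinder o1 r s = cylinder o1 r s A"
  proof -
    have neg: "-1 *s w = - w" for w :: "complex^'n" by (simp add: vec_eq_iff)
    have mem: "- w \<in> std_cylinder o1 r s" if "w \<in> std_cylinder o1 r s" for w
      using std_cylinder_disc[OF _ that, of "-1"] by (simp add: neg)
    have "uminus ` std_cylinder o1 r s = std_cylinder o1 r s"
      using mem by (force simp: image_iff intro: bexI[of _ "- _"])
    then have "(*v) A ` std_cylinder o1 r s = (\<lambda>w. A *v (- w)) ` std_cylinder o1 r s"
      by (metis image_image)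
    then show ?thesis
      unfolding cylinder_eq_image by (simp add: linear_neg[OF linear_matrix_vector_mult_complex])
  qed
  show "(LINT x:(+) a ` cylinder o1 r s A|lborel. g x) = (LINT w:std_cylinder o1 r s|lborel. g (a - A *v w))"
    using set_integral_orthogonal_image(1)[OF o, of a "std_cylinder o1 r s" g] m unfolding im by simp
qed

lemma emeasure_finite: "emeasure lborel ((+) a ` cylinder o1 r s A) < \<infinity>"
proof (rule emeasure_bounded_finite)
  have "bounded (cylinder o1 r s A)"
    unfolding cylinder_eq_image
    using linear_matrix_vector_mult_complex bounded_std_cylinder[OF rs]
    by (intro bounded_linear_image) (auto simp: linear_conv_bounded_linear)
  then show "bounded ((+) a ` cylinder o1 r s A)" by (rule bounded_translation)
qed

lemma measure_translated_cylinder: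
  "measure lborel ((+) a ` cylinder o1 r s A) = measure lborel (std_cylinder o1 r s)"
  using integral_cylinder(1)[of a "\<lambda>_. 1"]
    set_integral_const[OF measurable_cylinder(2)[of a], of 1] set_integral_const[OF std_cylinder_borel[of o1 r s], of 1]
  by simp

lemma measure_cylinder: "measure lborel (cylinder o1 r s A) = measure lborel (std_cylinder o1 r s)"
  using measure_translated_cylinder[of 0] by simp

lemma set_integrable_const:
  fixes c :: real
  shows "set_integrable lborel ((+) a ` cylinder o1 r s A) (\<lambda>_. c)"
  unfolding set_integrable_def
  using emeasure_finite[of a] measurable_cylinder(2) by simp

lemma set_integrable_continuous_compact:
  fixes g :: "complex^'n \<Rightarrow> real"
  assumes "compact X" "(+) a ` cylinder o1 r s A \<subseteq> X" "continuous_on X g"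
  shows "set_integrable lborel ((+) a ` cylinder o1 r s A) g"
proof -
  have "set_integrable lborel X g"
    unfolding set_integrable_def by (rule borel_integrable_compact[OF assms(1,3)])
  then show ?thesis by (rule set_integrable_subset) (use assms(2) measurable_cylinder(2) in auto)
qed

end

section \<open>The test section and the lower bound\<close>

lemma quadratic_lower_bound:
  fixes c k t :: real
  assumes "c > 0"
  shows "c * t\<^sup>2 - 2 * k * t \<ge> - (k\<^sup>2 / c)"
proof -
  have "c * t\<^sup>2 - 2 * k * t + k\<^sup>2 / c = (c * t - k)\<^sup>2 / c"
    using assms by (simp add: field_simps power2_eq_square)
  also have "\<dots> \<ge> 0" using assms by simp
  finally show ?thesis by simp
qed

context hermitian_matrix_field begin

text \<open>
  The constant is the smallest value of the quadratic forms on the product of the ball with the unit sphere.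
\<close>

lemma coercive:
  assumes R: "cball a R \<subseteq> U"
  shows "\<exists>c>0. \<forall>x\<in>cball a R. \<forall>u. c * (norm u)\<^sup>2 \<le> (H x *v u) \<bullet> u"
proof (cases "cball a R = {}")
  case False
  let ?X = "cball a R \<times> sphere (0::complex^'r) 1"
  let ?q = "\<lambda>p. (H (fst p) *v snd p) \<bullet> snd p"
  have cH: "continuous_on (cball a R) H"
    using Ck_on_mono[OF _ Ck_H, of 0] R by (auto intro: continuous_on_subset)
  have "continuous_on ?X ?q"
    by (intro continuous_on_inner bounded_bilinear.continuous_on[OF bounded_bilinear_matrix_vector_mult]
        continuous_on_compose2[OF cH] continuous_intros) auto
  moreover have "compact ?X" by (intro compact_Times compact_cball compact_sphere)
  moreover have "?X \<noteq> {}" using False by simp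
  ultimately obtain p where p: "p \<in> ?X" "\<And>q. q \<in> ?X \<Longrightarrow> ?q p \<le> ?q q"
    using continuous_attains_inf[of ?X ?q] by blast
  have "?q p > 0" using p(1) R by (intro pos) auto
  moreover have "?q p * (norm u)\<^sup>2 \<le> (H x *v u) \<bullet> u" if x: "x \<in> cball a R" for x u
  proof (cases "u = 0")
    case False
    define w where "w = (1 / norm u) *\<^sub>R u"
    have "(x, w) \<in> ?X" using x False by (simp add: w_def)
    from p(2)[OF this] have "?q p \<le> (H x *v w) \<bullet> w" by simp
    also have "\<dots> = ((H x *v u) \<bullet> u) / (norm u)\<^sup>2"
      by (simp add: w_def linear_scale[OF linear_matrix_vector_mult_complex] power2_eq_square)
    finally show ?thesis using False by (simp add: field_simps)
  qed simp
  ultimately show ?thesis by blast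
qed (auto intro: exI[of _ 1])

lemma completing_square:
  assumes x: "x \<in> U"
  shows "(H x *v (e + \<tau>)) \<bullet> (e + \<tau>) = (H x *v e) \<bullet> e + 2 * ((H x *v e) \<bullet> \<tau>) + (H x *v \<tau>) \<bullet> \<tau>"
  using selfadjoint[OF x, of \<tau> e]
  by (simp add: linear_add[OF linear_matrix_vector_mult_complex] inner_add_left inner_add_right inner_commute)

lemma test_norm2_at: "a \<in> U \<Longrightarrow> test_norm2 a \<xi> a = (H a *v \<xi>) \<bullet> \<xi>"
  by (simp add: test_norm2_def test_dual_def test_section_at)

text \<open>
  Averaging the integrals in the coordinates \<open>a + A w\<close> and \<open>a - A w\<close> replaces the density by its even
  part, which is known up to fourth order.
\<close>

lemma integral_test_norm2_expansion:
  fixes o1 :: 'n and \<xi> :: "complex^'r"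
  assumes R: "cball a R \<subseteq> U" "R > 0" and n: "CARD('n) \<ge> 2"
  shows "\<exists>C\<ge>0. \<forall>r s A. 0 < r \<and> 0 < s \<and> r\<^sup>2 + s\<^sup>2 \<le> R\<^sup>2 \<and> A \<in> unitary_group \<longrightarrow>
     \<bar>(LINT x:(+) a ` cylinder o1 r s A|lborel. test_norm2 a \<xi> x)
       - measure lborel (cylinder o1 r s A) * ((H a *v \<xi>) \<bullet> \<xi>
          - r\<^sup>2 / 2 * curv_form (A *v axis o1 1) a \<xi> - s\<^sup>2 / CARD('n) * (\<Sum>j\<in>UNIV-{o1}. curv_form (A *v axis j 1) a \<xi>))\<bar>
     \<le> C * (r\<^sup>2 + s\<^sup>2)\<^sup>2 * measure lborel (cylinder o1 r s A)"
proof -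
  have a: "a \<in> U" using R by auto
  let ?f = "test_norm2 a \<xi>"
  obtain C where C: "C \<ge> 0" "\<And>z. norm z \<le> R \<Longrightarrow> \<bar>?f (a + z) + ?f (a - z) - 2 * ?f a - dderiv z (dderiv z ?f) a\<bar> \<le> C * (norm z) ^ 4"
    using Taylor_even_bound[OF open_U Ck_on_test_norm2[OF a] R(1) a] by blast
  have cf: "continuous_on U ?f" using Ck_on_mono[OF _ Ck_on_test_norm2[OF a], of 0] by simp
  have main: "\<bar>(LINT x:(+) a ` cylinder o1 r s A|lborel. ?f x)
       - measure lborel (cylinder o1 r s A) * ((H a *v \<xi>) \<bullet> \<xi>
          - r\<^sup>2 / 2 * curv_form (A *v axis o1 1) a \<xi> - s\<^sup>2 / CARD('n) * (\<Sum>j\<in>UNIV-{o1}. curv_form (A *v axis j 1) a \<xi>))\<bar>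
     \<le> C * (r\<^sup>2 + s\<^sup>2)\<^sup>2 * measure lborel (cylinder o1 r s A)"
    if rs0: "0 < r" "0 < s" "r\<^sup>2 + s\<^sup>2 \<le> R\<^sup>2" "A \<in> unitary_group" for r s A
  proof -
    interpret unitary_cylinder o1 r s A using rs0 by unfold_locales auto
    let ?S = "std_cylinder o1 r s" and ?P = "(+) a ` cylinder o1 r s A"
    define V where "V = measure lborel ?S"
    have VD: "measure lborel (cylinder o1 r s A) = V" by (simp add: V_def measure_cylinder)
    have nz: "norm (A *v w) \<le> R" "norm (A *v w) ^ 4 \<le> (r\<^sup>2 + s\<^sup>2)\<^sup>2" if "w \<in> ?S" for w
    proof -
      have 1: "(norm (A *v w))\<^sup>2 \<le> r\<^sup>2 + s\<^sup>2" by (rule norm_cylinder) (use that in \<open>simp add: cylinder_eq_image\<close>)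
      have "(norm (A *v w))\<^sup>2 \<le> R\<^sup>2" using 1 rs0(3) by linarith
      then show "norm (A *v w) \<le> R" by (rule power2_le_imp_le) (use R(2) in simp)
      have "norm (A *v w) ^ 4 = ((norm (A *v w))\<^sup>2)\<^sup>2" by simp
      also have "\<dots> \<le> (r\<^sup>2 + s\<^sup>2)\<^sup>2" using 1 by (intro power_mono) auto
      finally show "norm (A *v w) ^ 4 \<le> (r\<^sup>2 + s\<^sup>2)\<^sup>2" .
    qed
    have Psub: "?P \<subseteq> cball a R" using nz(1) by (auto simp: cylinder_eq_image dist_norm)
    have cfP: "continuous_on ?P ?f" using cf Psub R(1) by (meson continuous_on_subset subset_trans)
    have ifP: "set_integrable lborel ?P ?f"
      by (rule set_integrable_continuous_compact[OF compact_cball Psub continuous_on_subset[OF cf R(1)]])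
    define q where "q w = dderiv (A *v w) (dderiv (A *v w) ?f) a" for w
    have bil: "bilinear (\<lambda>w w'. dderiv (A *v w) (dderiv (A *v w') ?f) a)"
    proof -
      have b: "bilinear (\<lambda>u v. dderiv u (dderiv v ?f) a)"
        by (rule bilinear_dderiv_dderiv[OF open_U Ck_on_mono[OF _ Ck_on_test_norm2[OF a]] a]) simp
      show ?thesis
        using b linear_compose[OF linear_matrix_vector_mult_complex[of A]]
        unfolding bilinear_def by (fastforce simp: o_def)
    qed
    have cq: "continuous_on UNIV q"
    proof -
      have "bounded_bilinear (\<lambda>w w'. dderiv (A *v w) (dderiv (A *v w') ?f) a)"
        using bil by (simp add: bilinear_conv_bounded_bilinear)
      from bounded_bilinear.continuous_on[OF this continuous_on_id continuous_on_id] show ?thesis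
        by (simp add: q_def[abs_def] id_def)
    qed
    have iq: "set_integrable lborel ?S q"
      by (rule set_integrable_continuous_bounded[OF bounded_std_cylinder[OF rs(1,2)] std_cylinder_borel cq])
    have ax: "A *v axis j \<i> = \<i> *s (A *v axis j 1)" for j
    proof -
      have "axis j \<i> = \<i> *s axis j (1::complex)" by (simp add: vec_eq_iff axis_def)
      then show ?thesis by (simp add: vector_scalar_commute)
    qed
    have Iq: "(LINT w:?S|lborel. q w) = V * (- 2 * (r\<^sup>2 / 2 * curv_form (A *v axis o1 1) a \<xi>
        + s\<^sup>2 / CARD('n) * (\<Sum>j\<in>UNIV-{o1}. curv_form (A *v axis j 1) a \<xi>)))"
      unfolding q_def integral_quadratic_std_cylinder[OF rs(1,2) n bil] V_def[symmetric] ax dderiv_dderiv_test_norm2_sum[OF a]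
      by (simp add: sum_negf sum_distrib_left algebra_simps)
    have ip: "set_integrable lborel ?S (\<lambda>w. ?f (a + A *v w))"
      using ifP set_integral_orthogonal_image(2)[OF orth, of a ?S ?f]
        set_borel_measurable_continuous_open[OF open_translated cfP]
      unfolding cylinder_eq_image by simp
    have im: "set_integrable lborel ?S (\<lambda>w. ?f (a - A *v w))"
    proof -
      have "continuous_on (closure ?S) (\<lambda>w. ?f (a - A *v w))"
      proof (rule continuous_on_compose2[OF cf])
        show "continuous_on (closure ?S) (\<lambda>w. a - A *v w)"
          by (intro continuous_intros linear_continuous_on
              linear_conv_bounded_linear[THEN iffD1, OF linear_matrix_vector_mult_complex])
        have "closure ?S \<subseteq> {w. norm (A *v w) \<le> R}"
        proof (rule closure_minimal)
          have "continuous_on UNIV (\<lambda>w. norm (A *v w))"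
            by (intro continuous_on_norm linear_continuous_on
              linear_conv_bounded_linear[THEN iffD1, OF linear_matrix_vector_mult_complex])
          then show "closed {w. norm (A *v w) \<le> R}" by (intro closed_Collect_le continuous_on_const)
        qed (use nz(1) in auto)
        then have "a - A *v w \<in> cball a R" if "w \<in> closure ?S" for w
          using that by (auto simp: dist_norm)
        then show "(\<lambda>w. a - A *v w) ` closure ?S \<subseteq> U" using R(1) by blast
      qed
      then have "set_integrable lborel (closure ?S) (\<lambda>w. ?f (a - A *v w))"
        unfolding set_integrable_def
        by (rule borel_integrable_compact[rotated])
          (use bounded_std_cylinder[OF rs(1,2)] in \<open>simp add: compact_closure\<close>)
      then show ?thesis
        by (rule set_integrable_subset) (auto simp: std_cylinder_borel closure_subset)
    qed
    have 2: "2 * (LINT x:?P|lborel. ?f x) = (LINT w:?S|lborel. ?f (a + A *v w) + ?f (a - A *v w))"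
      using integral_cylinder[OF cfP] by (simp add: set_integral_add(2)[OF ip im])
    have ipm: "set_integrable lborel ?S (\<lambda>w. ?f (a + A *v w) + ?f (a - A *v w))"
      by (rule set_integral_add(1)[OF ip im])
    have ic: "set_integrable lborel ?S (\<lambda>w. c)" for c :: real
      by (rule set_integrable_continuous_bounded[OF bounded_std_cylinder[OF rs(1,2)] std_cylinder_borel continuous_on_const])
    define E where "E = C * (r\<^sup>2 + s\<^sup>2)\<^sup>2"
    have bound: "\<bar>?f (a + A *v w) + ?f (a - A *v w) - (2 * ?f a + q w)\<bar> \<le> E" if "w \<in> ?S" for w
    proof -
      have "\<bar>?f (a + A *v w) + ?f (a - A *v w) - 2 * ?f a - q w\<bar> \<le> C * norm (A *v w) ^ 4"
        unfolding q_def by (rule C(2)[OF nz(1)[OF that]])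
      also have "\<dots> \<le> E" unfolding E_def by (rule mult_left_mono[OF nz(2)[OF that] C(1)])
      finally show ?thesis by (simp add: diff_diff_eq)
    qed
    have Ic: "(LINT w:?S|lborel. 2 * ?f a + q w) = 2 * ?f a * V + (LINT w:?S|lborel. q w)"
      using set_integral_add(2)[OF ic[of "2 * ?f a"] iq] set_integral_const[OF std_cylinder_borel[of o1 r s], of "2 * ?f a"]
      by (simp add: V_def)
    have isum: "set_integrable lborel ?S (\<lambda>w. 2 * ?f a + q w)" by (rule set_integral_add(1)[OF ic iq])
    have up: "(LINT w:?S|lborel. ?f (a + A *v w) + ?f (a - A *v w)) \<le> (LINT w:?S|lborel. (2 * ?f a + q w) + E)"
      by (rule set_integral_mono[OF ipm set_integral_add(1)[OF isum ic]]) (use bound in \<open>force simp: abs_le_iff\<close>)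
    have lo: "(LINT w:?S|lborel. (2 * ?f a + q w) - E) \<le> (LINT w:?S|lborel. ?f (a + A *v w) + ?f (a - A *v w))"
      by (rule set_integral_mono[OF set_integral_diff(1)[OF isum ic] ipm]) (use bound in \<open>force simp: abs_le_iff\<close>)
    have cE: "(LINT w:?S|lborel. E) = E * V"
      using set_integral_const[OF std_cylinder_borel[of o1 r s], of E] by (simp add: V_def)
    have "\<bar>2 * (LINT x:?P|lborel. ?f x) - (2 * ?f a * V + (LINT w:?S|lborel. q w))\<bar> \<le> E * V"
      using up lo unfolding 2[symmetric] set_integral_add(2)[OF isum ic] set_integral_diff(2)[OF isum ic] cE Ic
      by (simp add: abs_le_iff)
    moreover have "0 \<le> E * V" using C(1) by (simp add: E_def V_def)
    ultimately have "\<bar>(LINT x:?P|lborel. ?f x) - (?f a * V + (LINT w:?S|lborel. q w) / 2)\<bar> \<le> E * V"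
      by (simp add: abs_le_iff)
    also have "?f a * V + (LINT w:?S|lborel. q w) / 2 = V * ((H a *v \<xi>) \<bullet> \<xi>
          - r\<^sup>2 / 2 * curv_form (A *v axis o1 1) a \<xi> - s\<^sup>2 / CARD('n) * (\<Sum>j\<in>UNIV-{o1}. curv_form (A *v axis j 1) a \<xi>))"
      unfolding Iq test_norm2_at[OF a] by (simp add: algebra_simps diff_divide_distrib)
    finally show ?thesis unfolding VD E_def .
  qed
  show ?thesis using C(1) main by blast
qed

lemma holomorphic_test_section:
  assumes a: "a \<in> U"
  shows "holomorphic_fun_on (\<lambda>x. test_section a \<xi> x $ \<alpha>) W"
proof -
  have lin: "linear (\<lambda>v. - \<theta> v a \<xi> $ \<alpha>)"
    by (intro linearI) (simp_all add: linear_add[OF linear_\<theta>[OF a]] linear_scale[OF linear_\<theta>[OF a]])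
  have "- \<theta> (\<i> *s v) a \<xi> $ \<alpha> = \<i> * (- \<theta> v a \<xi> $ \<alpha>)" for v
    by (simp add: \<theta>_imaginary[OF a])
  from holomorphic_fun_on_affine[OF lin linear_imp_complex_linear[OF lin this], of "\<xi> $ \<alpha>" a W]
  show ?thesis by (simp add: test_section_def)
qed

text \<open>
  The antilinear part of \<open>H e\<close> paired with a holomorphic function vanishing at \<open>a\<close> integrates to zero,
  and the rest of the mixed term is absorbed by the positive quadratic term of the competitor.
\<close>

lemma integral_lower_bound:
  fixes o1 :: 'n and \<xi> :: "complex^'r"
  assumes R: "cball a R \<subseteq> U" "R > 0"
  shows "\<exists>C\<ge>0. \<forall>r s A u. 0 < r \<and> 0 < s \<and> r\<^sup>2 + s\<^sup>2 \<le> R\<^sup>2 \<and> A \<in> unitary_group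
      \<and> (\<forall>\<alpha>. holomorphic_fun_on (\<lambda>x. u x $ \<alpha>) ((+) a ` cylinder o1 r s A)) \<and> u a = \<xi>
      \<and> set_integrable lborel ((+) a ` cylinder o1 r s A) (\<lambda>x. (H x *v u x) \<bullet> u x) \<longrightarrow>
     (LINT x:(+) a ` cylinder o1 r s A|lborel. test_norm2 a \<xi> x) - C * (r\<^sup>2 + s\<^sup>2)\<^sup>2 * measure lborel (cylinder o1 r s A)
      \<le> (LINT x:(+) a ` cylinder o1 r s A|lborel. (H x *v u x) \<bullet> u x)"
proof -
  have a: "a \<in> U" using R by auto
  let ?F = "test_dual a \<xi>" and ?e = "test_section a \<xi>"
  have dF: "?F differentiable (at a)" using Ck_on_test_dual[OF a] a by (simp add: numeral_eq_Suc Ck_on_Suc_iff)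
  obtain C1 where C1: "C1 \<ge> 0" "\<And>z. norm z \<le> R \<Longrightarrow> norm (?F (a + z) - ?F a - dderiv z ?F a) \<le> C1 * (norm z)\<^sup>2"
    using Taylor1_bound[OF open_U Ck_on_mono[OF _ Ck_on_test_dual[OF a]] R(1) a] by fastforce
  obtain c where c: "c > 0" "\<And>x u. x \<in> cball a R \<Longrightarrow> c * (norm u)\<^sup>2 \<le> (H x *v u) \<bullet> u"
    using coercive[OF R(1)] by blast
  \<comment> \<open>The constant and antilinear part of \<open>H e\<close>.\<close>
  define L where "L x = ?F a + dderiv (x - a) ?F a" for x
  have cL: "continuous_on X L" for X
    unfolding L_def[abs_def]
    by (intro continuous_on_add continuous_on_const continuous_on_diff continuous_on_id
        bounded_linear.continuous_on[OF linear_conv_bounded_linear[THEN iffD1, OF linear_dderiv[OF dF]]])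
  have ce: "continuous_on X ?e" for X using Ck_on_test_section[OF a, of 0 \<xi> X] by simp
  have "\<exists>N. \<forall>x\<in>cball a R. norm (?e x) \<le> N"
    using compact_imp_bounded[OF compact_continuous_image[OF ce compact_cball[of a R]]]
    unfolding bounded_iff by auto
  then obtain N1 where N1: "\<And>x. x \<in> cball a R \<Longrightarrow> norm (?e x) \<le> N1" by blast
  have "\<exists>N. \<forall>x\<in>cball a R. norm (L x) \<le> N"
    using compact_imp_bounded[OF compact_continuous_image[OF cL compact_cball[of a R]]]
    unfolding bounded_iff by auto
  then obtain N2 where N2: "\<And>x. x \<in> cball a R \<Longrightarrow> norm (L x) \<le> N2" by blast
  have cf: "continuous_on U (test_norm2 a \<xi>)" using Ck_on_mono[OF _ Ck_on_test_norm2[OF a], of 0] by simp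
  have main: "(LINT x:(+) a ` cylinder o1 r s A|lborel. test_norm2 a \<xi> x) - C1\<^sup>2 / c * (r\<^sup>2 + s\<^sup>2)\<^sup>2 * measure lborel (cylinder o1 r s A)
      \<le> (LINT x:(+) a ` cylinder o1 r s A|lborel. (H x *v u x) \<bullet> u x)"
    if rs0: "0 < r" "0 < s" "r\<^sup>2 + s\<^sup>2 \<le> R\<^sup>2" "A \<in> unitary_group"
      and hol: "\<And>\<alpha>. holomorphic_fun_on (\<lambda>x. u x $ \<alpha>) ((+) a ` cylinder o1 r s A)" and ua: "u a = \<xi>"
      and int: "set_integrable lborel ((+) a ` cylinder o1 r s A) (\<lambda>x. (H x *v u x) \<bullet> u x)"
    for r s A and u :: "complex^'n \<Rightarrow> complex^'r"
  proof -
    interpret unitary_cylinder o1 r s A using rs0 by unfold_locales auto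
    let ?P = "(+) a ` cylinder o1 r s A"
    define Q where "Q x = (H x *v u x) \<bullet> u x" for x
    define \<tau> where "\<tau> x = u x - ?e x" for x
    \<comment> \<open>Conjugation turns the antilinear factor into a holomorphic one.\<close>
    define G where "G x = (\<Sum>\<alpha>\<in>UNIV. cnj (L x $ \<alpha>) * \<tau> x $ \<alpha>)" for x
    have nz: "norm (x - a) \<le> R" "(norm (x - a))\<^sup>2 \<le> r\<^sup>2 + s\<^sup>2" if "x \<in> ?P" for x
    proof -
      show 1: "(norm (x - a))\<^sup>2 \<le> r\<^sup>2 + s\<^sup>2" by (rule norm_cylinder) (use that in auto)
      have "(norm (x - a))\<^sup>2 \<le> R\<^sup>2" using 1 rs0(3) by linarith
      then show "norm (x - a) \<le> R" by (rule power2_le_imp_le) (use R(2) in simp)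
    qed
    have Psub: "?P \<subseteq> cball a R" using nz(1) by (metis dist_commute dist_norm mem_cball subsetI)
    have ifP: "set_integrable lborel ?P (test_norm2 a \<xi>)"
      by (rule set_integrable_continuous_compact[OF compact_cball Psub continuous_on_subset[OF cf R(1)]])
    have ReG: "Re (G x) = L x \<bullet> \<tau> x" for x
      by (simp add: G_def inner_vec_def inner_complex_def)
    have holL: "holomorphic_fun_on (\<lambda>x. cnj (L x $ \<alpha>)) W" for \<alpha> W
    proof -
      have lin: "linear (\<lambda>v. cnj (dderiv v ?F a $ \<alpha>))"
        by (rule linearI) (simp_all add: dderiv_add_direction[OF dF] dderiv_scaleR_direction[OF dF])
      have "cnj (dderiv (\<i> *s v) ?F a $ \<alpha>) = \<i> * cnj (dderiv v ?F a $ \<alpha>)" for v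
        by (simp add: dderiv_test_dual_antilinear[OF a])
      from holomorphic_fun_on_affine[OF lin linear_imp_complex_linear[OF lin this], of "cnj (?F a $ \<alpha>)" a W]
      show ?thesis by (simp add: L_def)
    qed
    have holG: "holomorphic_fun_on G ?P"
      unfolding G_def[abs_def] \<tau>_def vector_minus_component
      by (intro holomorphic_fun_on_sum holomorphic_fun_on_mult holL holomorphic_fun_on_diff hol holomorphic_test_section a)
    have Ga: "G a = 0" by (simp add: G_def \<tau>_def ua test_section_at[OF a])
    have nu: "norm (\<tau> x) \<le> 1 + N1 + Q x / c" if x: "x \<in> ?P" for x
    proof -
      have xb: "x \<in> cball a R" using x Psub by blast
      have "norm (u x) \<le> 1 + (norm (u x))\<^sup>2"
        using zero_le_power2[of "norm (u x) - 1/2"] by (simp add: power2_eq_square algebra_simps)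
      also have "(norm (u x))\<^sup>2 \<le> Q x / c" using c(2)[OF xb, of "u x"] c(1) by (simp add: Q_def field_simps)
      finally have "norm (u x) \<le> 1 + Q x / c" by simp
      moreover have "norm (\<tau> x) \<le> norm (u x) + norm (?e x)" unfolding \<tau>_def by (rule norm_triangle_ineq4)
      ultimately show ?thesis using N1[OF xb] by linarith
    qed
    \<comment> \<open>Only \<open>Q\<close> is known to be integrable. It dominates \<open>G\<close> because \<open>G\<close> grows linearly in \<open>\<tau>\<close>.\<close>
    have Gbound: "norm (G x) \<le> (real CARD('r) * N2) * ((1 + N1) + Q x / c)" if x: "x \<in> ?P" for x
    proof -
      have xb: "x \<in> cball a R" using x Psub by blast
      have "norm (G x) \<le> (\<Sum>\<alpha>\<in>UNIV. norm (cnj (L x $ \<alpha>) * \<tau> x $ \<alpha>))" unfolding G_def by (rule norm_sum)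
      also have "\<dots> \<le> (\<Sum>\<alpha>\<in>(UNIV::'r set). N2 * (1 + N1 + Q x / c))"
      proof (rule sum_mono)
        fix \<alpha>
        have "norm (L x $ \<alpha>) \<le> N2" using N2[OF xb] Finite_Cartesian_Product.norm_nth_le[of "L x" \<alpha>] by linarith
        moreover have "norm (\<tau> x $ \<alpha>) \<le> 1 + N1 + Q x / c"
          using nu[OF x] Finite_Cartesian_Product.norm_nth_le[of "\<tau> x" \<alpha>] by linarith
        ultimately show "norm (cnj (L x $ \<alpha>) * \<tau> x $ \<alpha>) \<le> N2 * (1 + N1 + Q x / c)"
          unfolding norm_mult complex_mod_cnj by (intro mult_mono) (auto intro: order_trans[OF norm_ge_zero])
      qed
      finally show ?thesis by simp
    qed
    have intQ: "set_integrable lborel ?P Q" using int by (simp add: Q_def[abs_def])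
    have iG: "set_integrable lborel ?P G"
    proof (rule set_integrable_bound)
      show "set_integrable lborel ?P (\<lambda>x. (real CARD('r) * N2) * ((1 + N1) + Q x / c))"
        by (intro set_integrable_mult_right set_integral_add(1) set_integrable_const)
          (use set_integrable_mult_right[of "1/c", OF intQ] in simp)
      show "set_borel_measurable lborel ?P G"
        by (rule set_borel_measurable_continuous_open[OF open_translated holomorphic_fun_on_imp_continuous_on[OF holG]])
      show "AE x in lborel. x \<in> ?P \<longrightarrow> norm (G x) \<le> norm ((real CARD('r) * N2) * ((1 + N1) + Q x / c))"
        using Gbound by (intro AE_I2 impI) (metis abs_ge_self order_trans real_norm_def)
    qed
    have G0: "(LINT x:?P|lborel. G x) = 0"
      by (rule set_integral_holomorphic_circled_eq_0[OF open_cylinder cylinder_disc holG Ga iG])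
    have iRe: "set_integrable lborel ?P (\<lambda>x. Re (G x))" and Re0: "(LINT x:?P|lborel. Re (G x)) = 0"
      using integrable_bounded_linear[OF bounded_linear_Re iG[unfolded set_integrable_def]]
        integral_bounded_linear[OF bounded_linear_Re iG[unfolded set_integrable_def]] G0
      by (simp_all add: set_integrable_def set_lebesgue_integral_def)
    define E where "E = C1\<^sup>2 / c * (r\<^sup>2 + s\<^sup>2)\<^sup>2"
    \<comment> \<open>The positive quadratic term in \<open>\<tau>\<close> absorbs the linear remainder.\<close>
    have pt: "test_norm2 a \<xi> x + 2 * Re (G x) - E \<le> Q x" if x: "x \<in> ?P" for x
    proof -
      have xb: "x \<in> cball a R" "x \<in> U" using x Psub R(1) by blast+
      define t where "t = norm (\<tau> x)"
      define k where "k = C1 * (r\<^sup>2 + s\<^sup>2)"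
      have "Q x = test_norm2 a \<xi> x + 2 * (?F x \<bullet> \<tau> x) + (H x *v \<tau> x) \<bullet> \<tau> x"
        using completing_square[OF xb(2), of "?e x" "\<tau> x"] by (simp add: Q_def \<tau>_def test_norm2_def test_dual_def)
      moreover have "(H x *v \<tau> x) \<bullet> \<tau> x \<ge> c * t\<^sup>2" unfolding t_def by (rule c(2)[OF xb(1)])
      moreover have "?F x \<bullet> \<tau> x \<ge> L x \<bullet> \<tau> x - k * t"
      proof -
        have "norm (?F x - L x) \<le> C1 * (norm (x - a))\<^sup>2"
          using C1(2)[OF nz(1)[OF x]] by (simp add: L_def diff_diff_eq)
        also have "\<dots> \<le> k" unfolding k_def by (rule mult_left_mono[OF nz(2)[OF x] C1(1)])
        finally have "norm (?F x - L x) * norm (\<tau> x) \<le> k * t" unfolding t_def by (rule mult_right_mono) simp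
        moreover have "- (norm (?F x - L x) * norm (\<tau> x)) \<le> (?F x - L x) \<bullet> \<tau> x"
          using Cauchy_Schwarz_ineq2[of "?F x - L x" "\<tau> x"] by (simp add: abs_le_iff)
        ultimately show ?thesis by (simp add: inner_diff_left)
      qed
      moreover have "c * t\<^sup>2 - 2 * k * t \<ge> - (k\<^sup>2 / c)" by (rule quadratic_lower_bound[OF c(1)])
      moreover have "k\<^sup>2 / c = E" by (simp add: k_def E_def power_mult_distrib)
      ultimately show ?thesis unfolding ReG by linarith
    qed
    have i2: "set_integrable lborel ?P (\<lambda>x. 2 * Re (G x))" by (rule set_integrable_mult_right) (rule iRe)
    have i3: "set_integrable lborel ?P (\<lambda>x. test_norm2 a \<xi> x + 2 * Re (G x))" by (rule set_integral_add(1)[OF ifP i2])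
    have "(LINT x:?P|lborel. test_norm2 a \<xi> x + 2 * Re (G x) - E) \<le> (LINT x:?P|lborel. Q x)"
      by (rule set_integral_mono[OF set_integral_diff(1)[OF i3 set_integrable_const] intQ pt])
    also have "(LINT x:?P|lborel. test_norm2 a \<xi> x + 2 * Re (G x) - E)
       = (LINT x:?P|lborel. test_norm2 a \<xi> x) - E * measure lborel (cylinder o1 r s A)"
      unfolding set_integral_diff(2)[OF i3 set_integrable_const] set_integral_add(2)[OF ifP i2]
      using Re0 set_integral_const[OF measurable_cylinder(2)[of a], of E]
      by (simp add: measure_translated_cylinder measure_cylinder)
    finally show ?thesis by (simp add: Q_def E_def)
  qed
  show ?thesis using c(1) main by (intro exI[of _ "C1\<^sup>2 / c"]) auto
qed

end

section \<open>Hermitian bundles in a trivialization\<close>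

lemma sum_axis:
  fixes g :: "'i::finite \<Rightarrow> 'a::comm_monoid_add"
  shows "(\<Sum>i\<in>UNIV. axis i (g i)) = (\<chi> i. g i)"
  by (simp add: vec_eq_iff axis_def)

lemma complex_linear_eq_sum_axis:
  fixes g :: "complex^'r \<Rightarrow> complex"
  assumes "\<And>v w. g (v + w) = g v + g w" "\<And>c v. g (c *s v) = c * g v"
  shows "g v = (\<Sum>\<beta>\<in>UNIV. v $ \<beta> * g (axis \<beta> 1))"
proof -
  have g0: "g 0 = 0" using assms(2)[of 0 0] by simp
  have "g (\<Sum>\<beta>\<in>I. v $ \<beta> *s axis \<beta> 1) = (\<Sum>\<beta>\<in>I. v $ \<beta> * g (axis \<beta> 1))" for I
    by (induction I rule: infinite_finite_induct) (simp_all add: g0 assms)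
  from this[of UNIV] show ?thesis by (simp add: basis_expansion)
qed

context holomorphic_vector_bundle begin

definition lift :: "('e \<Rightarrow> complex^'r) \<Rightarrow> complex^'n \<Rightarrow> complex^'r \<Rightarrow> 'e"
  where "lift \<phi> x v = inv_into (fiber E x) \<phi> v"

lemma frame_eq_lift: "frame E \<phi> \<alpha> x = lift \<phi> x (axis \<alpha> 1)"
  by (simp add: frame_def lift_def)

context
  fixes U \<phi> x assumes triv: "(U, \<phi>) \<in> trivs E" and x: "x \<in> U"
begin

lemma x_in_base: "x \<in> \<Omega>" using trivs_open[OF triv] x by blast

lemma lift_in_fiber: "lift \<phi> x v \<in> fiber E x"
  unfolding lift_def using trivs_bij[OF triv x] by (metis bij_betw_imp_surj_on inv_into_into UNIV_I)

lemma triv_lift: "\<phi> (lift \<phi> x v) = v"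
  unfolding lift_def using trivs_bij[OF triv x] by (metis bij_betw_inv_into_right UNIV_I)

lemma lift_triv: "u \<in> fiber E x \<Longrightarrow> lift \<phi> x (\<phi> u) = u"
  unfolding lift_def using trivs_bij[OF triv x] by (simp add: bij_betw_inv_into_left)

lemma triv_inj: "u \<in> fiber E x \<Longrightarrow> v \<in> fiber E x \<Longrightarrow> \<phi> u = \<phi> v \<Longrightarrow> u = v"
  by (metis lift_triv)

lemma lift_add: "lift \<phi> x (v + w) = fib_add E (lift \<phi> x v) (lift \<phi> x w)"
  by (rule triv_inj)
    (simp_all add: lift_in_fiber triv_lift add_in x_in_base trivs_add[OF triv x])

lemma lift_scale: "lift \<phi> x (c *s v) = fib_scale E c (lift \<phi> x v)"
  by (rule triv_inj)
    (simp_all add: lift_in_fiber triv_lift scale_in x_in_base trivs_scale[OF triv x])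

lemma lift_eq_zero_iff: "u \<in> fiber E x \<Longrightarrow> \<phi> u = 0 \<longleftrightarrow> u = fib_zero E x"
  using triv_inj[of u "fib_zero E x"] zero_in[OF x_in_base] trivs_zero[OF triv x] by metis

end

text \<open>
  In another trivialization the coordinates are the given ones multiplied by the holomorphic
  transition matrix.
\<close>

lemma holomorphic_section_lift:
  fixes w :: "complex^'n \<Rightarrow> complex^'r"
  assumes triv: "(U, \<phi>) \<in> trivs E" and P: "open P" "P \<subseteq> U"
    and w: "\<And>\<beta>. holomorphic_fun_on (\<lambda>x. w x $ \<beta>) P"
  shows "holomorphic_section_on E P (\<lambda>x. lift \<phi> x (w x))"
  unfolding holomorphic_section_on_def
proof (intro conjI ballI allI, goal_cases)
  case (1 x)
  then show ?case using lift_in_fiber[OF triv] P by blast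
next
  case (2 V\<psi>)
  obtain V \<psi> where V: "V\<psi> = (V, \<psi>)" "(V, \<psi>) \<in> trivs E" using 2 by (cases V\<psi>) auto
  have "holomorphic_fun_on (\<lambda>x. \<psi> (lift \<phi> x (w x)) $ \<alpha>) (V \<inter> P)" for \<alpha>
  proof (rule holomorphic_fun_on_cong)
    show "open (V \<inter> P)" using trivs_open[OF V(2)] P by auto
    show "(\<Sum>\<beta>\<in>UNIV. w x $ \<beta> * \<psi> (frame E \<phi> \<beta> x) $ \<alpha>) = \<psi> (lift \<phi> x (w x)) $ \<alpha>" if "x \<in> V \<inter> P" for x
    proof -
      have x: "x \<in> V" "x \<in> U" using that P by auto
      note l = lift_in_fiber[OF triv x(2)] lift_add[OF triv x(2)] lift_scale[OF triv x(2)]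
      have "\<psi> (lift \<phi> x (w x)) $ \<alpha> = (\<Sum>\<beta>\<in>UNIV. w x $ \<beta> * \<psi> (lift \<phi> x (axis \<beta> 1)) $ \<alpha>)"
        by (rule complex_linear_eq_sum_axis[of "\<lambda>v. \<psi> (lift \<phi> x v) $ \<alpha>"])
          (simp_all add: l trivs_add[OF V(2) x(1)] trivs_scale[OF V(2) x(1)])
      then show ?thesis by (simp add: frame_eq_lift)
    qed
    show "holomorphic_fun_on (\<lambda>x. \<Sum>\<beta>\<in>UNIV. w x $ \<beta> * \<psi> (frame E \<phi> \<beta> x) $ \<alpha>) (V \<inter> P)"
    proof (intro holomorphic_fun_on_sum holomorphic_fun_on_mult)
      show "holomorphic_fun_on (\<lambda>x. w x $ \<beta>) (V \<inter> P)" for \<beta>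
        by (rule holomorphic_fun_on_subset[OF w]) simp
      show "holomorphic_fun_on (\<lambda>x. \<psi> (frame E \<phi> \<beta> x) $ \<alpha>) (V \<inter> P)" for \<beta>
        by (rule holomorphic_fun_on_subset[OF trivs_trans[OF triv V(2)]]) (use P in auto)
    qed
  qed
  then show ?case by (simp add: V)
qed

end

locale hermitian_bundle = holomorphic_vector_bundle \<Omega> E
  for \<Omega> :: "(complex^'n::finite) set" and E :: "('e, 'n, 'r::finite) vec_bundle" +
  fixes h :: "'e \<Rightarrow> 'e \<Rightarrow> complex"
  assumes metric: "smooth_hermitian_metric \<Omega> E h"
begin

lemma metric_add: "x \<in> \<Omega> \<Longrightarrow> u \<in> fiber E x \<Longrightarrow> v \<in> fiber E x \<Longrightarrow> w \<in> fiber E x \<Longrightarrow> h (fib_add E u v) w = h u w + h v w"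
  and metric_scale: "x \<in> \<Omega> \<Longrightarrow> u \<in> fiber E x \<Longrightarrow> v \<in> fiber E x \<Longrightarrow> h (fib_scale E c u) v = c * h u v"
  and metric_cnj: "x \<in> \<Omega> \<Longrightarrow> u \<in> fiber E x \<Longrightarrow> v \<in> fiber E x \<Longrightarrow> h v u = cnj (h u v)"
  and metric_pos: "x \<in> \<Omega> \<Longrightarrow> u \<in> fiber E x \<Longrightarrow> u \<noteq> fib_zero E x \<Longrightarrow> 0 < Re (h u u)"
  using metric unfolding smooth_hermitian_metric_def by blast+

lemma metric_smooth: "(U, \<phi>) \<in> trivs E \<Longrightarrow> smooth_on (\<lambda>x. h (frame E \<phi> \<alpha> x) (frame E \<phi> \<beta> x)) U"
  using metric unfolding smooth_hermitian_metric_def by blast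

context
  fixes U \<phi> assumes triv: "(U, \<phi>) \<in> trivs E"
begin

lemma metric_lift:
  assumes x: "x \<in> U"
  shows "h (lift \<phi> x v) (lift \<phi> x w) = (\<Sum>\<alpha>\<in>UNIV. (gram E h \<phi> x *v v) $ \<alpha> * cnj (w $ \<alpha>))"
proof -
  note l = lift_in_fiber[OF triv x] lift_add[OF triv x] lift_scale[OF triv x] x_in_base[OF triv x]
  let ?G = "\<lambda>v w. h (lift \<phi> x v) (lift \<phi> x w)"
  have left: "?G v w = (\<Sum>\<beta>\<in>UNIV. v $ \<beta> * ?G (axis \<beta> 1) w)" for v w
    by (rule complex_linear_eq_sum_axis[of "\<lambda>v. ?G v w"]) (simp_all add: l metric_add[of x] metric_scale[of x])
  have right: "?G v w = (\<Sum>\<alpha>\<in>UNIV. cnj (w $ \<alpha>) * ?G v (axis \<alpha> 1))" for v w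
  proof -
    have "?G v w = cnj (?G w v)" by (rule metric_cnj[of x]) (simp_all add: l)
    also have "\<dots> = (\<Sum>\<alpha>\<in>UNIV. cnj (w $ \<alpha>) * cnj (?G (axis \<alpha> 1) v))" by (subst left) simp
    also have "\<dots> = (\<Sum>\<alpha>\<in>UNIV. cnj (w $ \<alpha>) * ?G v (axis \<alpha> 1))"
      by (intro sum.cong refl arg_cong2[where f="(*)"] metric_cnj[of x, symmetric]) (simp_all add: l)
    finally show ?thesis .
  qed
  have "?G v w = (\<Sum>\<alpha>\<in>UNIV. cnj (w $ \<alpha>) * (\<Sum>\<beta>\<in>UNIV. v $ \<beta> * ?G (axis \<beta> 1) (axis \<alpha> 1)))"
    by (subst right) (subst left, rule refl)
  then show ?thesis
    by (simp add: gram_def frame_eq_lift matrix_vector_mult_def mult.commute)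
qed

lemma Re_metric_lift:
  assumes x: "x \<in> U"
  shows "Re (h (lift \<phi> x v) (lift \<phi> x w)) = (gram E h \<phi> x *v v) \<bullet> w"
  unfolding metric_lift[OF x] by (simp add: inner_vec_def inner_complex_def)

lemma hnorm2_eq_gram: "x \<in> U \<Longrightarrow> u \<in> fiber E x \<Longrightarrow> hnorm2 h u = (gram E h \<phi> x *v \<phi> u) \<bullet> \<phi> u"
  using Re_metric_lift[of x "\<phi> u" "\<phi> u"] by (simp add: hnorm2_def lift_triv[OF triv])

lemma hermitian_matrix_field_gram: "hermitian_matrix_field U (gram E h \<phi>)"
proof
  show U: "open U" using trivs_open[OF triv] by simp
  show "Ck_on 4 (gram E h \<phi>) U"
  proof (rule Ck_on_cong[OF U])
    have ax: "bounded_linear (axis \<alpha> :: 'z::euclidean_space \<Rightarrow> 'z^'r)" for \<alpha>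
      unfolding linear_conv_bounded_linear[symmetric] by (rule linearI) (simp_all add: axis_def vec_eq_iff)
    show "Ck_on 4 (\<lambda>x. \<Sum>\<alpha>\<in>UNIV. axis \<alpha> (\<Sum>\<beta>\<in>UNIV. axis \<beta> (h (frame E \<phi> \<beta> x) (frame E \<phi> \<alpha> x)))) U"
      by (intro Ck_on_sum U Ck_on_bounded_linear[OF U ax] Ck_on_smooth metric_smooth triv)
    show "(\<Sum>\<alpha>\<in>UNIV. axis \<alpha> (\<Sum>\<beta>\<in>UNIV. axis \<beta> (h (frame E \<phi> \<beta> x) (frame E \<phi> \<alpha> x)))) = gram E h \<phi> x" for x
      by (simp add: sum_axis gram_def)
  qed
  fix x u v assume x: "x \<in> U"
  note l = lift_in_fiber[OF triv x] x_in_base[OF triv x]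
  have "h (lift \<phi> x u) (lift \<phi> x v) = cnj (h (lift \<phi> x v) (lift \<phi> x u))"
    by (rule metric_cnj[of x]) (simp_all add: l)
  then show "(gram E h \<phi> x *v u) \<bullet> v = u \<bullet> (gram E h \<phi> x *v v)"
    by (simp add: Re_metric_lift[OF x, symmetric] inner_commute[of u])
  show "u \<noteq> 0 \<Longrightarrow> (gram E h \<phi> x *v u) \<bullet> u > 0"
    using metric_pos[of x "lift \<phi> x u"] lift_eq_zero_iff[OF triv x, of "lift \<phi> x u"]
    by (simp add: Re_metric_lift[OF x, symmetric] l triv_lift[OF triv x])
qed

end

text \<open>
  The definition of the curvature uses a trivialization selected by the choice operator; the
  statement is about that one.
\<close>

lemma Re_curvature:
  assumes a: "a \<in> \<Omega>" and \<xi>: "\<xi> \<in> fiber E a"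
  defines "\<phi> \<equiv> SOME \<phi>. \<exists>U. (U, \<phi>) \<in> trivs E \<and> a \<in> U"
  assumes triv: "(U, \<phi>) \<in> trivs E" and aU: "a \<in> U"
  shows "Re (h (chern_curvature E h a v \<xi>) \<xi>) = hermitian_matrix_field.curv_form (gram E h \<phi>) v a (\<phi> \<xi>)"
proof -
  interpret H: hermitian_matrix_field U "gram E h \<phi>" by (rule hermitian_matrix_field_gram[OF triv])
  have connection: "chern_connection E h \<phi> j y = H.connection j y" for j y
    by (simp add: chern_connection_def H.connection_def)
  have "chern_curvature E h a v \<xi> = lift \<phi> a (H.curvature v a *v \<phi> \<xi>)"
    unfolding chern_curvature_def \<phi>_def[symmetric] Let_def lift_def
    by (simp add: curvature_coeff_def H.curvature_def connection)
  then have "Re (h (chern_curvature E h a v \<xi>) \<xi>)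
     = Re (h (lift \<phi> a (H.curvature v a *v \<phi> \<xi>)) (lift \<phi> a (\<phi> \<xi>)))"
    by (simp add: lift_triv[OF triv aU \<xi>])
  also have "\<dots> = H.curv_form v a (\<phi> \<xi>)"
    by (simp add: Re_metric_lift[OF triv aU] H.inner_curvature[OF aU])
  finally show ?thesis .
qed

end

section \<open>Expansion of the extension index\<close>

theorem theorem1p2:
  fixes \<Omega> :: "(complex^'n::finite) set"
    and E :: "('e, 'n, 'r::finite) vec_bundle"
    and h :: "'e \<Rightarrow> 'e \<Rightarrow> complex"
    and a :: "complex^'n" and \<xi> :: 'e and o1 :: 'n
  assumes "CARD('n) \<ge> 2"
    and "open \<Omega>" and "connected \<Omega>"
    and "holomorphic_vector_bundle \<Omega> E"
    and "smooth_hermitian_metric \<Omega> E h"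
    and "a \<in> \<Omega>" and "\<xi> \<in> fiber E a" and "\<xi> \<noteq> fib_zero E a"
  shows "\<exists>C \<delta>. \<delta> > 0 \<and>
    (\<forall>r s A. 0 < r \<and> r < \<delta> \<and> 0 < s \<and> s < \<delta> \<and> A \<in> unitary_group \<and>
       (+) a ` cylinder o1 r s A \<subseteq> \<Omega> \<longrightarrow>
       \<bar>L2_extension_index E h o1 a r s A \<xi> -
         ereal (1
           - r\<^sup>2 / 2 * (Re (h (chern_curvature E h a (A *v axis o1 1) \<xi>) \<xi>) / hnorm2 h \<xi>)
           - s\<^sup>2 / real CARD('n) *
               (\<Sum>j\<in>UNIV - {o1}.
                  Re (h (chern_curvature E h a (A *v axis j 1) \<xi>) \<xi>) / hnorm2 h \<xi>))\<bar>
       \<le> ereal (C * (r\<^sup>2 + s\<^sup>2)\<^sup>2))"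
proof -
  note n = assms(1) and aO = assms(6) and \<xi> = assms(7,8)
  interpret B: holomorphic_vector_bundle \<Omega> E by (rule assms(4))
  interpret B: hermitian_bundle \<Omega> E h by unfold_locales (rule assms(5))
  define \<phi> where "\<phi> = (SOME \<phi>. \<exists>U. (U, \<phi>) \<in> trivs E \<and> a \<in> U)"
  have "\<exists>\<phi> U. (U, \<phi>) \<in> trivs E \<and> a \<in> U" using B.trivs_cover[OF aO] by blast
  then have "\<exists>U. (U, \<phi>) \<in> trivs E \<and> a \<in> U" unfolding \<phi>_def by (rule someI_ex)
  then obtain U where triv: "(U, \<phi>) \<in> trivs E" and aU: "a \<in> U" by blast
  interpret H: hermitian_matrix_field U "gram E h \<phi>" by (rule B.hermitian_matrix_field_gram[OF triv])
  define w where "w = \<phi> \<xi>"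
  have curvature: "Re (h (chern_curvature E h a v \<xi>) \<xi>) = H.curv_form v a w" for v
    unfolding w_def using B.Re_curvature[OF aO \<xi>(1), folded \<phi>_def, OF triv aU] by simp
  define N where "N = hnorm2 h \<xi>"
  have N: "N > 0" unfolding N_def hnorm2_def by (rule B.metric_pos[OF aO \<xi>])
  have Nw: "(gram E h \<phi> a *v w) \<bullet> w = N"
    unfolding N_def w_def by (rule B.hnorm2_eq_gram[OF triv aU \<xi>(1), symmetric])
  obtain R0 where "R0 > 0" "ball a R0 \<subseteq> U" using H.open_U aU open_contains_ball by blast
  then obtain R where R: "R > 0" "cball a R \<subseteq> U"
    by (intro that[of "R0 / 2"]) (auto simp: subset_eq)
  let ?Q = "\<lambda>r s A. 1 - r\<^sup>2 / 2 * (H.curv_form (A *v axis o1 1) a w / N)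
           - s\<^sup>2 / real CARD('n) * (\<Sum>j\<in>UNIV - {o1}. H.curv_form (A *v axis j 1) a w / N)"
  obtain C1 where C1: "C1 \<ge> 0" "\<And>r s A. 0 < r \<Longrightarrow> 0 < s \<Longrightarrow> r\<^sup>2 + s\<^sup>2 \<le> R\<^sup>2 \<Longrightarrow> A \<in> unitary_group \<Longrightarrow>
     \<bar>(LINT x:(+) a ` cylinder o1 r s A|lborel. H.test_norm2 a w x)
       - measure lborel (cylinder o1 r s A) * ((gram E h \<phi> a *v w) \<bullet> w
          - r\<^sup>2 / 2 * H.curv_form (A *v axis o1 1) a w - s\<^sup>2 / CARD('n) * (\<Sum>j\<in>UNIV-{o1}. H.curv_form (A *v axis j 1) a w))\<bar>
     \<le> C1 * (r\<^sup>2 + s\<^sup>2)\<^sup>2 * measure lborel (cylinder o1 r s A)"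
    using H.integral_test_norm2_expansion[OF R(2,1) n, of o1 w] by blast
  obtain C2 where C2: "C2 \<ge> 0" "\<And>r s A u. 0 < r \<Longrightarrow> 0 < s \<Longrightarrow> r\<^sup>2 + s\<^sup>2 \<le> R\<^sup>2 \<Longrightarrow> A \<in> unitary_group
      \<Longrightarrow> (\<forall>\<alpha>. holomorphic_fun_on (\<lambda>x. u x $ \<alpha>) ((+) a ` cylinder o1 r s A)) \<Longrightarrow> u a = w
      \<Longrightarrow> set_integrable lborel ((+) a ` cylinder o1 r s A) (\<lambda>x. (gram E h \<phi> x *v u x) \<bullet> u x) \<Longrightarrow>
     (LINT x:(+) a ` cylinder o1 r s A|lborel. H.test_norm2 a w x) - C2 * (r\<^sup>2 + s\<^sup>2)\<^sup>2 * measure lborel (cylinder o1 r s A)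
      \<le> (LINT x:(+) a ` cylinder o1 r s A|lborel. (gram E h \<phi> x *v u x) \<bullet> u x)"
    using H.integral_lower_bound[OF R(2,1), of o1 w] by blast
  \<comment> \<open>For radii below \<open>R / 2\<close> the cylinder lies in the ball of radius \<open>R\<close>, where all bounds hold.\<close>
  have main: "\<bar>L2_extension_index E h o1 a r s A \<xi> - ereal (?Q r s A)\<bar> \<le> ereal ((C1 + C2) / N * (r\<^sup>2 + s\<^sup>2)\<^sup>2)"
    if rs0: "0 < r" "r < R / 2" "0 < s" "s < R / 2" "A \<in> unitary_group" for r s A
  proof -
    interpret unitary_cylinder o1 r s A using rs0 by unfold_locales auto
    let ?P = "(+) a ` cylinder o1 r s A"
    define V where "V = measure lborel (cylinder o1 r s A)"
    have V: "V > 0" unfolding V_def measure_cylinder by (rule measure_std_cylinder_pos[OF rs0(1,3)])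
    have rsR: "r\<^sup>2 + s\<^sup>2 \<le> R\<^sup>2"
    proof -
      have "r\<^sup>2 \<le> (R/2)\<^sup>2" "s\<^sup>2 \<le> (R/2)\<^sup>2" using rs0 by (auto intro!: power_mono)
      moreover have "(R/2)\<^sup>2 = R\<^sup>2 / 4" by (simp add: power_divide)
      ultimately show ?thesis using zero_le_power2[of R] by linarith
    qed
    have Pc: "?P \<subseteq> cball a R"
    proof
      fix x assume "x \<in> ?P"
      then obtain z where z: "x = a + z" "z \<in> cylinder o1 r s A" by auto
      have "(norm z)\<^sup>2 \<le> R\<^sup>2" using norm_cylinder[OF z(2)] rsR by linarith
      then have "norm z \<le> R" by (rule power2_le_imp_le) (use R(1) in simp)
      then show "x \<in> cball a R" by (simp add: z(1) dist_norm)
    qed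
    have PU: "?P \<subseteq> U" using Pc R(2) by blast
    have aP: "a \<in> ?P" using zero_in_cylinder by force
    define \<rho> where "\<rho> = (r\<^sup>2 + s\<^sup>2)\<^sup>2"
    define I where "I = (LINT x:?P|lborel. H.test_norm2 a w x)"
    have exp: "\<bar>I - V * (N * ?Q r s A)\<bar> \<le> C1 * \<rho> * V"
    proof -
      have "N * ?Q r s A = N - r\<^sup>2 / 2 * H.curv_form (A *v axis o1 1) a w - s\<^sup>2 / CARD('n) * (\<Sum>j\<in>UNIV-{o1}. H.curv_form (A *v axis j 1) a w)"
        using N by (simp add: sum_divide_distrib[symmetric] right_diff_distrib)
      then show ?thesis using C1(2)[OF rs0(1,3) rsR rs0(5)] by (simp add: Nw I_def V_def \<rho>_def)
    qed
    let ?val = "\<lambda>\<sigma>. (LINT x:?P|lborel. hnorm2 h (\<sigma> x)) / (V * N)"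
    have scale: "X / (V * N) - ?Q r s A = (X - V * (N * ?Q r s A)) / (V * N)" for X
      using V N by (simp add: diff_divide_distrib)
    have cancel: "X * V / (V * N) = X / N" for X using V by simp
    have index: "L2_extension_index E h o1 a r s A \<xi> = (INF \<sigma>\<in>{\<sigma> \<in> A2 E h ?P. \<sigma> a = \<xi>}. ereal (?val \<sigma>))"
      by (simp add: L2_extension_index_def V_def N_def)
    have lower: "?Q r s A - (C1 + C2) / N * \<rho> \<le> ?val \<sigma>" if \<sigma>: "\<sigma> \<in> A2 E h ?P" "\<sigma> a = \<xi>" for \<sigma>
    proof -
      define u where "u x = \<phi> (\<sigma> x)" for x
      have sec: "holomorphic_section_on E ?P \<sigma>" and int: "set_integrable lborel ?P (\<lambda>x. hnorm2 h (\<sigma> x))"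
        using \<sigma>(1) by (auto simp: A2_def)
      have fib: "\<sigma> x \<in> fiber E x" if "x \<in> ?P" for x using sec that unfolding holomorphic_section_on_def by blast
      have UP: "U \<inter> ?P = ?P" using PU by blast
      have hol: "\<forall>\<alpha>. holomorphic_fun_on (\<lambda>x. u x $ \<alpha>) ?P"
        using sec triv unfolding holomorphic_section_on_def u_def by (force simp: UP)
      have eq: "hnorm2 h (\<sigma> x) = (gram E h \<phi> x *v u x) \<bullet> u x" if "x \<in> ?P" for x
        unfolding u_def by (rule B.hnorm2_eq_gram[OF triv _ fib[OF that]]) (use PU that in blast)
      have intu: "set_integrable lborel ?P (\<lambda>x. (gram E h \<phi> x *v u x) \<bullet> u x)"
        using int by (rule set_integrable_cong[THEN iffD1, rotated -1]) (simp_all add: eq)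
      have "I - C2 * \<rho> * V \<le> (LINT x:?P|lborel. (gram E h \<phi> x *v u x) \<bullet> u x)"
        unfolding I_def \<rho>_def V_def
        by (rule C2(2)[OF rs0(1,3) rsR rs0(5) hol _ intu]) (simp add: u_def \<sigma>(2) w_def)
      also have "\<dots> = (LINT x:?P|lborel. hnorm2 h (\<sigma> x))"
        by (rule set_lebesgue_integral_cong) (use eq measurable_cylinder(2) in auto)
      finally have "- ((C1 + C2) * \<rho> * V) \<le> (LINT x:?P|lborel. hnorm2 h (\<sigma> x)) - V * (N * ?Q r s A)"
        using exp by (simp add: abs_le_iff algebra_simps)
      then have "- ((C1 + C2) * \<rho> * V) / (V * N) \<le> ?val \<sigma> - ?Q r s A"
        unfolding scale using V N by (intro divide_right_mono) auto
      also have "- ((C1 + C2) * \<rho> * V) / (V * N) = - ((C1 + C2) / N * \<rho>)"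
        unfolding minus_divide_left[symmetric] cancel by simp
      finally show ?thesis by linarith
    qed
    have upper: "\<exists>\<sigma>\<in>{\<sigma> \<in> A2 E h ?P. \<sigma> a = \<xi>}. ?val \<sigma> \<le> ?Q r s A + (C1 + C2) / N * \<rho>"
    proof
      let ?\<sigma> = "\<lambda>x. B.lift \<phi> x (H.test_section a w x)"
      have val: "hnorm2 h (?\<sigma> x) = H.test_norm2 a w x" if "x \<in> ?P" for x
        using B.Re_metric_lift[OF triv] PU that by (auto simp: hnorm2_def H.test_norm2_def H.test_dual_def)
      have "holomorphic_section_on E ?P ?\<sigma>"
        by (rule B.holomorphic_section_lift[OF triv open_translated PU H.holomorphic_test_section[OF aU]])
      moreover have "set_integrable lborel ?P (\<lambda>x. hnorm2 h (?\<sigma> x))"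
      proof -
        have "continuous_on U (H.test_norm2 a w)" using Ck_on_mono[OF _ H.Ck_on_test_norm2[OF aU], of 0] by simp
        then have "set_integrable lborel ?P (H.test_norm2 a w)"
          by (intro set_integrable_continuous_compact[OF compact_cball Pc] continuous_on_subset[OF _ R(2)])
        then show ?thesis
          by (rule set_integrable_cong[THEN iffD1, rotated -1]) (simp_all add: val)
      qed
      moreover have "?\<sigma> a = \<xi>" by (simp add: H.test_section_at[OF aU] w_def B.lift_triv[OF triv aU \<xi>(1)])
      ultimately show "?\<sigma> \<in> {\<sigma> \<in> A2 E h ?P. \<sigma> a = \<xi>}" by (simp add: A2_def)
      have "(LINT x:?P|lborel. hnorm2 h (?\<sigma> x)) = I"
        unfolding I_def by (rule set_lebesgue_integral_cong) (use val measurable_cylinder(2) in auto)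
      moreover have "I - V * (N * ?Q r s A) \<le> (C1 + C2) * \<rho> * V"
      proof -
        have "0 \<le> C2 * \<rho> * V" using C2(1) V by (simp add: \<rho>_def)
        then show ?thesis using exp by (simp add: abs_le_iff algebra_simps)
      qed
      ultimately have "?val ?\<sigma> - ?Q r s A \<le> (C1 + C2) * \<rho> * V / (V * N)"
        unfolding scale using V N by (intro divide_right_mono) auto
      also have "(C1 + C2) * \<rho> * V / (V * N) = (C1 + C2) / N * \<rho>" unfolding cancel by simp
      finally show "?val ?\<sigma> \<le> ?Q r s A + (C1 + C2) / N * \<rho>" by linarith
    qed
    have "ereal (?Q r s A - (C1 + C2) / N * \<rho>) \<le> L2_extension_index E h o1 a r s A \<xi>"
      unfolding index by (rule INF_greatest) (use lower in simp)
    moreover have "L2_extension_index E h o1 a r s A \<xi> \<le> ereal (?Q r s A + (C1 + C2) / N * \<rho>)"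
      unfolding index using upper by (force intro: INF_lower2)
    ultimately show ?thesis
      unfolding \<rho>_def[symmetric]
      by (cases "L2_extension_index E h o1 a r s A \<xi>") (auto simp: abs_le_iff)
  qed
  show ?thesis
    unfolding curvature N_def[symmetric]
    by (rule exI[of _ "(C1 + C2) / N"], rule exI[of _ "R / 2"]) (use main R(1) in auto)
qed

end
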